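(* Assume that $D\subset\Omega$ is open and symmetric with respect to the $x$-axis (that is, $(x,y)\in D$ if and only if $(x,-y)\in D$, for all $(x,y)\in\Omega$), and let $p\in\,]1,\infty]$. Consider either of the energies $\mathbb{E}_1$ or $\mathbb{E}_2$. Then the maximization problem $$\max\{\mathcal{G}^\infty_{f,D}:\ f\in L^p(\Omega),\ \|f\|_{L^p}=1\}\qquad(\ast)$$ is equivalent to the maximization problem $$\max\{\mathcal{G}^\infty_{f,D}:\ f\in L^p(\Omega),\ f\text{ odd in }y,\ \|f\|_{L^p}=1\},$$ in the sense that both maxima are attained and they coincide. If $1<p<\infty$, then any maximizer of $(\ast)$ is necessarily odd with respect to $y$. If $p=\infty$ and an odd maximizer $f$ satisfies $|f(x,y)|<1$ on a subset of $\Omega$ of positive measure, then there exist infinitely many maximizers $g\in L^\infty(\Omega)$ of $(\ast)$ such that $g^e\neq 0$ and $\|g\|_{L^\infty}=1$.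
   Context: Let $\ell>0$, $\Omega=\,]0,\pi[\,\times\,]-\ell,\ell[\,\subset\mathbb{R}^2$, and let $0<\sigma<1$ and $d>0$ be fixed constants. Let $H^2_*(\Omega)=\{v\in H^2(\Omega): v=0 \text{ on } \{0,\pi\}\times\,]-\ell,\ell[\,\}$ (recall $H^2(\Omega)\subset C^0(\overline\Omega)$). For an open $D\subset\Omega$ set $$(u,v)_D=\int_D\left[\Delta u\,\Delta v+(1-\sigma)(2u_{xy}v_{xy}-u_{xx}v_{yy}-u_{yy}v_{xx})\right]dxdy,\qquad (u,v)_{H^2_*}=(u,v)_\Omega .$$ With $(\cdot,\cdot)_{H^2_*}$, $H^2_*(\Omega)$ is a Hilbert space, and the associated norm is equivalent to the $H^2$ norm. Given $f\in L^p(\Omega)$ and an open set $D\subset\Omega$, $u_{f,D}\in H^2_*(\Omega)$ denotes the unique minimizer on $H^2_*(\Omega)$ of one of the following energies: - $\mathbb{E}_1(u)=\int_\Omega\left[(1+d\chi_D)\left(\frac{(\Delta u)^2}{2}+(1-\sigma)(u_{xy}^2-u_{xx}u_{yy})\right)-fu\right]dxdy$; equivalently $(u_{f,D},v)_{H^2_*}+d\,(u_{f,D},v)_D=\int_\Omega fv\,dxdy$ for all $v\in H^2_*(\Omega)$; - $\mathbb{E}_2(u)=\int_\Omega\left[\frac{(\Delta u)^2}{2}+(1-\sigma)(u_{xy}^2-u_{xx}u_{yy})-\frac{fu}{1+d\chi_D}\right]dxdy$; equivalently $(u_{f,D},v)_{H^2_*}=\int_\Omega\frac{fv}{1+d\chi_D}\,dxdy$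 for all $v\in H^2_*(\Omega)$. The maximal gap is $\mathcal{G}^\infty_{f,D}=\max_{x\in[0,\pi]}|u_{f,D}(x,\ell)-u_{f,D}(x,-\ell)|$. For a function $g$ on $\Omega$, its even part with respect to $y$ is $g^e(x,y)=\frac{g(x,y)+g(x,-y)}{2}$; "odd in $y$" means $g(x,-y)=-g(x,y)$ for a.e. $(x,y)\in\Omega$. *)

theory Defs
  imports "HOL-Analysis.Analysis" "HOL-Probability.Essential_Supremum"
begin

section \<open>Lebesgue spaces\<close>

text \<open>
  Members of \<open>L\<^sup>p\<close> are represented by functions; equality in \<open>L\<^sup>p\<close> is equality almost everywhere.
  The exponent ranges over the extended reals.
\<close>

definition lp_space :: "'a measure \<Rightarrow> ereal \<Rightarrow> ('a \<Rightarrow> real) set" where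
  "lp_space M p = {f \<in> borel_measurable M.
     if p = \<infinity> then esssup M (\<lambda>z. ereal \<bar>f z\<bar>) < \<infinity>
     else integrable M (\<lambda>z. \<bar>f z\<bar> powr real_of_ereal p)}"

definition lp_norm :: "'a measure \<Rightarrow> ereal \<Rightarrow> ('a \<Rightarrow> real) \<Rightarrow> real" where
  "lp_norm M p f =
     (if p = \<infinity> then real_of_ereal (esssup M (\<lambda>z. ereal \<bar>f z\<bar>))
      else (LINT z|M. \<bar>f z\<bar> powr real_of_ereal p) powr (1 / real_of_ereal p))"

definition lp_sphere :: "'a measure \<Rightarrow> ereal \<Rightarrow> ('a \<Rightarrow> real) set" where
  "lp_sphere M p = {f \<in> lp_space M p. lp_norm M p f = 1}"

definition ae_eq :: "'a measure \<Rightarrow> (('a \<Rightarrow> real) \<times> ('a \<Rightarrow> real)) set" where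
  "ae_eq M = {(f, g). AE z in M. f z = g z}"


section \<open>Weak derivatives and the Sobolev spaces \<open>H\<^sup>k\<close>\<close>

primrec times_cont_differentiable :: "nat \<Rightarrow> ('a::euclidean_space \<Rightarrow> real) \<Rightarrow> bool" where
  "times_cont_differentiable 0 f \<longleftrightarrow> continuous_on UNIV f"
| "times_cont_differentiable (Suc k) f \<longleftrightarrow> (\<forall>z. f differentiable (at z)) \<and>
     (\<forall>e\<in>Basis. times_cont_differentiable k (\<lambda>z. frechet_derivative f (at z) e))"

definition test_functions :: "'a::euclidean_space set \<Rightarrow> ('a \<Rightarrow> real) set" where
  "test_functions S = {\<phi>. (\<forall>k. times_cont_differentiable k \<phi>) \<and>
     (\<exists>K. compact K \<and> K \<subseteq> S \<and> (\<forall>z. z \<notin> K \<longrightarrow> \<phi> z = 0))}"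

definition locally_integrable :: "'a::euclidean_space set \<Rightarrow> ('a \<Rightarrow> real) \<Rightarrow> bool" where
  "locally_integrable S u \<longleftrightarrow> (\<forall>K. compact K \<and> K \<subseteq> S \<longrightarrow> integrable (lebesgue_on K) u)"

definition has_weak_partial ::
  "'a::euclidean_space set \<Rightarrow> 'a \<Rightarrow> ('a \<Rightarrow> real) \<Rightarrow> ('a \<Rightarrow> real) \<Rightarrow> bool" where
  "has_weak_partial S e u g \<longleftrightarrow> locally_integrable S u \<and> locally_integrable S g \<and>
     (\<forall>\<phi>\<in>test_functions S.
        (LINT z|lebesgue_on S. u z * frechet_derivative \<phi> (at z) e) =
        - (LINT z|lebesgue_on S. g z * \<phi> z))"

text \<open>A weak partial derivative is determined almost everywhere; some representative is chosen.\<close>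

definition weak_partial ::
  "'a::euclidean_space set \<Rightarrow> 'a \<Rightarrow> ('a \<Rightarrow> real) \<Rightarrow> ('a \<Rightarrow> real)" where
  "weak_partial S e u = (SOME g. has_weak_partial S e u g)"

primrec sobolev_H :: "nat \<Rightarrow> 'a::euclidean_space set \<Rightarrow> ('a \<Rightarrow> real) set" where
  "sobolev_H 0 S = lp_space (lebesgue_on S) 2"
| "sobolev_H (Suc k) S = {u \<in> lp_space (lebesgue_on S) 2.
     \<forall>e\<in>Basis. \<exists>g\<in>sobolev_H k S. has_weak_partial S e u g}"


section \<open>The plate, its energies and the maximal gap\<close>

definition plate :: "real \<Rightarrow> (real \<times> real) set" where
  "plate l = {0<..<pi} \<times> {-l<..<l}"

text \<open>
  By the Sobolev embedding every class in \<open>H\<^sup>2\<close> of the plate has exactly one representative that is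
  continuous on the closed plate. It is this representative, extended by zero off the closed
  plate, that stands for the class below, so that pointwise values are meaningful and distinct
  functions are distinct elements of the space.
\<close>

definition H2_star :: "real \<Rightarrow> (real \<times> real \<Rightarrow> real) set" where
  "H2_star l = {v \<in> sobolev_H 2 (plate l).
     continuous_on (closure (plate l)) v \<and> (\<forall>z. z \<notin> closure (plate l) \<longrightarrow> v z = 0) \<and>
     (\<forall>x\<in>{0, pi}. \<forall>y\<in>{-l<..<l}. v (x, y) = 0)}"

definition D_xx :: "real \<Rightarrow> (real \<times> real \<Rightarrow> real) \<Rightarrow> (real \<times> real \<Rightarrow> real)" where
  "D_xx l u = weak_partial (plate l) (1, 0) (weak_partial (plate l) (1, 0) u)"

definition D_xy :: "real \<Rightarrow> (real \<times> real \<Rightarrow> real) \<Rightarrow> (real \<times> real \<Rightarrow> real)" where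
  "D_xy l u = weak_partial (plate l) (0, 1) (weak_partial (plate l) (1, 0) u)"

definition D_yy :: "real \<Rightarrow> (real \<times> real \<Rightarrow> real) \<Rightarrow> (real \<times> real \<Rightarrow> real)" where
  "D_yy l u = weak_partial (plate l) (0, 1) (weak_partial (plate l) (0, 1) u)"

definition laplacian :: "real \<Rightarrow> (real \<times> real \<Rightarrow> real) \<Rightarrow> (real \<times> real \<Rightarrow> real)" where
  "laplacian l u = (\<lambda>z. D_xx l u z + D_yy l u z)"

definition bending_density ::
  "real \<Rightarrow> real \<Rightarrow> (real \<times> real \<Rightarrow> real) \<Rightarrow> (real \<times> real \<Rightarrow> real)" where
  "bending_density l \<sigma> u = (\<lambda>z. (laplacian l u z)\<^sup>2 / 2 +
     (1 - \<sigma>) * ((D_xy l u z)\<^sup>2 - D_xx l u z * D_yy l u z))"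

definition energy1 ::
  "real \<Rightarrow> real \<Rightarrow> real \<Rightarrow> (real \<times> real) set \<Rightarrow> (real \<times> real \<Rightarrow> real) \<Rightarrow> (real \<times> real \<Rightarrow> real) \<Rightarrow> real"
  where "energy1 l \<sigma> d D f u = (LINT z|lebesgue_on (plate l).
     (1 + d * indicator D z) * bending_density l \<sigma> u z - f z * u z)"

definition energy2 ::
  "real \<Rightarrow> real \<Rightarrow> real \<Rightarrow> (real \<times> real) set \<Rightarrow> (real \<times> real \<Rightarrow> real) \<Rightarrow> (real \<times> real \<Rightarrow> real) \<Rightarrow> real"
  where "energy2 l \<sigma> d D f u = (LINT z|lebesgue_on (plate l).
     bending_density l \<sigma> u z - f z * u z / (1 + d * indicator D z))"

definition energy_minimizer ::
  "real \<Rightarrow> ((real \<times> real \<Rightarrow> real) \<Rightarrow> real) \<Rightarrow> (real \<times> real \<Rightarrow> real)" where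
  "energy_minimizer l E = (THE u. is_arg_min E (\<lambda>v. v \<in> H2_star l) u)"

text \<open>
  \<open>E\<close> maps a load to the corresponding energy. The supremum is a maximum, because
  the minimizer is continuous on the closed plate.
\<close>

definition maximal_gap ::
  "real \<Rightarrow> ((real \<times> real \<Rightarrow> real) \<Rightarrow> (real \<times> real \<Rightarrow> real) \<Rightarrow> real) \<Rightarrow> (real \<times> real \<Rightarrow> real) \<Rightarrow> real"
  where "maximal_gap l E f =
     (SUP x\<in>{0..pi}. \<bar>energy_minimizer l (E f) (x, l) - energy_minimizer l (E f) (x, - l)\<bar>)"

definition even_part :: "(real \<times> real \<Rightarrow> real) \<Rightarrow> (real \<times> real \<Rightarrow> real)" where
  "even_part g = (\<lambda>(x, y). (g (x, y) + g (x, - y)) / 2)"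

definition odd_in_y :: "real \<Rightarrow> (real \<times> real \<Rightarrow> real) \<Rightarrow> bool" where
  "odd_in_y l g \<longleftrightarrow> (AE (x, y) in lebesgue_on (plate l). g (x, - y) = - g (x, y))"

end

theory Submission
  imports Defs
begin

text \<open>
  Weak derivatives on the plate are primitives along lines, which gives
  \<open>|u| \<le> C (\<parallel>u\<^sub>x\<^sub>x\<parallel> + \<parallel>u\<^sub>x\<^sub>y\<parallel>)\<close> and bounds on the first derivatives for \<open>u\<close> vanishing on the vertical
  sides; hence the space is complete for the energy form and point evaluations are bounded. Let \<open>w\<^sub>x\<close>
  represent \<open>v \<mapsto> v (x, l) - v (x, -l)\<close>. The gap at \<open>x\<close> of the solution with load \<open>f\<close> is then the integral
  of \<open>f\<close> against the kernel \<open>w\<^sub>x\<close> (weighted by \<open>1 / (1 + d \<chi>\<^sub>D)\<close> for the second energy), which is odd in \<open>y\<close> by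
  symmetry of \<open>D\<close> and depends continuously on \<open>x\<close>. By Hoelder's inequality the largest gap is the
  maximum over \<open>x\<close> of the dual norm of the kernel, attained at an odd load. The even part of a load is
  invisible to an odd kernel, so a maximizer that is not odd could be improved when the norm is
  strictly convex, while for \<open>p = \<infinity>\<close> an even perturbation fits wherever \<open>|f| < 1\<close>.
\<close>

section \<open>Riesz representation in a form-normed function space\<close>

text \<open>Both energies are one problem with two even weights, \<open>\<omega>\<close> on the
  bending density and \<open>\<kappa>\<close> on the load: 1 + d \<chi> and 1 for the first, 1 and 1
  / (1 + d \<chi>) for the second. Symmetry of D enters only as evenness of these weights. The
  analytic obstacle is that second derivatives are chosen representatives, known only almost
  everywhere. Linear combinations, limits and reflections are therefore carried out on jets, that
  is, functions together with explicit representatives of their derivatives up to order two. The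
  pointwise bounds use the vertical sides twice: u_x has integral zero over almost every horizontal
  line, so u_xx controls it; and u_y has trace zero on x = 0, so u_xy controls it. The trace
  statement cannot be read off from u_y itself and is obtained by letting x tend to 0 in differences
  u(x, y2) - u(x, y1). In the maximization everything rests on a positive maximum: it normalizes the
  extremal load and makes the comparison arguments strict. Positivity comes from sin x * y, which
  belongs to the space and has gap 2 l at x = pi / 2.\<close>

locale form_space =
  fixes V :: "('b \<Rightarrow> real) set" and a :: "('b \<Rightarrow> real) \<Rightarrow> ('b \<Rightarrow> real) \<Rightarrow> real" and C :: real
  assumes zero_mem: "(\<lambda>z. 0) \<in> V"
    and comb: "u \<in> V \<Longrightarrow> v \<in> V \<Longrightarrow> (\<lambda>z. s * u z + t * v z) \<in> V"
    and sym: "u \<in> V \<Longrightarrow> v \<in> V \<Longrightarrow> a u v = a v u"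
    and lin: "u \<in> V \<Longrightarrow> v \<in> V \<Longrightarrow> w \<in> V \<Longrightarrow> a (\<lambda>z. s * u z + t * v z) w = s * a u w + t * a v w"
    and nonneg: "u \<in> V \<Longrightarrow> 0 \<le> a u u"
    and eval: "u \<in> V \<Longrightarrow> \<bar>u z\<bar> \<le> C * sqrt (a u u)"
    and complete: "(\<And>n. X n \<in> V) \<Longrightarrow>
      (\<And>e. e > 0 \<Longrightarrow> \<exists>N. \<forall>m\<ge>N. \<forall>n\<ge>N. a (\<lambda>z. X m z - X n z) (\<lambda>z. X m z - X n z) < e) \<Longrightarrow>
      \<exists>u\<in>V. (\<lambda>n. a (\<lambda>z. X n z - u z) (\<lambda>z. X n z - u z)) \<longlonglongrightarrow> 0"
begin

lemma diff_mem: "u \<in> V \<Longrightarrow> v \<in> V \<Longrightarrow> (\<lambda>z. u z - v z) \<in> V"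
  using comb[of u v 1 "-1"] by simp

lemma lin_right:
  assumes "u \<in> V" "v \<in> V" "w \<in> V"
  shows "a w (\<lambda>z. s * u z + t * v z) = s * a w u + t * a w v"
  using lin[OF assms] sym assms comb by metis

lemma square_comb:
  assumes "u \<in> V" "v \<in> V"
  shows "a (\<lambda>z. s * u z + t * v z) (\<lambda>z. s * u z + t * v z) =
    s\<^sup>2 * a u u + 2 * s * t * a u v + t\<^sup>2 * a v v"
  using assms sym[OF assms] comb[OF assms]
  by (simp add: lin lin_right power2_eq_square algebra_simps)

lemma square_diff:
  assumes "u \<in> V" "v \<in> V"
  shows "a (\<lambda>z. u z - v z) (\<lambda>z. u z - v z) = a u u - 2 * a u v + a v v"
  using square_comb[OF assms, of 1 "-1"] by simp

text \<open>Definiteness comes from the evaluation bound, so zero energy forces the function to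
  vanish at every point and not just almost everywhere.\<close>

lemma square_eq_0: "u \<in> V \<Longrightarrow> a u u = 0 \<Longrightarrow> u = (\<lambda>z. 0)"
  using eval[of u] by auto

lemma zero_left: "v \<in> V \<Longrightarrow> a (\<lambda>z. 0) v = 0"
  using lin[OF zero_mem zero_mem, of v 0 0] by simp

lemma Cauchy_Schwarz:
  assumes u: "u \<in> V" and v: "v \<in> V"
  shows "\<bar>a u v\<bar> \<le> sqrt (a u u) * sqrt (a v v)"
proof (cases "a v v = 0")
  case True
  then have "a u v = 0" using square_eq_0[OF v] zero_left[OF u] sym[OF u v] by simp
  then show ?thesis using True by simp
next
  case False
  then have pos: "a v v > 0" using nonneg[OF v] by simp
  \<comment> \<open>The square of a(v,v) u - a(u,v) v is nonnegative; this multiple of the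
    projection remainder avoids a division.\<close>
  have "0 \<le> (a v v)\<^sup>2 * a u u + 2 * a v v * (- a u v) * a u v + (- a u v)\<^sup>2 * a v v"
    using square_comb[OF u v, of "a v v" "- a u v"] nonneg[OF comb[OF u v]] by metis
  also have "\<dots> = a v v * (a u u * a v v - (a u v)\<^sup>2)"
    by (simp add: power2_eq_square algebra_simps)
  finally have "(a u v)\<^sup>2 \<le> a u u * a v v"
    using pos by (simp add: zero_le_mult_iff)
  then have "sqrt ((a u v)\<^sup>2) \<le> sqrt (a u u * a v v)" by (rule real_sqrt_le_mono)
  then show ?thesis by (simp add: real_sqrt_mult)
qed

definition bounded_functional :: "(('b \<Rightarrow> real) \<Rightarrow> real) \<Rightarrow> bool" where
  "bounded_functional L \<longleftrightarrow>
     (\<forall>u\<in>V. \<forall>v\<in>V. \<forall>s t. L (\<lambda>z. s * u z + t * v z) = s * L u + t * L v) \<and>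
     (\<exists>B. \<forall>u\<in>V. \<bar>L u\<bar> \<le> B * sqrt (a u u))"

lemma bounded_functional_comb:
  "bounded_functional L \<Longrightarrow> u \<in> V \<Longrightarrow> v \<in> V \<Longrightarrow> L (\<lambda>z. s * u z + t * v z) = s * L u + t * L v"
  by (auto simp: bounded_functional_def)

text \<open>Direct method: a minimizing sequence of a(v,v) / 2 - L v is Cauchy by the parallelogram
  identity, its limit is a minimizer, and the first variation there is the asserted
  identity.\<close>

lemma riesz:
  assumes L: "bounded_functional L"
  shows "\<exists>w\<in>V. \<forall>v\<in>V. a w v = L v"
proof -
  obtain B0 where B0: "\<And>u. u \<in> V \<Longrightarrow> \<bar>L u\<bar> \<le> B0 * sqrt (a u u)"
    using L unfolding bounded_functional_def by blast
  define B where "B = \<bar>B0\<bar>"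
  have B: "\<bar>L u\<bar> \<le> B * sqrt (a u u)" if "u \<in> V" for u
  proof -
    have "B0 * sqrt (a u u) \<le> B * sqrt (a u u)"
      by (rule mult_right_mono) (simp_all add: B_def nonneg[OF that])
    then show ?thesis using B0[OF that] by linarith
  qed
  note Lc = bounded_functional_comb[OF L]
  define J where "J v = a v v / 2 - L v" for v
  \<comment> \<open>Completing the square: with s the norm of v, J v is at least (s - B)^2 / 2 - B^2
    / 2.\<close>
  have J_low: "J v \<ge> - B\<^sup>2 / 2" if v: "v \<in> V" for v
  proof -
    have "0 \<le> (sqrt (a v v) - B)\<^sup>2" by simp
    then have "0 \<le> a v v - 2 * (B * sqrt (a v v)) + B\<^sup>2"
      using nonneg[OF v] by (simp add: power2_diff algebra_simps)
    with B[OF v] have "0 \<le> a v v - 2 * L v + B\<^sup>2" by linarith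
    then show ?thesis unfolding J_def by (simp add: field_simps)
  qed
  define m where "m = Inf (J ` V)"
  have bdd: "bdd_below (J ` V)" using J_low by (auto intro!: bdd_belowI2)
  have m_le: "m \<le> J v" if "v \<in> V" for v
    unfolding m_def using that bdd by (intro cInf_lower) auto
  have "\<exists>v\<in>V. J v < m + e" if "e > 0" for e
    using cInf_lessD[of "J ` V" "m + e"] that zero_mem unfolding m_def by auto
  then have "\<forall>n. \<exists>v\<in>V. J v < m + 1 / (real n + 1)" by (simp add: add_pos_nonneg)
  then obtain X where X: "\<And>n. X n \<in> V" "\<And>n. J (X n) < m + 1 / (real n + 1)" by metis
  \<comment> \<open>Parallelogram identity, with the value at the midpoint bounded below by the
    infimum \<open>m\<close>.\<close>
  have par: "a (\<lambda>z. x z - y z) (\<lambda>z. x z - y z) \<le> 4 * (J x + J y - 2 * m)" if "x \<in> V" "y \<in> V" for x y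
  proof -
    have mid: "(\<lambda>z. (1/2) * x z + (1/2) * y z) \<in> V" using that by (rule comb)
    have "J (\<lambda>z. (1/2) * x z + (1/2) * y z) = a x x / 8 + a x y / 4 + a y y / 8 - L x / 2 - L y / 2"
      unfolding J_def square_comb[OF that] Lc[OF that] by (simp add: power2_eq_square)
    then show ?thesis using m_le[OF mid] square_diff[OF that] unfolding J_def by simp
  qed
  have "\<exists>u\<in>V. (\<lambda>n. a (\<lambda>z. X n z - u z) (\<lambda>z. X n z - u z)) \<longlonglongrightarrow> 0"
  proof (rule complete)
    fix e :: real assume "e > 0"
    \<comment> \<open>Two values within e / 8 of the infimum give 4 (e / 8 + e / 8) = e in
      \<open>par\<close>.\<close>
    then obtain N where N: "1 / (real N + 1) < e / 8"
      using nat_approx_posE[of "e/8"] by (metis Suc_eq_plus1 of_nat_1 of_nat_add divide_pos_pos zero_less_numeral)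
    have "a (\<lambda>z. X i z - X j z) (\<lambda>z. X i z - X j z) < e" if ij: "i \<ge> N" "j \<ge> N" for i j
    proof -
      have "1 / (real i + 1) \<le> 1 / (real N + 1)" "1 / (real j + 1) \<le> 1 / (real N + 1)"
        using ij by (auto simp: frac_le)
      then have "J (X i) < m + e / 8" "J (X j) < m + e / 8"
        using X(2)[of i] X(2)[of j] N by linarith+
      then have "4 * (J (X i) + J (X j) - 2 * m) < e" by (simp add: field_simps)
      then show ?thesis using par[OF X(1) X(1), of i j] by linarith
    qed
    then show "\<exists>N. \<forall>m\<ge>N. \<forall>n\<ge>N. a (\<lambda>z. X m z - X n z) (\<lambda>z. X m z - X n z) < e" by blast
  qed (rule X)
  then obtain u where u: "u \<in> V" and lim: "(\<lambda>n. a (\<lambda>z. X n z - u z) (\<lambda>z. X n z - u z)) \<longlonglongrightarrow> 0" by auto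
  define e where "e n = (\<lambda>z. X n z - u z)" for n
  have e: "e n \<in> V" for n unfolding e_def using diff_mem[OF X(1) u] .
  have lims: "(\<lambda>n. sqrt (a (e n) (e n))) \<longlonglongrightarrow> 0"
    using tendsto_real_sqrt[OF lim] by (simp add: e_def)
  have "(\<lambda>n. a u (e n)) \<longlonglongrightarrow> 0"
    by (rule Lim_null_comparison[OF _ tendsto_mult_right_zero[OF lims, of "sqrt (a u u)"]])
      (auto intro!: always_eventually Cauchy_Schwarz u e)
  moreover have "(\<lambda>n. L (e n)) \<longlonglongrightarrow> 0"
    by (rule Lim_null_comparison[OF _ tendsto_mult_right_zero[OF lims, of B]])
      (auto intro!: always_eventually B e)
  moreover have "J (X n) = J u + a u (e n) + a (e n) (e n) / 2 - L (e n)" for n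
  proof -
    have eq: "X n = (\<lambda>z. 1 * u z + 1 * e n z)" by (auto simp: e_def)
    show ?thesis unfolding J_def
      by (subst (1 2 3) eq) (simp only: square_comb[OF u e] Lc[OF u e], simp add: field_simps)
  qed
  moreover have "(\<lambda>n. a (e n) (e n)) \<longlonglongrightarrow> 0" using lim by (simp add: e_def)
  ultimately have "(\<lambda>n. J (X n)) \<longlonglongrightarrow> J u + 0 + 0 / 2 - 0"
    by (simp only:) (intro tendsto_intros; simp)
  moreover have "(\<lambda>n. m + 1 / (real n + 1)) \<longlonglongrightarrow> m + 0"
    using LIMSEQ_inverse_real_of_nat by (intro tendsto_intros) (simp add: inverse_eq_divide add.commute)
  ultimately have "J u \<le> m"
    using X(2) by (intro LIMSEQ_le[of "\<lambda>n. J (X n)" "J u" "\<lambda>n. m + 1 / (real n + 1)" m]) (auto intro: less_imp_le)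
  have "a u v = L v" if v: "v \<in> V" for v
  proof (rule ccontr)
    define r where "r = a u v - L v"
    define s where "s = a v v"
    assume "a u v \<noteq> L v"
    then have r: "r \<noteq> 0" by (simp add: r_def)
    have s: "s \<ge> 0" unfolding s_def by (rule nonneg[OF v])
    \<comment> \<open>The best step would be - r / s; the summand 1 covers s = 0 and still makes the
      increment t r + t^2 s / 2 negative.\<close>
    define t where "t = - r / (s + 1)"
    have "J u \<le> J (\<lambda>z. 1 * u z + t * v z)"
      using \<open>J u \<le> m\<close> m_le[OF comb[OF u v, of 1 t]] by linarith
    also have "\<dots> = J u + t * r + t\<^sup>2 * s / 2"
      unfolding J_def r_def s_def by (simp only: square_comb[OF u v] Lc[OF u v], simp add: field_simps)
    finally have "0 \<le> t * r + t\<^sup>2 * s / 2" by simp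
    also have "r = - t * (s + 1)" unfolding t_def using s by simp
    also have "t * (- t * (s + 1)) + t\<^sup>2 * s / 2 = - (t\<^sup>2 * (s / 2 + 1))"
      by (simp add: power2_eq_square field_simps)
    also have "\<dots> < 0" using r s by (simp add: t_def)
    finally show False by simp
  qed
  with u show ?thesis by blast
qed

lemma representer_unique:
  assumes "w \<in> V" "w' \<in> V" "\<And>v. v \<in> V \<Longrightarrow> a w v = a w' v"
  shows "w = w'"
proof -
  note d = diff_mem[OF assms(1,2)]
  have "a w (\<lambda>z. w z - w' z) = a w' (\<lambda>z. w z - w' z)" by (rule assms(3)[OF d])
  moreover have "a (\<lambda>z. w z - w' z) (\<lambda>z. w z - w' z)
      = a w (\<lambda>z. w z - w' z) - a w' (\<lambda>z. w z - w' z)"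
    using lin[OF assms(1,2) d, of 1 "-1"] by simp
  ultimately have "(\<lambda>z. w z - w' z) = (\<lambda>z. 0)" using square_eq_0[OF d] by simp
  then show ?thesis by (auto simp: fun_eq_iff)
qed

text \<open>Completing the square around the representer leaves J v = J w plus half the energy of v
  - w. This identifies the energy minimizer, defined by \<open>THE\<close>, with the weak
  solution.\<close>

lemma is_arg_min_iff_representer:
  assumes L: "bounded_functional L" and w: "w \<in> V" "\<And>v. v \<in> V \<Longrightarrow> a w v = L v"
  shows "is_arg_min (\<lambda>v. a v v / 2 - L v) (\<lambda>v. v \<in> V) u \<longleftrightarrow> u = w"
proof -
  define J where "J v = a v v / 2 - L v" for v
  have J: "J v = J w + a (\<lambda>z. v z - w z) (\<lambda>z. v z - w z) / 2" if v: "v \<in> V" for v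
    unfolding J_def using square_diff[OF v w(1)] w(2)[OF v] w(2)[OF w(1)] sym[OF v w(1)] by (simp add: field_simps)
  have "\<not> J v < J w" if "v \<in> V" for v using J[OF that] nonneg[OF diff_mem[OF that w(1)]] by simp
  moreover have "u = w" if u: "u \<in> V" and "\<not> (\<exists>v. v \<in> V \<and> J v < J u)"
  proof -
    have "J u \<le> J w" using that(2) w(1) by force
    then have "a (\<lambda>z. u z - w z) (\<lambda>z. u z - w z) = 0" using J[OF u] nonneg[OF diff_mem[OF u w(1)]] by simp
    then have "(\<lambda>z. u z - w z) = (\<lambda>z. 0)" by (rule square_eq_0[OF diff_mem[OF u w(1)]])
    then show ?thesis by (auto simp: fun_eq_iff)
  qed
  ultimately show ?thesis unfolding is_arg_min_def J_def[symmetric] using w(1) by auto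
qed

end

section \<open>Smooth bumps in one variable\<close>

text \<open>Derivatives are existential witnesses, so that closure under sums, products and affine
  substitutions is an induction that never has to compute \<open>deriv\<close>.\<close>

primrec times_differentiable :: "nat \<Rightarrow> (real \<Rightarrow> real) \<Rightarrow> bool" where
  "times_differentiable 0 f \<longleftrightarrow> True"
| "times_differentiable (Suc n) f \<longleftrightarrow>
     (\<exists>f'. (\<forall>x. (f has_real_derivative f' x) (at x)) \<and> times_differentiable n f')"

lemma times_differentiable_SucD: "times_differentiable (Suc n) f \<Longrightarrow> times_differentiable n f"
proof (induction n arbitrary: f)
  case (Suc n)
  then obtain f' where "\<And>x. (f has_real_derivative f' x) (at x)" "times_differentiable (Suc n) f'" by auto
  then show ?case using Suc.IH[of f'] by auto
qed simp

lemma times_differentiable_add: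
  "times_differentiable n f \<Longrightarrow> times_differentiable n g \<Longrightarrow> times_differentiable n (\<lambda>x. f x + g x)"
proof (induction n arbitrary: f g)
  case (Suc n)
  then obtain f' g' where "\<And>x. (f has_real_derivative f' x) (at x)" "times_differentiable n f'"
    "\<And>x. (g has_real_derivative g' x) (at x)" "times_differentiable n g'" by auto
  then show ?case using Suc.IH
    by (auto intro!: exI[of _ "\<lambda>x. f' x + g' x"] derivative_eq_intros)
qed simp

lemma times_differentiable_cmult:
  "times_differentiable n f \<Longrightarrow> times_differentiable n (\<lambda>x. c * f x)"
proof (induction n arbitrary: f)
  case (Suc n)
  then obtain f' where "\<And>x. (f has_real_derivative f' x) (at x)" "times_differentiable n f'" by auto
  then show ?case using Suc.IH by (auto intro!: exI[of _ "\<lambda>x. c * f' x"] derivative_eq_intros)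
qed simp

lemma times_differentiable_mult:
  "times_differentiable n f \<Longrightarrow> times_differentiable n g \<Longrightarrow> times_differentiable n (\<lambda>x. f x * g x)"
proof (induction n arbitrary: f g)
  case (Suc n)
  then obtain f' g' where f': "\<And>x. (f has_real_derivative f' x) (at x)" "times_differentiable n f'"
    and g': "\<And>x. (g has_real_derivative g' x) (at x)" "times_differentiable n g'" by auto
  have "times_differentiable n (\<lambda>x. f' x * g x + f x * g' x)"
    using f' g' Suc.prems[THEN times_differentiable_SucD]
    by (intro times_differentiable_add Suc.IH)
  moreover have "((\<lambda>x. f x * g x) has_real_derivative f' x * g x + f x * g' x) (at x)" for x
    using f'(1)[of x] g'(1)[of x] by (auto intro!: derivative_eq_intros)
  ultimately show ?case by (auto intro!: exI[of _ "\<lambda>x. f' x * g x + f x * g' x"])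
qed simp

lemma times_differentiable_affine:
  "times_differentiable n f \<Longrightarrow> times_differentiable n (\<lambda>x. f (c * x + d))"
proof (induction n arbitrary: f)
  case (Suc n)
  then obtain f' where f': "\<And>x. (f has_real_derivative f' x) (at x)" "times_differentiable n f'" by auto
  have "((\<lambda>x. f (c * x + d)) has_real_derivative c * f' (c * x + d)) (at x)" for x
  proof -
    have "((\<lambda>x. c * x + d) has_real_derivative c) (at x)" by (auto intro!: derivative_eq_intros)
    from DERIV_chain2[OF f'(1) this] show ?thesis by (simp add: mult.commute)
  qed
  with Suc.IH[OF f'(2)] show ?case
    by (auto intro!: exI[of _ "\<lambda>x. c * f' (c * x + d)"] times_differentiable_cmult)
qed simp

text \<open>For k = 0 this is the classical flat function exp(-1/x). The factors x^(-k) are included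
  because the family is then closed under differentiation up to linear combinations.\<close>

definition flat :: "nat \<Rightarrow> real \<Rightarrow> real" where
  "flat k x = (if x > 0 then (1 / x) ^ k * exp (- (1 / x)) else 0)"

lemma tendsto_flat_0: "(flat k \<longlongrightarrow> 0) (at_right 0)"
proof -
  have "((\<lambda>x::real. x ^ k / exp x) \<longlongrightarrow> 0) at_top" by (rule tendsto_power_div_exp_0)
  then have "((\<lambda>x::real. inverse x ^ k / exp (inverse x)) \<longlongrightarrow> 0) (at_right 0)"
    by (rule filterlim_compose) (rule filterlim_inverse_at_top_right)
  then show ?thesis
    by (rule Lim_transform_eventually)
      (auto simp: flat_def eventually_at_filter exp_minus divide_inverse intro!: always_eventually)
qed

lemma DERIV_flat: "(flat k has_real_derivative (flat (Suc (Suc k)) x - real k * flat (Suc k) x)) (at x)"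
proof (cases "x = 0")
  case False
  show ?thesis
  proof (cases "x > 0")
    case True
    have "((\<lambda>x. (1 / x) ^ k * exp (- (1 / x))) has_real_derivative
        (flat (Suc (Suc k)) x - real k * flat (Suc k) x)) (at x)"
    proof -
      have inv: "((\<lambda>x. 1 / x) has_real_derivative - (1 / x)\<^sup>2) (at x)"
        using True by (auto intro!: derivative_eq_intros simp: power2_eq_square)
      have pow: "((\<lambda>x. (1 / x) ^ k) has_real_derivative - real k * (1 / x) ^ Suc k) (at x)"
      proof -
        have "real k * (- (1 / x)\<^sup>2 * (1 / x) ^ (k - Suc 0)) = - real k * (1 / x) ^ Suc k"
          by (cases k) (simp_all add: power2_eq_square add_divide_distrib diff_divide_distrib algebra_simps)
        then show ?thesis using DERIV_power[OF inv, of k] by simp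
      qed
      have "((\<lambda>x. exp (- (1 / x))) has_real_derivative exp (- (1 / x)) * (1 / x)\<^sup>2) (at x)"
        using DERIV_chain2[OF DERIV_exp DERIV_minus[OF inv]] by simp
      from DERIV_mult[OF pow this] show ?thesis
        using True by (simp add: flat_def power2_eq_square algebra_simps)
    qed
    then show ?thesis
      by (rule has_field_derivative_transform_within_open[of _ _ _ "{0<..}"])
        (use True in \<open>auto simp: flat_def\<close>)
  next
    case neg: False
    have "((\<lambda>x. 0) has_real_derivative (flat (Suc (Suc k)) x - real k * flat (Suc k) x)) (at x)"
      using neg by (auto simp: flat_def)
    then show ?thesis
      by (rule has_field_derivative_transform_within_open[of _ _ _ "{..<0}"])
        (use False neg in \<open>auto simp: flat_def\<close>)
  qed
next
  case True
  \<comment> \<open>For h > 0 the difference quotient at 0 is \<open>flat (Suc k) h\<close>, which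
    tends to 0 because the exponential beats every power of 1/h.\<close>
  have "((\<lambda>h. flat k h / h) \<longlongrightarrow> 0) (at_right 0)"
    by (rule Lim_transform_eventually[OF tendsto_flat_0[of "Suc k"]])
      (auto simp: flat_def eventually_at_filter intro!: always_eventually)
  moreover have "((\<lambda>h. flat k h / h) \<longlongrightarrow> 0) (at_left 0)"
    by (rule Lim_transform_eventually[OF tendsto_const])
      (auto simp: flat_def eventually_at_filter intro!: always_eventually)
  ultimately have "((\<lambda>h. flat k h / h) \<longlongrightarrow> 0) (at 0)"
    by (simp add: filterlim_split_at)
  then show ?thesis using True by (simp add: DERIV_def flat_def)
qed

lemma times_differentiable_flat: "times_differentiable n (flat k)"
proof (induction n arbitrary: k)
  case (Suc n)
  have "times_differentiable n (\<lambda>x. flat (Suc (Suc k)) x + (- real k) * flat (Suc k) x)"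
    by (intro times_differentiable_add times_differentiable_cmult Suc.IH)
  then show ?case using DERIV_flat[of k]
    by (auto intro!: exI[of _ "\<lambda>x. flat (Suc (Suc k)) x - real k * flat (Suc k) x"])
qed simp

definition smooth :: "(real \<Rightarrow> real) \<Rightarrow> bool" where
  "smooth f \<longleftrightarrow> (\<forall>n. times_differentiable n f)"

lemma smooth_add: "smooth f \<Longrightarrow> smooth g \<Longrightarrow> smooth (\<lambda>x. f x + g x)"
  and smooth_cmult: "smooth f \<Longrightarrow> smooth (\<lambda>x. c * f x)"
  and smooth_mult: "smooth f \<Longrightarrow> smooth g \<Longrightarrow> smooth (\<lambda>x. f x * g x)"
  and smooth_affine: "smooth f \<Longrightarrow> smooth (\<lambda>x. f (c * x + d))"
  and smooth_flat: "smooth (flat k)"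
  by (simp_all add: smooth_def times_differentiable_add times_differentiable_cmult
      times_differentiable_mult times_differentiable_affine times_differentiable_flat)

lemma smooth_DERIV: "smooth f \<Longrightarrow> (f has_real_derivative deriv f x) (at x)"
  unfolding smooth_def by (metis times_differentiable.simps(2) DERIV_imp_deriv)

lemma smooth_primitive:
  assumes "smooth f" "\<And>x. (F has_real_derivative f x) (at x)"
  shows "smooth F"
proof -
  have "times_differentiable n F" for n
    using assms by (cases n) (auto simp: smooth_def)
  then show ?thesis by (simp add: smooth_def)
qed

lemma smooth_deriv: "smooth f \<Longrightarrow> smooth (deriv f)"
proof -
  assume f: "smooth f"
  have "times_differentiable n (deriv f)" for n
  proof -
    obtain f' where "\<And>x. (f has_real_derivative f' x) (at x)" "times_differentiable n f'"
      using f unfolding smooth_def by (metis times_differentiable.simps(2))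
    moreover from this(1) have "deriv f = f'" by (auto simp: fun_eq_iff intro!: DERIV_imp_deriv)
    ultimately show ?thesis by simp
  qed
  then show ?thesis by (simp add: smooth_def)
qed

lemma smooth_continuous_on: "smooth f \<Longrightarrow> continuous_on S f"
  by (meson DERIV_continuous_on DERIV_subset smooth_DERIV subset_UNIV)

text \<open>Smooth functions with compact support in the open interval. The interval from a' to b'
  may be empty, which makes the zero function a bump for every a and b.\<close>

definition bumps :: "real \<Rightarrow> real \<Rightarrow> (real \<Rightarrow> real) set" where
  "bumps a b = {\<alpha>. smooth \<alpha> \<and> (\<exists>a' b'. a < a' \<and> b' < b \<and> (\<forall>x. x \<notin> {a'..b'} \<longrightarrow> \<alpha> x = 0))}"

lemma bumps_smooth: "\<alpha> \<in> bumps a b \<Longrightarrow> smooth \<alpha>"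
  by (simp add: bumps_def)

lemma bumps_support: "\<alpha> \<in> bumps a b \<Longrightarrow> \<exists>a' b'. a < a' \<and> b' < b \<and> (\<forall>x. x \<notin> {a'..b'} \<longrightarrow> \<alpha> x = 0)"
  by (simp add: bumps_def)

lemma bumps_outside: "\<alpha> \<in> bumps a b \<Longrightarrow> x \<notin> {a<..<b} \<Longrightarrow> \<alpha> x = 0"
  unfolding bumps_def by force

lemma bumps_deriv: "\<alpha> \<in> bumps a b \<Longrightarrow> deriv \<alpha> \<in> bumps a b"
proof -
  assume \<alpha>: "\<alpha> \<in> bumps a b"
  then obtain a' b' where ab: "a < a'" "b' < b" "\<And>x. x \<notin> {a'..b'} \<Longrightarrow> \<alpha> x = 0"
    using bumps_support by blast
  have "deriv \<alpha> x = 0" if "x \<notin> {a'..b'}" for x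
  proof (rule DERIV_imp_deriv)
    show "(\<alpha> has_real_derivative 0) (at x)"
      by (rule has_field_derivative_transform_within_open[of "\<lambda>x. 0" _ _ "- {a'..b'}"])
        (use that ab(3) in auto)
  qed
  then show ?thesis using ab \<alpha> smooth_deriv unfolding bumps_def by blast
qed

lemma bumps_bounded: "\<alpha> \<in> bumps a b \<Longrightarrow> \<exists>B. \<forall>x. \<bar>\<alpha> x\<bar> \<le> B"
proof -
  assume \<alpha>: "\<alpha> \<in> bumps a b"
  then obtain a' b' where ab: "\<And>x. x \<notin> {a'..b'} \<Longrightarrow> \<alpha> x = 0" using bumps_support by blast
  have "bounded (\<alpha> ` {a'..b'})"
    by (intro compact_imp_bounded compact_continuous_image smooth_continuous_on bumps_smooth[OF \<alpha>]) simp
  then obtain B where "\<forall>y\<in>\<alpha> ` {a'..b'}. norm y \<le> B" unfolding bounded_iff by blast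
  then have "\<bar>\<alpha> x\<bar> \<le> B" if "x \<in> {a'..b'}" for x using that by simp
  then have "\<bar>\<alpha> x\<bar> \<le> max B 0" for x using ab[of x] by (cases "x \<in> {a'..b'}") force+
  then show ?thesis by blast
qed

lemma bumps_measurable [measurable_dest]: "\<alpha> \<in> bumps a b \<Longrightarrow> \<alpha> \<in> borel_measurable borel"
  by (intro borel_measurable_continuous_onI smooth_continuous_on bumps_smooth)

section \<open>Tensor products of bumps as test functions\<close>

lemma has_derivative_tensor:
  assumes "(\<alpha> has_real_derivative \<alpha>') (at (fst z))" "(\<beta> has_real_derivative \<beta>') (at (snd z))"
  shows "((\<lambda>z. \<alpha> (fst z) * \<beta> (snd z)) has_derivative
    (\<lambda>h. \<alpha>' * fst h * \<beta> (snd z) + \<alpha> (fst z) * (\<beta>' * snd h))) (at z)"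
proof -
  have "((\<lambda>z. \<alpha> (fst z)) has_derivative (\<lambda>h. \<alpha>' * fst h)) (at z)"
    using has_derivative_compose[OF has_derivative_fst[OF has_derivative_ident] assms(1)[unfolded has_field_derivative_def]]
    by simp
  moreover have "((\<lambda>z. \<beta> (snd z)) has_derivative (\<lambda>h. \<beta>' * snd h)) (at z)"
    using has_derivative_compose[OF has_derivative_snd[OF has_derivative_ident] assms(2)[unfolded has_field_derivative_def]]
    by simp
  ultimately show ?thesis
    by (auto intro!: derivative_eq_intros simp: fun_eq_iff algebra_simps)
qed

lemma Basis_real_prod: "(Basis :: (real \<times> real) set) = {(1, 0), (0, 1)}"
  by (auto simp: Basis_prod_def)

lemma frechet_derivative_tensor:
  assumes "(\<alpha> has_real_derivative \<alpha>') (at (fst z))" "(\<beta> has_real_derivative \<beta>') (at (snd z))"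
  shows "frechet_derivative (\<lambda>z. \<alpha> (fst z) * \<beta> (snd z)) (at z) (1, 0) = \<alpha>' * \<beta> (snd z)"
    and "frechet_derivative (\<lambda>z. \<alpha> (fst z) * \<beta> (snd z)) (at z) (0, 1) = \<alpha> (fst z) * \<beta>'"
  by (simp_all add: frechet_derivative_at[OF has_derivative_tensor[OF assms], symmetric])

text \<open>One more derivative is asked of the factors because continuity at the last order is
  deduced from differentiability.\<close>

lemma times_cont_differentiable_tensor:
  "times_differentiable (Suc k) \<alpha> \<Longrightarrow> times_differentiable (Suc k) \<beta> \<Longrightarrow>
    times_cont_differentiable k (\<lambda>z. \<alpha> (fst z) * \<beta> (snd z))"
proof (induction k arbitrary: \<alpha> \<beta>)
  case 0
  then obtain \<alpha>' \<beta>' where "\<And>x. (\<alpha> has_real_derivative \<alpha>' x) (at x)" "\<And>x. (\<beta> has_real_derivative \<beta>' x) (at x)"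
    by auto
  then have "(\<lambda>z. \<alpha> (fst z) * \<beta> (snd z)) differentiable (at z)" for z
    using has_derivative_tensor[of \<alpha> "\<alpha>' (fst z)" z \<beta> "\<beta>' (snd z)"] unfolding differentiable_def by blast
  then show ?case by (auto simp: continuous_on_eq_continuous_at intro: differentiable_imp_continuous_within)
next
  case (Suc k)
  then obtain \<alpha>' \<beta>' where
    d: "\<And>x. (\<alpha> has_real_derivative \<alpha>' x) (at x)" "\<And>x. (\<beta> has_real_derivative \<beta>' x) (at x)"
    and t: "times_differentiable (Suc k) \<alpha>'" "times_differentiable (Suc k) \<beta>'"
    by (auto simp del: times_differentiable.simps simp: times_differentiable.simps(2)[of "Suc k"])
  have "(\<lambda>z. \<alpha> (fst z) * \<beta> (snd z)) differentiable (at z)" for z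
    using has_derivative_tensor[of \<alpha> "\<alpha>' (fst z)" z \<beta> "\<beta>' (snd z)"] d unfolding differentiable_def by blast
  moreover note frechet_derivative_tensor[OF d]
  moreover have "times_cont_differentiable k (\<lambda>z. \<alpha>' (fst z) * \<beta> (snd z))"
      "times_cont_differentiable k (\<lambda>z. \<alpha> (fst z) * \<beta>' (snd z))"
    using Suc.IH t Suc.prems[THEN times_differentiable_SucD] by blast+
  ultimately show ?case by (simp add: Basis_real_prod)
qed

text \<open>Uniqueness of weak derivatives and the estimates along lines are all obtained by testing
  with these products.\<close>

lemma tensor_test_function:
  assumes "\<alpha> \<in> bumps a b" "\<beta> \<in> bumps c d"
  shows "(\<lambda>z. \<alpha> (fst z) * \<beta> (snd z)) \<in> test_functions ({a<..<b} \<times> {c<..<d})"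
proof -
  obtain a' b' where ab: "a < a'" "b' < b" "\<And>x. x \<notin> {a'..b'} \<Longrightarrow> \<alpha> x = 0"
    using bumps_support[OF assms(1)] by blast
  obtain c' d' where cd: "c < c'" "d' < d" "\<And>x. x \<notin> {c'..d'} \<Longrightarrow> \<beta> x = 0"
    using bumps_support[OF assms(2)] by blast
  have "compact ({a'..b'} \<times> {c'..d'})" by (intro compact_Times) auto
  moreover have "{a'..b'} \<times> {c'..d'} \<subseteq> {a<..<b} \<times> {c<..<d}" using ab cd by auto
  moreover have "\<alpha> (fst z) * \<beta> (snd z) = 0" if "z \<notin> {a'..b'} \<times> {c'..d'}" for z
    using that ab(3) cd(3) by (auto simp: mem_Times_iff)
  ultimately show ?thesis
    using times_cont_differentiable_tensor assms[THEN bumps_smooth]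
    unfolding test_functions_def smooth_def by blast
qed

text \<open>Smooth approximations of the indicator of ]a,b[ with values between 0 and 1. The index
  only steepens the two edges: exp(-1/((n+1) t)) tends to 1 for t > 0. With \<open>Suc n\<close> the
  scaling factor is positive already for n = 0.\<close>

definition cutoff :: "real \<Rightarrow> real \<Rightarrow> nat \<Rightarrow> real \<Rightarrow> real" where
  "cutoff a b n x = flat 0 (real (Suc n) * (x - a)) * flat 0 (real (Suc n) * (b - x))"

lemma cutoff_bumps: "a < a' \<Longrightarrow> b' < b \<Longrightarrow> cutoff a' b' n \<in> bumps a b"
proof -
  assume *: "a < a'" "b' < b"
  have "smooth (\<lambda>x. flat 0 (real (Suc n) * x + (- real (Suc n) * a')) * flat 0 ((- real (Suc n)) * x + real (Suc n) * b'))"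
    by (intro smooth_mult smooth_affine smooth_flat)
  also have "(\<lambda>x. flat 0 (real (Suc n) * x + (- real (Suc n) * a')) * flat 0 ((- real (Suc n)) * x + real (Suc n) * b')) = cutoff a' b' n"
    by (auto simp: cutoff_def algebra_simps)
  finally have "smooth (cutoff a' b' n)" .
  moreover have "cutoff a' b' n x = 0" if "x \<notin> {a'..b'}" for x
    using that by (auto simp: cutoff_def flat_def zero_less_mult_iff)
  ultimately show ?thesis using * unfolding bumps_def by blast
qed

lemma cutoff_nonneg: "0 \<le> cutoff a b n x" and cutoff_le_1: "cutoff a b n x \<le> 1"
  by (auto simp: cutoff_def flat_def intro!: mult_le_one)

lemma cutoff_pos: "a < x \<Longrightarrow> x < b \<Longrightarrow> 0 < cutoff a b n x"
  by (auto simp: cutoff_def flat_def)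

lemma cutoff_tendsto: "(\<lambda>n. cutoff a b n x) \<longlonglongrightarrow> indicator {a<..<b} x"
proof (cases "a < x \<and> x < b")
  case True
  have *: "(\<lambda>n. flat 0 (real (Suc n) * t)) \<longlonglongrightarrow> 1" if "t > 0" for t
  proof -
    have "(\<lambda>n. exp (- (inverse (real (Suc n)) * inverse t))) \<longlonglongrightarrow> exp (- (0 * inverse t))"
      by (intro tendsto_intros LIMSEQ_inverse_real_of_nat)
    moreover have "exp (- (inverse (real (Suc n)) * inverse t)) = flat 0 (real (Suc n) * t)" for n
      using that by (simp add: flat_def field_simps del: of_nat_Suc)
    ultimately show ?thesis by simp
  qed
  have "(\<lambda>n. flat 0 (real (Suc n) * (x - a)) * flat 0 (real (Suc n) * (b - x))) \<longlonglongrightarrow> 1 * 1"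
    by (intro tendsto_mult *) (use True in auto)
  with True show ?thesis by (simp add: cutoff_def)
next
  case False
  then have "cutoff a b n x = 0" for n by (auto simp: cutoff_def flat_def zero_less_mult_iff)
  with False show ?thesis by simp
qed

section \<open>The fundamental lemma on a rectangle\<close>

lemma integrable_mult_bounded:
  fixes w \<phi> :: "'a \<Rightarrow> real"
  assumes w: "integrable M w" and [measurable]: "\<phi> \<in> borel_measurable M" and B: "\<And>z. \<bar>\<phi> z\<bar> \<le> B"
  shows "integrable M (\<lambda>z. w z * \<phi> z)"
proof (rule Bochner_Integration.integrable_bound[of _ "\<lambda>z. B * w z"])
  show "integrable M (\<lambda>z. B * w z)" using w by simp
  show "(\<lambda>z. w z * \<phi> z) \<in> borel_measurable M" using w by measurable
  have "\<bar>w z\<bar> * \<bar>\<phi> z\<bar> \<le> \<bar>B\<bar> * \<bar>w z\<bar>" for z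
    using mult_left_mono[of "\<bar>\<phi> z\<bar>" "\<bar>B\<bar>" "\<bar>w z\<bar>"] B[of z] by (simp add: mult.commute)
  then show "AE z in M. norm (w z * \<phi> z) \<le> norm (B * w z)" by (simp add: abs_mult)
qed

lemma measurable_fst_snd_borel [measurable]:
  "(fst :: real \<times> real \<Rightarrow> real) \<in> borel_measurable borel"
  "(snd :: real \<times> real \<Rightarrow> real) \<in> borel_measurable borel"
  by (intro borel_measurable_continuous_onI continuous_intros)+

text \<open>Boxes form an intersection-stable generator of the Borel sets, so the integral of
  \<open>w\<close> vanishes over every Borel set; the hypothesis on the whole space starts the
  complement step. A density whose set integrals all vanish is zero almost everywhere.\<close>

lemma AE_zero_if_zero_on_boxes:
  fixes w :: "'a::euclidean_space \<Rightarrow> real"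
  assumes w: "integrable lborel w"
    and box: "\<And>a b. (LINT z|lborel. indicator (box a b) z * w z) = 0"
    and all: "(LINT z|lborel. w z) = 0"
  shows "AE z in lborel. w z = 0"
proof -
  have int: "integrable lborel (\<lambda>z. indicator A z * w z)" if "A \<in> sets borel" for A
    using that integrable_real_mult_indicator[OF _ w, of A] by (simp add: mult.commute)
  have zero: "(LINT z|lborel. indicator A z * w z) = 0" if A: "A \<in> sets borel" for A
  proof -
    let ?G = "range (\<lambda>(a, b). box a b :: 'a set)"
    have "Int_stable ?G" by (auto simp: Int_stable_def box_Int_box)
    moreover have "?G \<subseteq> Pow UNIV" by simp
    moreover have "A \<in> sigma_sets UNIV ?G" using A by (simp add: borel_eq_box)
    ultimately show ?thesis
    proof (induction rule: sigma_sets_induct_disjoint)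
      case (basic A)
      then show ?case using box by auto
    next
      case empty
      then show ?case by simp
    next
      case (compl A)
      then have A: "A \<in> sets borel" by (simp add: borel_eq_box)
      have "(LINT z|lborel. indicator (UNIV - A) z * w z) = (LINT z|lborel. w z - indicator A z * w z)"
        by (intro Bochner_Integration.integral_cong) (auto split: split_indicator)
      also have "\<dots> = 0" using compl.IH int[OF A] w all by simp
      finally show ?case .
    next
      case (union A)
      then have A: "A i \<in> sets borel" for i by (auto simp: borel_eq_box)
      have "(LINT z:(\<Union>i. A i)|lborel. w z) = (\<Sum>i. (LINT z:(A i)|lborel. w z))"
        using A union(1) int[of "\<Union>i. A i"]
        by (intro lebesgue_integral_countable_add) (auto simp: disjoint_family_on_def set_integrable_def)
      then show ?case using union.IH by (simp add: set_lebesgue_integral_def)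
    qed
  qed
  then show ?thesis
    using density_unique_real[OF w, of "\<lambda>_. 0"] by (simp add: set_lebesgue_integral_def)
qed

lemma bumps_mono: "a \<le> a' \<Longrightarrow> b' \<le> b \<Longrightarrow> \<alpha> \<in> bumps a' b' \<Longrightarrow> \<alpha> \<in> bumps a b"
  unfolding bumps_def by force

text \<open>Cutoffs approximate the indicator of a smaller open rectangle, and dominated convergence
  turns the test identity into a vanishing integral over it. The strict inclusions keep the supports
  of these cutoffs inside the large rectangle.\<close>

lemma fundamental_lemma_subrectangle:
  fixes w :: "real \<times> real \<Rightarrow> real"
  assumes w: "integrable lborel w"
    and test: "\<And>\<alpha> \<beta>. \<alpha> \<in> bumps a b \<Longrightarrow> \<beta> \<in> bumps c d \<Longrightarrow>
      (LINT z|lborel. w z * (\<alpha> (fst z) * \<beta> (snd z))) = 0"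
    and sub: "a < a1" "b1 < b" "c < c1" "d1 < d"
  shows "AE z in lborel. z \<in> {a1<..<b1} \<times> {c1<..<d1} \<longrightarrow> w z = 0"
proof -
  let ?R = "{a1<..<b1} \<times> {c1<..<d1}"
  define w1 where "w1 z = indicator ?R z * w z" for z
  have [measurable]: "w \<in> borel_measurable borel" using w by auto
  have R [measurable]: "?R \<in> sets borel" by (intro borel_open open_Times) auto
  have rect: "(LINT z|lborel. indicator ({a2<..<b2} \<times> {c2<..<d2}) z * w z) = 0"
    if "a < a2" "b2 < b" "c < c2" "d2 < d" for a2 b2 c2 d2
  proof -
    have "(\<lambda>n. LINT z|lborel. w z * (cutoff a2 b2 n (fst z) * cutoff c2 d2 n (snd z))) \<longlonglongrightarrow>
      (LINT z|lborel. w z * indicator ({a2<..<b2} \<times> {c2<..<d2}) z)"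
    proof (rule integral_dominated_convergence[where w = "\<lambda>z. \<bar>w z\<bar>"])
      have [measurable]: "cutoff x y n \<in> borel_measurable borel" for x y n
        by (rule bumps_measurable[OF cutoff_bumps[of "x - 1" _ _ "y + 1"]]) auto
      show "(\<lambda>z. w z * (cutoff a2 b2 n (fst z) * cutoff c2 d2 n (snd z))) \<in> borel_measurable lborel" for n
        by measurable
      have [measurable]: "{a2<..<b2} \<times> {c2<..<d2} \<in> sets borel" by (intro borel_open open_Times) auto
      show "(\<lambda>z. w z * indicator ({a2<..<b2} \<times> {c2<..<d2}) z) \<in> borel_measurable lborel"
        by measurable
      have "\<bar>cutoff a2 b2 n x * cutoff c2 d2 n y\<bar> \<le> 1" for n x y
        using cutoff_nonneg cutoff_le_1 by (simp add: abs_mult mult_le_one)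
      from mult_left_mono[OF this]
      show "AE z in lborel. norm (w z * (cutoff a2 b2 n (fst z) * cutoff c2 d2 n (snd z))) \<le> \<bar>w z\<bar>" for n
        by (auto simp: abs_mult)
      have "(\<lambda>n. w z * (cutoff a2 b2 n (fst z) * cutoff c2 d2 n (snd z))) \<longlonglongrightarrow>
          w z * (indicator {a2<..<b2} (fst z) * indicator {c2<..<d2} (snd z))" for z
        by (intro tendsto_intros cutoff_tendsto)
      then show "AE z in lborel. (\<lambda>n. w z * (cutoff a2 b2 n (fst z) * cutoff c2 d2 n (snd z)))
          \<longlonglongrightarrow> w z * indicator ({a2<..<b2} \<times> {c2<..<d2}) z"
        by (simp add: indicator_times)
    qed (use w in auto)
    moreover have "(LINT z|lborel. w z * (cutoff a2 b2 n (fst z) * cutoff c2 d2 n (snd z))) = 0" for n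
      by (intro test cutoff_bumps that)
    ultimately have "(\<lambda>n. 0) \<longlonglongrightarrow> (LINT z|lborel. w z * indicator ({a2<..<b2} \<times> {c2<..<d2}) z)" by simp
    from LIMSEQ_unique[OF this tendsto_const] show ?thesis by (simp add: mult.commute)
  qed
  have "AE z in lborel. w1 z = 0"
  proof (rule AE_zero_if_zero_on_boxes)
    show "integrable lborel w1"
      unfolding w1_def using integrable_real_mult_indicator[OF _ w, of ?R] R by (simp add: mult.commute)
    show "(LINT z|lborel. w1 z) = 0" unfolding w1_def by (rule rect[OF sub])
    fix p q :: "real \<times> real"
    have "indicator (box p q) z * w1 z =
        indicator ({max a1 (fst p)<..<min b1 (fst q)} \<times> {max c1 (snd p)<..<min d1 (snd q)}) z * w z" for z
      unfolding w1_def by (cases z; cases p; cases q) (auto simp: box_prod split: split_indicator)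
    then show "(LINT z|lborel. indicator (box p q) z * w1 z) = 0"
      using rect[of "max a1 (fst p)" "min b1 (fst q)" "max c1 (snd p)" "min d1 (snd q)"] sub by simp
  qed
  then show ?thesis by eventually_elim (auto simp: w1_def)
qed

text \<open>Fubini's theorem is applied to \<open>lborel\<close>, whereas Sobolev functions are
  measurable for the completed measure. This is the passage from the latter to the former, valid for
  integrals against Borel functions.\<close>

lemma lebesgue_borel_representative:
  fixes f :: "'a::euclidean_space \<Rightarrow> real"
  assumes f: "integrable lebesgue f"
  shows "\<exists>f'. integrable lborel f' \<and> (AE z in lborel. f z = f' z) \<and>
    (\<forall>\<phi>\<in>borel_measurable borel. (LINT z|lebesgue. f z * \<phi> z) = (LINT z|lborel. f' z * \<phi> z))"
proof -
  have [measurable]: "f \<in> borel_measurable lebesgue" using f by auto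
  obtain f' where f' [measurable]: "f' \<in> borel_measurable lborel" and ae: "AE z in lborel. f z = f' z"
    using completion_ex_borel_measurable_real[of f lborel] by auto
  have f'l [measurable]: "f' \<in> borel_measurable lebesgue" using f' by (rule measurable_completion)
  have ae': "AE z in lebesgue. f z = f' z" using ae by (rule AE_completion)
  have "integrable lebesgue f'" by (rule integrable_cong_AE_imp[OF f f'l]) (use ae' in eventually_elim, simp)
  then have "integrable lborel f'" by (simp add: integrable_completion)
  moreover have "(LINT z|lebesgue. f z * \<phi> z) = (LINT z|lborel. f' z * \<phi> z)" if \<phi>: "\<phi> \<in> borel_measurable borel" for \<phi>
  proof -
    have [measurable]: "\<phi> \<in> borel_measurable lborel" using \<phi> by simp
    have [measurable]: "\<phi> \<in> borel_measurable lebesgue" using \<phi> by (simp add: measurable_completion)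
    have "(LINT z|lebesgue. f z * \<phi> z) = (LINT z|lebesgue. f' z * \<phi> z)"
    proof (rule integral_cong_AE)
      show "AE z in lebesgue. f z * \<phi> z = f' z * \<phi> z" using ae' by eventually_elim simp
    qed measurable
    then show ?thesis by (simp add: integral_completion)
  qed
  ultimately show ?thesis using ae by blast
qed

lemma fundamental_lemma:
  fixes w :: "real \<times> real \<Rightarrow> real"
  assumes w: "\<And>a1 b1 c1 d1. a < a1 \<Longrightarrow> b1 < b \<Longrightarrow> c < c1 \<Longrightarrow> d1 < d \<Longrightarrow>
      integrable lebesgue (\<lambda>z. indicator ({a1..b1} \<times> {c1..d1}) z * w z)"
    and test: "\<And>\<alpha> \<beta>. \<alpha> \<in> bumps a b \<Longrightarrow> \<beta> \<in> bumps c d \<Longrightarrow>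
      (LINT z|lebesgue. w z * (\<alpha> (fst z) * \<beta> (snd z))) = 0"
  shows "AE z in lborel. z \<in> {a<..<b} \<times> {c<..<d} \<longrightarrow> w z = 0"
proof -
  define e where "e n = 1 / real (Suc n)" for n
  have e: "e n > 0" for n by (simp add: e_def)
  have "AE z in lborel. z \<in> {a + 2 * e n<..<b - 2 * e n} \<times> {c + 2 * e n<..<d - 2 * e n} \<longrightarrow> w z = 0" for n
  proof -
    \<comment> \<open>Two margins: w is made integrable by cutting it to a rectangle of margin
      \<open>e n\<close>, which does not alter integrals against bumps supported inside; the
      conclusion is drawn on the rectangle of margin \<open>2 * e n\<close>, strictly inside the
      first.\<close>
    let ?Q = "{a + e n..b - e n} \<times> {c + e n..d - e n}"
    have "integrable lebesgue (\<lambda>z. indicator ?Q z * w z)" using e[of n] by (intro w) auto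
    from lebesgue_borel_representative[OF this] obtain w' where w': "integrable lborel w'"
      and ae: "AE z in lborel. indicator ?Q z * w z = w' z"
      and int: "\<And>\<phi>. \<phi> \<in> borel_measurable borel \<Longrightarrow>
        (LINT z|lebesgue. indicator ?Q z * w z * \<phi> z) = (LINT z|lborel. w' z * \<phi> z)"
      by blast
    have "AE z in lborel. z \<in> {a + 2 * e n<..<b - 2 * e n} \<times> {c + 2 * e n<..<d - 2 * e n} \<longrightarrow> w' z = 0"
    proof (rule fundamental_lemma_subrectangle[OF w'])
      fix \<alpha> \<beta> assume ab: "\<alpha> \<in> bumps (a + e n) (b - e n)" "\<beta> \<in> bumps (c + e n) (d - e n)"
      have "indicator ?Q z * w z * (\<alpha> (fst z) * \<beta> (snd z)) = w z * (\<alpha> (fst z) * \<beta> (snd z))" for z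
      proof (cases "\<alpha> (fst z) = 0 \<or> \<beta> (snd z) = 0")
        case False
        then have "fst z \<in> {a + e n<..<b - e n}" "snd z \<in> {c + e n<..<d - e n}"
          using bumps_outside ab by blast+
        then show ?thesis by (auto simp: indicator_def mem_Times_iff)
      qed auto
      then have eq: "(\<lambda>z. indicator ?Q z * w z * (\<alpha> (fst z) * \<beta> (snd z))) = (\<lambda>z. w z * (\<alpha> (fst z) * \<beta> (snd z)))"
        by blast
      moreover have "\<alpha> \<in> bumps a b" "\<beta> \<in> bumps c d"
        using ab e[of n] by (auto intro: bumps_mono[rotated 2])
      moreover have "(\<lambda>z. \<alpha> (fst z) * \<beta> (snd z)) \<in> borel_measurable borel"
        using ab[THEN bumps_measurable] by measurable
      ultimately show "(LINT z|lborel. w' z * (\<alpha> (fst z) * \<beta> (snd z))) = 0"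
        using test int[of "\<lambda>z. \<alpha> (fst z) * \<beta> (snd z)"] unfolding eq by simp
    qed (use e[of n] in auto)
    then show ?thesis using ae
    proof eventually_elim
      case (elim z)
      then show ?case using e[of n] by (auto simp: indicator_def)
    qed
  qed
  then have "AE z in lborel. \<forall>n. z \<in> {a + 2 * e n<..<b - 2 * e n} \<times> {c + 2 * e n<..<d - 2 * e n} \<longrightarrow> w z = 0"
    unfolding AE_all_countable by blast
  then show ?thesis
  proof eventually_elim
    case (elim z)
    show ?case
    proof
      assume z: "z \<in> {a<..<b} \<times> {c<..<d}"
      define m where "m = Min {fst z - a, b - fst z, snd z - c, d - snd z} / 2"
      have "m > 0" using z by (auto simp: m_def)
      then obtain n where "e n < m" unfolding e_def using nat_approx_posE by metis
      then have "2 * e n < Min {fst z - a, b - fst z, snd z - c, d - snd z}" by (simp add: m_def)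
      then show "w z = 0" using elim[rule_format, of n] by (auto simp: mem_Times_iff)
    qed
  qed
qed

section \<open>Primitives and normalization of bumps\<close>

lemma bumps_integrable: "\<alpha> \<in> bumps a b \<Longrightarrow> integrable lborel \<alpha>"
proof -
  assume \<alpha>: "\<alpha> \<in> bumps a b"
  then obtain a' b' where "\<And>x. x \<notin> {a'..b'} \<Longrightarrow> \<alpha> x = 0" using bumps_support by blast
  then have "(\<lambda>x. indicator {a'..b'} x *\<^sub>R \<alpha> x) = \<alpha>" by (auto simp: fun_eq_iff indicator_def)
  then show ?thesis
    using borel_integrable_compact[of "{a'..b'}" \<alpha>] smooth_continuous_on[OF bumps_smooth[OF \<alpha>]] by simp
qed

text \<open>The primitive starting at the left end is constant on both sides of the support; total
  integral zero makes the right constant zero as well.\<close>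

lemma bumps_primitive:
  assumes \<gamma>: "\<gamma> \<in> bumps a b" and "(LINT x|lborel. \<gamma> x) = 0"
  shows "\<exists>\<alpha>\<in>bumps a b. deriv \<alpha> = \<gamma>"
proof -
  obtain a' b' where ab: "a < a'" "b' < b" and out: "\<And>x. x \<notin> {a'..b'} \<Longrightarrow> \<gamma> x = 0"
    using bumps_support[OF \<gamma>] by blast
  show ?thesis
  proof (cases "a' \<le> b'")
    case False
    then have "\<gamma> = (\<lambda>x. 0)" using out by auto
    moreover have "deriv (\<lambda>x::real. 0::real) = (\<lambda>x. 0)" by (simp add: fun_eq_iff)
    ultimately show ?thesis using \<gamma> by (intro bexI[of _ \<gamma>]) auto
  next
    case True
    obtain G where G: "\<And>x. x \<in> {a..b} \<Longrightarrow> (G has_vector_derivative \<gamma> x) (at x within {a..b})"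
      using antiderivative_continuous[OF smooth_continuous_on[OF bumps_smooth[OF \<gamma>]], of a b] by blast
    have diff: "(LINT x|lborel. indicator {s..t} x *\<^sub>R \<gamma> x) = G t - G s" if "a \<le> s" "s \<le> t" "t \<le> b" for s t
      using that by (intro integral_FTC_Icc smooth_continuous_on bumps_smooth[OF \<gamma>])
        (auto intro!: has_vector_derivative_within_subset[OF G])
    have "indicator {a..b} x *\<^sub>R \<gamma> x = \<gamma> x" for x using ab out[of x] by (cases "x \<in> {a..b}") auto
    then have "(LINT x|lborel. indicator {a..b} x *\<^sub>R \<gamma> x) = 0" by (simp only: assms(2))
    then have Gb: "G b = G a" using diff[of a b] ab True by simp
    have Gl: "G x = G a" if "a \<le> x" "x < a'" for x
    proof -
      have "(\<lambda>t. indicator {a..x} t *\<^sub>R \<gamma> t) = (\<lambda>t. 0)" using that out by (auto simp: fun_eq_iff indicator_def)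
      then show ?thesis using diff[of a x] that ab True by simp
    qed
    have Gr: "G x = G a" if "b' < x" "x \<le> b" for x
    proof -
      have "(\<lambda>t. indicator {x..b} t *\<^sub>R \<gamma> t) = (\<lambda>t. 0)" using that out by (auto simp: fun_eq_iff indicator_def)
      then show ?thesis using diff[of x b] that ab True Gb by simp
    qed
    define \<alpha> where "\<alpha> x = (if x \<in> {a..b} then G x - G a else 0)" for x
    have \<alpha>0: "\<alpha> x = 0" if "x \<notin> {a'..b'}" for x using that Gl[of x] Gr[of x] by (auto simp: \<alpha>_def)
    have d: "(\<alpha> has_real_derivative \<gamma> x) (at x)" for x
    proof (cases "x \<in> {a<..<b}")
      case True
      then have "(G has_real_derivative \<gamma> x) (at x)"
        using G[of x] at_within_Icc_at[of a x b] by (simp add: has_real_derivative_iff_has_vector_derivative)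
      then have "((\<lambda>x. G x - G a) has_real_derivative \<gamma> x) (at x)" by (auto intro!: derivative_eq_intros)
      then show ?thesis
        by (rule has_field_derivative_transform_within_open[of _ _ _ "{a<..<b}"])
          (use True in \<open>auto simp: \<alpha>_def\<close>)
    next
      case False
      then have x: "x \<in> - {a'..b'}" using ab by auto
      have "((\<lambda>x. 0) has_real_derivative \<gamma> x) (at x)" using x out[of x] by simp
      then show ?thesis
        by (rule has_field_derivative_transform_within_open[of _ _ _ "- {a'..b'}"]) (use x \<alpha>0 in auto)
    qed
    have "\<alpha> \<in> bumps a b"
      unfolding bumps_def using smooth_primitive[OF bumps_smooth[OF \<gamma>] d] ab \<alpha>0 by blast
    moreover have "deriv \<alpha> = \<gamma>" using d by (auto simp: fun_eq_iff intro: DERIV_imp_deriv)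
    ultimately show ?thesis by blast
  qed
qed

lemma bumps_add: "\<alpha> \<in> bumps a b \<Longrightarrow> \<beta> \<in> bumps a b \<Longrightarrow> (\<lambda>x. \<alpha> x + c * \<beta> x) \<in> bumps a b"
proof -
  assume ab: "\<alpha> \<in> bumps a b" "\<beta> \<in> bumps a b"
  obtain a1 b1 where 1: "a < a1" "b1 < b" "\<And>x. x \<notin> {a1..b1} \<Longrightarrow> \<alpha> x = 0" using bumps_support[OF ab(1)] by blast
  obtain a2 b2 where 2: "a < a2" "b2 < b" "\<And>x. x \<notin> {a2..b2} \<Longrightarrow> \<beta> x = 0" using bumps_support[OF ab(2)] by blast
  have "\<alpha> x + c * \<beta> x = 0" if "x \<notin> {min a1 a2..max b1 b2}" for x
  proof -
    have "x \<notin> {a1..b1}" "x \<notin> {a2..b2}" using that by auto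
    then show ?thesis by (simp add: 1(3) 2(3) del: atLeastAtMost_iff)
  qed
  moreover have "smooth (\<lambda>x. \<alpha> x + c * \<beta> x)" by (intro smooth_add smooth_cmult bumps_smooth[OF ab(1)] bumps_smooth[OF ab(2)])
  moreover have "a < min a1 a2" "max b1 b2 < b" using 1 2 by auto
  ultimately show ?thesis unfolding bumps_def by blast
qed

lemma bumps_zero: "(\<lambda>x. 0) \<in> bumps a b"
  unfolding bumps_def using smooth_cmult[OF smooth_flat[of 0], of 0] gt_ex[of a] lt_ex[of b] by auto

lemma bumps_normalized: "a < b \<Longrightarrow> \<exists>\<zeta>\<in>bumps a b. (LINT x|lborel. \<zeta> x) = 1"
proof -
  assume ab: "a < b"
  define a' b' where "a' = (2 * a + b) / 3" and "b' = (a + 2 * b) / 3"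
  have *: "a < a'" "a' < b'" "b' < b" using ab by (auto simp: a'_def b'_def)
  let ?\<eta> = "cutoff a' b' 0"
  have \<eta>: "?\<eta> \<in> bumps a b" by (intro cutoff_bumps *)
  have "(LINT x|lborel. ?\<eta> x) \<noteq> 0"
  proof
    assume "(LINT x|lborel. ?\<eta> x) = 0"
    then have "AE x in lborel. ?\<eta> x = 0"
      using integral_nonneg_eq_0_iff_AE[OF bumps_integrable[OF \<eta>]] cutoff_nonneg by auto
    then have "AE x in lborel. x \<notin> {a'<..<b'}"
    proof eventually_elim
      case (elim x)
      then show ?case using cutoff_pos[of a' x b' 0] by auto
    qed
    then have "emeasure lborel {a'<..<b'} = 0"
      by (subst (asm) AE_iff_measurable[of "{a'<..<b'}"]) auto
    then show False using * by simp
  qed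
  moreover have "(\<lambda>x. 0 + (1 / (LINT x|lborel. ?\<eta> x)) * ?\<eta> x) \<in> bumps a b"
    by (intro bumps_add \<eta> bumps_zero)
  ultimately show ?thesis by (intro bexI[of _ "\<lambda>x. 0 + (1 / (LINT x|lborel. ?\<eta> x)) * ?\<eta> x"]) auto
qed

section \<open>Weak partial derivatives and primitives\<close>

lemma
  fixes W :: "real \<times> real \<Rightarrow> real"
  assumes W: "integrable lborel W"
  shows lborel2_AE_integrable_x: "AE y in lborel. integrable lborel (\<lambda>x. W (x, y))"
    and lborel2_integrable_x: "integrable lborel (\<lambda>y. LINT x|lborel. W (x, y))"
    and lborel2_integral_x: "(LINT y|lborel. LINT x|lborel. W (x, y)) = (LINT z|lborel. W z)"
    and lborel2_AE_integrable_y: "AE x in lborel. integrable lborel (\<lambda>y. W (x, y))"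
    and lborel2_integrable_y: "integrable lborel (\<lambda>x. LINT y|lborel. W (x, y))"
    and lborel2_integral_y: "(LINT x|lborel. LINT y|lborel. W (x, y)) = (LINT z|lborel. W z)"
proof -
  have *: "integrable (lborel \<Otimes>\<^sub>M lborel) (case_prod (\<lambda>x y. W (x, y)))"
    using W by (simp add: lborel_prod)
  from lborel_pair.AE_integrable_snd[OF *] lborel_pair.integrable_snd[OF *] lborel_pair.integral_snd[OF *]
    lborel_pair.AE_integrable_fst[OF *] lborel_pair.integrable_fst[OF *] lborel_pair.integral_fst[OF *]
  show "AE y in lborel. integrable lborel (\<lambda>x. W (x, y))"
    "integrable lborel (\<lambda>y. LINT x|lborel. W (x, y))"
    "(LINT y|lborel. LINT x|lborel. W (x, y)) = (LINT z|lborel. W z)"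
    "AE x in lborel. integrable lborel (\<lambda>y. W (x, y))"
    "integrable lborel (\<lambda>x. LINT y|lborel. W (x, y))"
    "(LINT x|lborel. LINT y|lborel. W (x, y)) = (LINT z|lborel. W z)"
    by (simp_all add: lborel_prod)
qed

text \<open>\<open>P\<close> is an arbitrary predicate, so the exceptional set is first enlarged to
  a Borel null set, to which the product statements apply.\<close>

lemma lborel2_AE:
  fixes P :: "real \<times> real \<Rightarrow> bool"
  assumes "AE z in lborel. P z"
  shows lborel2_AE_yx: "AE y in lborel. AE x in lborel. P (x, y)"
    and lborel2_AE_xy: "AE x in lborel. AE y in lborel. P (x, y)"
proof -
  obtain N where N: "N \<in> null_sets lborel" "{z. \<not> P z} \<subseteq> N"
    using assms by (auto simp: eventually_ae_filter)
  then have "AE z in lborel. z \<notin> N" by (auto intro: AE_not_in)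
  then have ae: "AE z in lborel \<Otimes>\<^sub>M lborel. z \<notin> N" unfolding lborel_prod .
  have [measurable]: "N \<in> sets (lborel \<Otimes>\<^sub>M lborel)" unfolding lborel_prod using N(1) by auto
  have m: "{x \<in> space (lborel \<Otimes>\<^sub>M lborel). (fst x, snd x) \<notin> N} \<in> sets (lborel \<Otimes>\<^sub>M lborel)"
    by measurable
  have 1: "AE x in lborel. AE y in lborel. (x, y) \<notin> N" by (rule lborel_pair.AE_pair[OF ae])
  then have 2: "AE y in lborel. AE x in lborel. (x, y) \<notin> N"
    using lborel_pair.AE_commute[OF m] by simp
  have P: "(x, y) \<notin> N \<Longrightarrow> P (x, y)" for x y using N(2) by blast
  show "AE y in lborel. AE x in lborel. P (x, y)" using 2 by eventually_elim (erule eventually_mono, rule P)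
  show "AE x in lborel. AE y in lborel. P (x, y)" using 1 by eventually_elim (erule eventually_mono, rule P)
qed

lemma integrable_tensor:
  fixes f g :: "real \<Rightarrow> real"
  assumes f: "integrable lborel f" and g: "integrable lborel g"
  shows "integrable lborel (\<lambda>z. f (fst z) * g (snd z))"
proof -
  have [measurable]: "f \<in> borel_measurable borel" "g \<in> borel_measurable borel" using f g by auto
  have "integrable (lborel \<Otimes>\<^sub>M lborel) (\<lambda>z. f (fst z) * g (snd z))"
  proof (rule lborel_pair.Fubini_integrable)
    show "integrable lborel (\<lambda>x. LINT y|lborel. norm (f (fst (x, y)) * g (snd (x, y))))"
      using f by (simp add: abs_mult)
    show "AE x in lborel. integrable lborel (\<lambda>y. f (fst (x, y)) * g (snd (x, y)))"
      using g by simp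
  qed measurable
  then show ?thesis by (simp add: lborel_prod)
qed

lemma integrable_indicator_Icc: "integrable lborel (indicator {a..b} :: real \<Rightarrow> real)"
  by (cases "a \<le> b") (auto simp: integrable_indicator_iff)

text \<open>A Lebesgue integral over [a,x], hence zero for x < a. In this form measurability in x
  and in further parameters is that of a parametrized integral.\<close>

definition prim :: "real \<Rightarrow> (real \<Rightarrow> real) \<Rightarrow> real \<Rightarrow> real" where
  "prim a k x = (LINT s|lborel. indicator {a..x} s * k s)"

lemma prim_measurable [measurable]:
  assumes [measurable]: "k \<in> borel_measurable borel"
  shows "prim a k \<in> borel_measurable borel"
proof -
  have "{z::real \<times> real. a \<le> snd z \<and> snd z \<le> fst z} \<in> sets borel" by measurable
  then have [measurable]: "{z::real \<times> real. a \<le> snd z \<and> snd z \<le> fst z} \<in> sets (borel \<Otimes>\<^sub>M borel)"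
    unfolding borel_prod .
  have "(\<lambda>z. indicator {z. a \<le> snd z \<and> snd z \<le> fst z} z * k (snd z)) \<in> borel_measurable (borel \<Otimes>\<^sub>M lborel)"
    by measurable
  then have "(\<lambda>x. LINT s|lborel. indicator {z. a \<le> snd z \<and> snd z \<le> fst z} (x, s) * k (snd (x, s))) \<in> borel_measurable borel"
    by (intro lborel.borel_measurable_lebesgue_integral) (simp add: case_prod_unfold)
  moreover have "indicator {z. a \<le> snd z \<and> snd z \<le> fst z} (x, s) = (indicator {a..x} s :: real)" for x s
    by (auto simp: indicator_def)
  ultimately show ?thesis by (simp add: prim_def[abs_def])
qed

lemma prim_measurable2:
  assumes [measurable]: "k \<in> borel_measurable borel"
  shows "(\<lambda>z::real \<times> real. prim a (\<lambda>s. k (s, snd z)) (fst z)) \<in> borel_measurable borel"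
proof -
  let ?A = "{w :: (real \<times> real) \<times> real. a \<le> snd w \<and> snd w \<le> fst (fst w)}"
  have "closed ?A" by (intro closed_Collect_conj closed_Collect_le continuous_intros)
  then have [measurable]: "?A \<in> sets ((borel :: (real \<times> real) measure) \<Otimes>\<^sub>M borel)"
    unfolding borel_prod by (rule borel_closed)
  have [measurable]: "(\<lambda>w :: (real \<times> real) \<times> real. (snd w, snd (fst w))) \<in> borel_measurable (borel \<Otimes>\<^sub>M borel)"
    unfolding borel_prod by (intro borel_measurable_continuous_onI continuous_intros)
  have "(\<lambda>w. indicator ?A w * k (snd w, snd (fst w))) \<in> borel_measurable (borel \<Otimes>\<^sub>M lborel)"
    by measurable
  then have "(\<lambda>z. LINT s|lborel. indicator ?A (z, s) * k (snd (z, s), snd (fst (z, s)))) \<in> borel_measurable borel"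
    by (intro lborel.borel_measurable_lebesgue_integral) (simp add: case_prod_unfold)
  moreover have "indicator ?A (z, s) = (indicator {a..fst z} s :: real)" for z s
    by (auto simp: indicator_def)
  ultimately show ?thesis by (simp add: prim_def)
qed

lemma integrable_indicator_mult:
  fixes k :: "'a \<Rightarrow> real"
  shows "integrable M k \<Longrightarrow> A \<in> sets M \<Longrightarrow> integrable M (\<lambda>s. indicator A s * k s)"
  using integrable_real_mult_indicator[of A M k] by (simp add: mult.commute)

lemma abs_prim_le:
  assumes k: "integrable lborel k"
  shows "\<bar>prim a k x\<bar> \<le> (LINT s|lborel. \<bar>k s\<bar>)"
proof -
  have "\<bar>prim a k x\<bar> \<le> (LINT s|lborel. \<bar>indicator {a..x} s * k s\<bar>)"
    unfolding prim_def using integral_norm_bound[of lborel "\<lambda>s. indicator {a..x} s * k s"] by simp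
  also have "\<dots> \<le> (LINT s|lborel. \<bar>k s\<bar>)"
    by (intro integral_mono integrable_abs integrable_indicator_mult k) (auto split: split_indicator)
  finally show ?thesis .
qed

text \<open>The function \<open>k\<close> is only integrable, so instead of differentiating its
  primitive the order of integration is exchanged on the triangle a \<le> s \<le> x: the inner
  integral of \<alpha>' from s onwards is - \<alpha>(s).\<close>

lemma prim_by_parts:
  assumes k: "integrable lborel k" and \<alpha>: "\<alpha> \<in> bumps a b"
  shows "(LINT x|lborel. prim a k x * deriv \<alpha> x) = - (LINT s|lborel. k s * \<alpha> s)"
proof -
  note \<alpha>' = bumps_deriv[OF \<alpha>]
  note d = smooth_DERIV[OF bumps_smooth[OF \<alpha>]]
  have [measurable]: "k \<in> borel_measurable borel" "deriv \<alpha> \<in> borel_measurable borel"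
    using k bumps_measurable[OF \<alpha>'] by auto
  let ?A = "{z :: real \<times> real. a \<le> snd z \<and> snd z \<le> fst z}"
  have A [measurable]: "?A \<in> sets borel" by measurable
  let ?F = "\<lambda>z. indicator ?A z * (deriv \<alpha> (fst z) * k (snd z))"
  have F: "integrable lborel ?F"
    using A by (intro integrable_indicator_mult integrable_tensor bumps_integrable[OF \<alpha>'] k) auto
  have "(LINT x|lborel. prim a k x * deriv \<alpha> x) = (LINT x|lborel. LINT s|lborel. ?F (x, s))"
  proof (rule Bochner_Integration.integral_cong[OF refl])
    fix x
    have "prim a k x * deriv \<alpha> x = (LINT s|lborel. indicator {a..x} s * k s * deriv \<alpha> x)"
      by (simp add: prim_def)
    also have "\<dots> = (LINT s|lborel. ?F (x, s))"
      by (intro Bochner_Integration.integral_cong) (auto simp: indicator_def)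
    finally show "prim a k x * deriv \<alpha> x = (LINT s|lborel. ?F (x, s))" .
  qed
  also have "\<dots> = (LINT s|lborel. LINT x|lborel. ?F (x, s))"
    by (simp only: lborel2_integral_y[OF F] lborel2_integral_x[OF F])
  also have "\<dots> = (LINT s|lborel. - (k s * \<alpha> s))"
  proof (rule Bochner_Integration.integral_cong[OF refl])
    fix s
    show "(LINT x|lborel. ?F (x, s)) = - (k s * \<alpha> s)"
    proof (cases "a \<le> s")
      case True
      \<comment> \<open>This endpoint lies beyond the support of \<alpha> and not to the left of s,
        so \<alpha>(t) = 0 and the fundamental theorem applies on [s,t] for every s \<ge> a.\<close>
      define t where "t = max b s"
      have "?F (x, s) = k s * (indicator {s..t} x *\<^sub>R deriv \<alpha> x)" for x
        using True bumps_outside[OF \<alpha>', of x] by (cases "x < b") (auto simp: indicator_def t_def)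
      then have "(LINT x|lborel. ?F (x, s)) = k s * (LINT x|lborel. indicator {s..t} x *\<^sub>R deriv \<alpha> x)"
        by (simp only: integral_mult_right_zero)
      moreover have "(LINT x|lborel. indicator {s..t} x *\<^sub>R deriv \<alpha> x) = \<alpha> t - \<alpha> s"
        by (intro integral_FTC_Icc smooth_continuous_on bumps_smooth[OF \<alpha>'])
          (auto simp: t_def has_real_derivative_iff_has_vector_derivative[symmetric] intro: has_field_derivative_at_within d)
      moreover have "\<alpha> t = 0" by (rule bumps_outside[OF \<alpha>]) (simp add: t_def)
      ultimately show ?thesis by simp
    next
      case False
      then have "?F (x, s) = 0" for x by simp
      then have "(LINT x|lborel. ?F (x, s)) = 0" by (simp only: integral_zero)
      moreover have "\<alpha> s = 0" using False by (intro bumps_outside[OF \<alpha>]) simp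
      ultimately show ?thesis by simp
    qed
  qed
  finally show ?thesis by simp
qed

text \<open>A function with weak partial derivative \<open>k\<close> differs from the primitive of \<open>k\<close> by a function whose
  integrals against derivatives of bumps vanish. Since \<open>\<eta> - (\<integral>\<eta>) \<zeta>\<close> is the derivative of a bump when
  \<open>\<integral>\<zeta> = 1\<close>, that difference has to agree with its own \<open>\<zeta>\<close>-average.\<close>

lemma weak_partial_imp_primitive:
  fixes g k :: "real \<times> real \<Rightarrow> real"
  assumes ab: "a < b" and g: "integrable lborel g" and k: "integrable lborel k"
    and weak: "\<And>\<alpha> \<beta>. \<alpha> \<in> bumps a b \<Longrightarrow> \<beta> \<in> bumps c d \<Longrightarrow>
      (LINT z|lborel. g z * (deriv \<alpha> (fst z) * \<beta> (snd z))) = - (LINT z|lborel. k z * (\<alpha> (fst z) * \<beta> (snd z)))"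
  shows "\<exists>h. integrable lborel h \<and> (AE z in lborel. z \<in> {a<..<b} \<times> {c<..<d} \<longrightarrow>
      g z = h (snd z) + prim a (\<lambda>s. k (s, snd z)) (fst z))"
proof -
  have [measurable]: "g \<in> borel_measurable borel" "k \<in> borel_measurable borel" using g k by auto
  define K where "K z = prim a (\<lambda>s. k (s, snd z)) (fst z)" for z
  have [measurable]: "K \<in> borel_measurable borel" unfolding K_def by (rule prim_measurable2) measurable
  define \<kappa> where "\<kappa> y = (LINT s|lborel. \<bar>k (s, y)\<bar>)" for y
  have \<kappa>: "integrable lborel \<kappa>" unfolding \<kappa>_def by (rule lborel2_integrable_x) (use k in simp)
  \<comment> \<open>A primitive need not decay as x grows; only its restriction to a \<le> x \<le> b
    is integrable over the plane.\<close>
  define I where "I z = indicator {a..b} (fst z) * K z" for z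
  have I: "integrable lborel I"
  proof (rule Bochner_Integration.integrable_bound)
    show "integrable lborel (\<lambda>z. indicator {a..b} (fst z) * \<kappa> (snd z))"
      by (intro integrable_tensor \<kappa> integrable_indicator_Icc)
    show "I \<in> borel_measurable lborel" unfolding I_def by measurable
    have "AE y in lborel. integrable lborel (\<lambda>x. k (x, y))" by (rule lborel2_AE_integrable_x[OF k])
    then have "AE y in lborel. \<forall>x. \<bar>K (x, y)\<bar> \<le> \<kappa> y"
      by eventually_elim (auto simp: K_def \<kappa>_def intro: abs_prim_le)
    then obtain N where N: "N \<in> null_sets lborel" "{y. \<not> (\<forall>x. \<bar>K (x, y)\<bar> \<le> \<kappa> y)} \<subseteq> N"
      by (auto simp: eventually_ae_filter)
    have "UNIV \<times> N \<in> null_sets (lborel \<Otimes>\<^sub>M lborel)"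
      by (rule lborel.times_in_null_sets2[OF _ N(1)]) simp
    then have "AE z in lborel. z \<notin> UNIV \<times> N" by (intro AE_not_in) (simp add: lborel_prod)
    then show "AE z in lborel. norm (I z) \<le> norm (indicator {a..b} (fst z) * \<kappa> (snd z))"
    proof eventually_elim
      case (elim z)
      then have "\<bar>K z\<bar> \<le> \<kappa> (snd z)" using N(2) by (cases z) auto
      then show ?case by (auto simp: I_def split: split_indicator)
    qed
  qed
  have I_parts: "(LINT z|lborel. I z * (deriv \<alpha> (fst z) * \<beta> (snd z))) = - (LINT z|lborel. k z * (\<alpha> (fst z) * \<beta> (snd z)))"
    if \<alpha>: "\<alpha> \<in> bumps a b" and \<beta>: "\<beta> \<in> bumps c d" for \<alpha> \<beta>
  proof -
    have [measurable]: "\<alpha> \<in> borel_measurable borel" "deriv \<alpha> \<in> borel_measurable borel" "\<beta> \<in> borel_measurable borel"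
      using bumps_measurable[OF \<alpha>] bumps_measurable[OF \<beta>] bumps_measurable[OF bumps_deriv[OF \<alpha>]] by auto
    obtain A A' B where B: "\<And>x. \<bar>\<alpha> x\<bar> \<le> A" "\<And>x. \<bar>deriv \<alpha> x\<bar> \<le> A'" "\<And>x. \<bar>\<beta> x\<bar> \<le> B"
      using bumps_bounded[OF \<alpha>] bumps_bounded[OF bumps_deriv[OF \<alpha>]] bumps_bounded[OF \<beta>] by blast
    have nn: "0 \<le> A" "0 \<le> A'" using B(1)[of 0] B(2)[of 0] by linarith+
    have i1: "integrable lborel (\<lambda>z. I z * (deriv \<alpha> (fst z) * \<beta> (snd z)))"
      by (rule integrable_mult_bounded[OF I, where B = "A' * B"])
        (auto simp: abs_mult intro!: mult_mono B nn)
    have i2: "integrable lborel (\<lambda>z. k z * (\<alpha> (fst z) * \<beta> (snd z)))"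
      by (rule integrable_mult_bounded[OF k, where B = "A * B"])
        (auto simp: abs_mult intro!: mult_mono B nn)
    have "(LINT z|lborel. I z * (deriv \<alpha> (fst z) * \<beta> (snd z)))
        = (LINT y|lborel. LINT x|lborel. I (x, y) * (deriv \<alpha> x * \<beta> y))"
      using lborel2_integral_x[OF i1] by simp
    also have "\<dots> = (LINT y|lborel. LINT x|lborel. - (k (x, y) * (\<alpha> x * \<beta> y)))"
    proof (rule integral_cong_AE)
      show "(\<lambda>y. LINT x|lborel. I (x, y) * (deriv \<alpha> x * \<beta> y)) \<in> borel_measurable lborel"
        using lborel2_integrable_x[OF i1] by auto
      show "(\<lambda>y. LINT x|lborel. - (k (x, y) * (\<alpha> x * \<beta> y))) \<in> borel_measurable lborel"
        using lborel2_integrable_x[OF i2] by auto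
      show "AE y in lborel. (LINT x|lborel. I (x, y) * (deriv \<alpha> x * \<beta> y)) = (LINT x|lborel. - (k (x, y) * (\<alpha> x * \<beta> y)))"
        using lborel2_AE_integrable_x[OF k]
      proof eventually_elim
        case (elim y)
        have "I (x, y) * (deriv \<alpha> x * \<beta> y) = prim a (\<lambda>s. k (s, y)) x * deriv \<alpha> x * \<beta> y" for x
          using bumps_outside[OF bumps_deriv[OF \<alpha>], of x]
          by (cases "x \<in> {a<..<b}") (auto simp: I_def K_def indicator_def)
        then have "(LINT x|lborel. I (x, y) * (deriv \<alpha> x * \<beta> y))
            = (LINT x|lborel. prim a (\<lambda>s. k (s, y)) x * deriv \<alpha> x) * \<beta> y"
          by (simp only: integral_mult_left_zero)
        also have "\<dots> = - (LINT x|lborel. k (x, y) * \<alpha> x) * \<beta> y"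
          by (simp only: prim_by_parts[OF elim \<alpha>])
        also have "\<dots> = (LINT x|lborel. - (k (x, y) * (\<alpha> x * \<beta> y)))"
          by (simp add: mult.assoc[symmetric])
        finally show ?case .
      qed
    qed
    also have "\<dots> = - (LINT z|lborel. k z * (\<alpha> (fst z) * \<beta> (snd z)))"
      using lborel2_integral_x[OF i2] by simp
    finally show ?thesis .
  qed
  obtain \<zeta> where \<zeta>: "\<zeta> \<in> bumps a b" and \<zeta>1: "(LINT x|lborel. \<zeta> x) = 1" using bumps_normalized[OF ab] by blast
  have [measurable]: "\<zeta> \<in> borel_measurable borel" by (rule bumps_measurable[OF \<zeta>])
  obtain Z where Z: "\<And>x. \<bar>\<zeta> x\<bar> \<le> Z" using bumps_bounded[OF \<zeta>] by blast
  define w where "w z = g z - I z" for z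
  have w: "integrable lborel w" unfolding w_def using g I by simp
  have w0: "(LINT z|lborel. w z * (deriv \<alpha> (fst z) * \<beta> (snd z))) = 0"
    if \<alpha>: "\<alpha> \<in> bumps a b" and \<beta>: "\<beta> \<in> bumps c d" for \<alpha> \<beta>
  proof -
    have [measurable]: "deriv \<alpha> \<in> borel_measurable borel" "\<beta> \<in> borel_measurable borel"
      using bumps_measurable[OF \<beta>] bumps_measurable[OF bumps_deriv[OF \<alpha>]] by auto
    obtain A' B where B: "\<And>x. \<bar>deriv \<alpha> x\<bar> \<le> A'" "\<And>x. \<bar>\<beta> x\<bar> \<le> B"
      using bumps_bounded[OF bumps_deriv[OF \<alpha>]] bumps_bounded[OF \<beta>] by blast
    have nn: "0 \<le> A'" using B(1)[of 0] by linarith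
    have i: "integrable lborel (\<lambda>z. f z * (deriv \<alpha> (fst z) * \<beta> (snd z)))" if "integrable lborel f" for f :: "real \<times> real \<Rightarrow> real"
      by (rule integrable_mult_bounded[OF that, where B = "A' * B"])
        (auto simp: abs_mult intro!: mult_mono B nn)
    show ?thesis using weak[OF \<alpha> \<beta>] I_parts[OF \<alpha> \<beta>] i[OF g] i[OF I]
      by (simp add: w_def left_diff_distrib)
  qed
  have w\<zeta>: "integrable lborel (\<lambda>z. w z * \<zeta> (fst z))"
    by (rule integrable_mult_bounded[OF w, where B = Z]) (auto intro: Z)
  \<comment> \<open>The \<zeta>-average of the difference on each horizontal line; this is the
    constant of integration.\<close>
  define h where "h y = (LINT x|lborel. w (x, y) * \<zeta> x)" for y
  have h: "integrable lborel h" unfolding h_def using lborel2_integrable_x[OF w\<zeta>] by simp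
  define v where "v z = w z - indicator {a..b} (fst z) * h (snd z)" for z
  have ih: "integrable lborel (\<lambda>z. indicator {a..b} (fst z) * h (snd z))"
    by (intro integrable_tensor h integrable_indicator_Icc)
  have v: "integrable lborel v" unfolding v_def using w ih by simp
  have "AE z in lborel. z \<in> {a<..<b} \<times> {c<..<d} \<longrightarrow> v z = 0"
  proof (rule fundamental_lemma)
    fix a1 b1 c1 d1 :: real
    have [measurable]: "{a1..b1} \<times> {c1..d1} \<in> sets borel" by (intro borel_closed closed_Times) auto
    have "integrable lborel (\<lambda>z. indicator ({a1..b1} \<times> {c1..d1}) z * v z)"
      by (intro integrable_indicator_mult v) auto
    then show "integrable lebesgue (\<lambda>z. indicator ({a1..b1} \<times> {c1..d1}) z * v z)"
      by (subst integrable_completion) auto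
  next
    fix \<eta> \<beta> assume \<eta>: "\<eta> \<in> bumps a b" and \<beta>: "\<beta> \<in> bumps c d"
    have [measurable]: "\<eta> \<in> borel_measurable borel" "\<beta> \<in> borel_measurable borel"
      using bumps_measurable[OF \<eta>] bumps_measurable[OF \<beta>] by auto
    obtain A B where B: "\<And>x. \<bar>\<eta> x\<bar> \<le> A" "\<And>x. \<bar>\<beta> x\<bar> \<le> B"
      using bumps_bounded[OF \<eta>] bumps_bounded[OF \<beta>] by blast
    have nn: "0 \<le> A" "0 \<le> Z" using B(1)[of 0] Z[of 0] by linarith+
    define m where "m = (LINT x|lborel. \<eta> x)"
    have "(\<lambda>x. \<eta> x + (- m) * \<zeta> x) \<in> bumps a b" by (rule bumps_add[OF \<eta> \<zeta>])
    moreover have "(LINT x|lborel. \<eta> x + (- m) * \<zeta> x) = 0"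
      using bumps_integrable[OF \<eta>] bumps_integrable[OF \<zeta>] \<zeta>1 by (simp add: m_def)
    ultimately obtain \<alpha> where \<alpha>: "\<alpha> \<in> bumps a b" "deriv \<alpha> = (\<lambda>x. \<eta> x + (- m) * \<zeta> x)"
      using bumps_primitive by blast
    have i1: "integrable lborel (\<lambda>z. f z * (\<eta> (fst z) * \<beta> (snd z)))" if "integrable lborel f" for f :: "real \<times> real \<Rightarrow> real"
      by (rule integrable_mult_bounded[OF that, where B = "A * B"])
        (auto simp: abs_mult intro!: mult_mono B nn)
    have i2: "integrable lborel (\<lambda>z. w z * (\<zeta> (fst z) * \<beta> (snd z)))"
      by (rule integrable_mult_bounded[OF w, where B = "Z * B"])
        (auto simp: abs_mult intro!: mult_mono B Z nn)
    have "0 = (LINT z|lborel. w z * (\<eta> (fst z) * \<beta> (snd z)) - m * (w z * (\<zeta> (fst z) * \<beta> (snd z))))"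
      using w0[OF \<alpha>(1) \<beta>] by (simp add: \<alpha>(2) algebra_simps)
    then have eq: "(LINT z|lborel. w z * (\<eta> (fst z) * \<beta> (snd z))) = m * (LINT z|lborel. w z * (\<zeta> (fst z) * \<beta> (snd z)))"
      using i1[OF w] i2 by simp
    have "(LINT z|lborel. w z * (\<zeta> (fst z) * \<beta> (snd z))) = (LINT y|lborel. h y * \<beta> y)"
      using lborel2_integral_x[OF i2] by (simp add: h_def mult.assoc[symmetric])
    moreover have "(LINT z|lborel. indicator {a..b} (fst z) * h (snd z) * (\<eta> (fst z) * \<beta> (snd z))) = m * (LINT y|lborel. h y * \<beta> y)"
    proof -
      have "indicator {a..b} x * h y * (\<eta> x * \<beta> y) = \<eta> x * (h y * \<beta> y)" for x y
        using bumps_outside[OF \<eta>, of x] by (cases "x \<in> {a<..<b}") (auto simp: indicator_def)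
      then have "(LINT y|lborel. LINT x|lborel. indicator {a..b} x * h y * (\<eta> x * \<beta> y)) = (LINT y|lborel. m * (h y * \<beta> y))"
        unfolding m_def by (simp only: integral_mult_left_zero)
      then show ?thesis using lborel2_integral_x[OF i1[OF ih]] by simp
    qed
    ultimately have "(LINT z|lborel. v z * (\<eta> (fst z) * \<beta> (snd z))) = 0"
      using eq i1[OF w] i1[OF ih] by (simp add: v_def left_diff_distrib)
    then show "(LINT z|lebesgue. v z * (\<eta> (fst z) * \<beta> (snd z))) = 0"
      using i1[OF v] by (subst integral_completion) auto
  qed
  then have "AE z in lborel. z \<in> {a<..<b} \<times> {c<..<d} \<longrightarrow> g z = h (snd z) + prim a (\<lambda>s. k (s, snd z)) (fst z)"
    by eventually_elim (auto simp: v_def w_def I_def K_def)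
  with h show ?thesis by blast
qed

section \<open>Exchanging the two coordinates\<close>

lemma lborel_swap: "distr lborel borel (\<lambda>z. (snd z, fst z)) = (lborel :: (real \<times> real) measure)"
proof -
  have "(lborel :: (real \<times> real) measure) = distr (lborel \<Otimes>\<^sub>M lborel) (lborel \<Otimes>\<^sub>M lborel) (\<lambda>(x, y). (y, x))"
    using lborel_pair.distr_pair_swap[where 'a=real and 'b=real] unfolding lborel_prod .
  also have "\<dots> = distr lborel lborel (\<lambda>z. (snd z, fst z))"
    by (simp only: lborel_prod case_prod_unfold)
  also have "\<dots> = distr lborel borel (\<lambda>z. (snd z, fst z))"
    by (rule distr_cong) auto
  finally show ?thesis by simp
qed

lemma measurable_swap_borel [measurable]:
  "(\<lambda>z :: real \<times> real. (snd z, fst z)) \<in> borel_measurable borel"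
  by (intro borel_measurable_continuous_onI continuous_intros)

lemma integrable_swap:
  fixes g :: "real \<times> real \<Rightarrow> real"
  shows "integrable lborel g \<Longrightarrow> integrable lborel (\<lambda>z. g (snd z, fst z))"
  using integrable_distr[of "\<lambda>z. (snd z, fst z)" lborel borel g] by (simp add: lborel_swap)

lemma integral_swap:
  fixes g :: "real \<times> real \<Rightarrow> real"
  assumes "g \<in> borel_measurable borel"
  shows "(LINT z|lborel. g (snd z, fst z)) = (LINT z|lborel. g z)"
  using integral_distr[of "\<lambda>z. (snd z, fst z)" lborel borel g] assms by (simp add: lborel_swap)

lemma AE_swap:
  fixes P :: "real \<times> real \<Rightarrow> bool"
  assumes "AE z in lborel. P z"
  shows "AE z in lborel. P (snd z, fst z)"
proof -
  have "AE z in distr lborel borel (\<lambda>z. (snd z, fst z)). P z" using assms unfolding lborel_swap .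
  then show ?thesis by (rule AE_distrD[rotated]) simp
qed

lemma weak_partial_imp_primitive_snd:
  fixes g k :: "real \<times> real \<Rightarrow> real"
  assumes cd: "c < d" and g: "integrable lborel g" and k: "integrable lborel k"
    and weak: "\<And>\<alpha> \<beta>. \<alpha> \<in> bumps a b \<Longrightarrow> \<beta> \<in> bumps c d \<Longrightarrow>
      (LINT z|lborel. g z * (\<alpha> (fst z) * deriv \<beta> (snd z))) = - (LINT z|lborel. k z * (\<alpha> (fst z) * \<beta> (snd z)))"
  shows "\<exists>h. integrable lborel h \<and> (AE z in lborel. z \<in> {a<..<b} \<times> {c<..<d} \<longrightarrow>
      g z = h (fst z) + prim c (\<lambda>t. k (fst z, t)) (snd z))"
proof -
  have [measurable]: "g \<in> borel_measurable borel" "k \<in> borel_measurable borel" using g k by auto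
  have "\<exists>h. integrable lborel h \<and> (AE z in lborel. z \<in> {c<..<d} \<times> {a<..<b} \<longrightarrow>
      g (snd z, fst z) = h (snd z) + prim c (\<lambda>s. k (snd (s, snd z), fst (s, snd z))) (fst z))"
  proof (rule weak_partial_imp_primitive[OF cd integrable_swap[OF g] integrable_swap[OF k]])
    fix \<beta> \<alpha> assume \<beta>: "\<beta> \<in> bumps c d" and \<alpha>: "\<alpha> \<in> bumps a b"
    have [measurable]: "\<alpha> \<in> borel_measurable borel" "deriv \<beta> \<in> borel_measurable borel" "\<beta> \<in> borel_measurable borel"
      using bumps_measurable[OF \<alpha>] bumps_measurable[OF \<beta>] bumps_measurable[OF bumps_deriv[OF \<beta>]] by auto
    show "(LINT z|lborel. g (snd z, fst z) * (deriv \<beta> (fst z) * \<alpha> (snd z))) =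
        - (LINT z|lborel. k (snd z, fst z) * (\<beta> (fst z) * \<alpha> (snd z)))"
      using integral_swap[of "\<lambda>z. g z * (\<alpha> (fst z) * deriv \<beta> (snd z))"]
        integral_swap[of "\<lambda>z. k z * (\<alpha> (fst z) * \<beta> (snd z))"] weak[OF \<alpha> \<beta>]
      by (simp add: mult.commute[of "deriv \<beta> _"] mult.commute[of "\<beta> _" "\<alpha> _"])
  qed
  then obtain h where "integrable lborel h" and ae: "AE z in lborel. z \<in> {c<..<d} \<times> {a<..<b} \<longrightarrow>
      g (snd z, fst z) = h (snd z) + prim c (\<lambda>s. k (snd z, s)) (fst z)" by auto
  moreover from AE_swap[OF ae] have "AE z in lborel. z \<in> {a<..<b} \<times> {c<..<d} \<longrightarrow>
      g z = h (fst z) + prim c (\<lambda>t. k (fst z, t)) (snd z)"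
    by eventually_elim (auto simp: mem_Times_iff)
  ultimately show ?thesis by blast
qed

text \<open>Carries identities that hold almost everywhere over to every point, including the
  endpoints where the boundary values sit: the nonnegative continuous function |f - c| has integral
  zero.\<close>

lemma continuous_AE_const:
  fixes f :: "real \<Rightarrow> real"
  assumes ab: "a < b" and cont: "continuous_on {a..b} f" and ae: "AE x in lborel. x \<in> {a<..<b} \<longrightarrow> f x = c"
    and x: "x \<in> {a..b}"
  shows "f x = c"
proof -
  have "AE x in lborel. x \<noteq> a \<and> x \<noteq> b" by (intro AE_conjI AE_lborel_singleton)
  with ae have "AE x in lborel. x \<in> {a..b} \<longrightarrow> f x = c" by eventually_elim auto
  then obtain N where N: "N \<in> null_sets lborel" "{x. \<not> (x \<in> {a..b} \<longrightarrow> f x = c)} \<subseteq> N"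
    by (auto simp: eventually_ae_filter)
  have "((\<lambda>x. \<bar>f x - c\<bar>) has_integral 0) (cbox a b)"
  proof (rule has_integral_negligible)
    show "negligible N" using N(1) by (simp add: negligible_iff_null_sets null_sets_completionI)
  qed (use N(2) in auto)
  then have "\<bar>f x - c\<bar> = 0"
    by (intro has_integral_0_cbox_imp_0[of a b "\<lambda>x. \<bar>f x - c\<bar>"] continuous_intros)
      (use assms in auto)
  then show ?thesis by simp
qed

lemma prim_eq_integral: "integrable lborel k \<Longrightarrow> prim a k x = integral {a..x} k"
  using set_borel_integral_eq_integral(2)[of "{a..x}" k]
    integrable_indicator_mult[of lborel k "{a..x}"]
  by (simp add: prim_def set_integrable_def set_lebesgue_integral_def)

lemma prim_continuous_on:
  assumes k: "integrable lborel k"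
  shows "continuous_on {a..b} (prim a k)"
proof -
  have "k integrable_on {a..b}"
    using set_borel_integral_eq_integral(1)[of "{a..b}" k] integrable_indicator_mult[OF k, of "{a..b}"]
    by (simp add: set_integrable_def)
  then have "continuous_on {a..b} (\<lambda>x. integral {a..x} k)" by (rule indefinite_integral_continuous_1)
  then show ?thesis by (simp add: prim_eq_integral[OF k])
qed

lemma prim_left [simp]: "prim a k a = 0"
proof -
  have "AE s in lborel. indicator {a..a} s * k s = 0"
    using AE_lborel_singleton[of a] by eventually_elim auto
  then show ?thesis unfolding prim_def by (rule integral_eq_zero_AE)
qed

lemma prim_diff:
  assumes k: "integrable lborel k" and "a \<le> x" "x \<le> y"
  shows "prim a k y - prim a k x = (LINT s|lborel. indicator {x<..y} s * k s)"
proof -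
  have "indicator {a..y} s * k s - indicator {a..x} s * k s = indicator {x<..y} s * k s" for s
    using assms(2,3) by (auto simp: indicator_def)
  moreover have "prim a k y - prim a k x = (LINT s|lborel. indicator {a..y} s * k s - indicator {a..x} s * k s)"
    unfolding prim_def by (intro Bochner_Integration.integral_diff[symmetric] integrable_indicator_mult k) auto
  ultimately show ?thesis by simp
qed

lemma AE_lborel_fst_snd:
  fixes P :: "real \<Rightarrow> bool"
  assumes "AE x in lborel. P x"
  shows "AE z in (lborel :: (real \<times> real) measure). P (fst z)"
    and "AE z in (lborel :: (real \<times> real) measure). P (snd z)"
proof -
  obtain N where N: "N \<in> null_sets lborel" "{x. \<not> P x} \<subseteq> N"
    using assms by (auto simp: eventually_ae_filter)
  have "UNIV \<times> N \<in> null_sets (lborel \<Otimes>\<^sub>M lborel)"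
    by (rule lborel.times_in_null_sets2[OF _ N(1)]) simp
  then have "AE z in (lborel :: (real \<times> real) measure). z \<notin> UNIV \<times> N"
    unfolding lborel_prod by (rule AE_not_in)
  then show snd: "AE z in (lborel :: (real \<times> real) measure). P (snd z)"
    by eventually_elim (use N(2) in auto)
  then show "AE z in (lborel :: (real \<times> real) measure). P (fst z)"
    using AE_swap[of "\<lambda>z. P (snd z)"] by simp
qed

lemma exists_point_if_AE:
  assumes "AE x in lborel. P x" "a < (b::real)"
  shows "\<exists>x\<in>{a<..<b}. P x"
proof (rule ccontr)
  assume "\<not> ?thesis"
  with assms(1) have "AE x in lborel. x \<notin> {a<..<b}" by (auto elim!: eventually_mono)
  then have "emeasure lborel {a<..<b} = 0" by (subst (asm) AE_iff_measurable[of "{a<..<b}"]) auto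
  then show False using assms(2) by simp
qed

lemma abs_LINT_indicator_le:
  fixes g :: "'a \<Rightarrow> real"
  assumes g: "integrable M g" and A: "A \<in> sets M" and B: "AE z in M. z \<in> A \<longrightarrow> \<bar>g z\<bar> \<le> f z"
    and f: "integrable M f" "\<And>z. 0 \<le> f z"
  shows "\<bar>LINT z|M. indicator A z * g z\<bar> \<le> (LINT z|M. f z)"
proof -
  have "\<bar>LINT z|M. indicator A z * g z\<bar> \<le> (LINT z|M. \<bar>indicator A z * g z\<bar>)"
    using integral_norm_bound[of M "\<lambda>z. indicator A z * g z"] by simp
  also have "\<dots> \<le> (LINT z|M. f z)"
    by (intro integral_mono_AE integrable_abs integrable_indicator_mult g A f)
      (use B in eventually_elim, use f(2) in \<open>auto simp: indicator_def\<close>)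
  finally show ?thesis .
qed

section \<open>A priori estimates on the plate\<close>

lemma plate_borel [measurable]: "plate l \<in> sets borel"
  unfolding plate_def by (intro borel_open open_Times) auto

lemma AE_Icc_Ioo: "AE x in lborel. x \<in> {a..b::real} \<longrightarrow> x \<in> {a<..<b}"
proof -
  have "AE x in lborel. x \<noteq> a \<and> x \<noteq> b" by (intro AE_conjI AE_lborel_singleton)
  then show ?thesis by eventually_elim auto
qed

text \<open>The functions g, q, k, h play the roles of u_x, u_y, u_xx and u_xy. They are Borel and
  integrable over the whole plane, so that Fubini's theorem applies directly, and the derivative
  relations are required only against products of bumps.\<close>

locale hinged_jet =
  fixes l :: real and u g q k h :: "real \<times> real \<Rightarrow> real"
  assumes l: "0 < l"
    and cont: "continuous_on ({0..pi} \<times> {-l..l}) u"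
    and left: "y \<in> {-l..l} \<Longrightarrow> u (0, y) = 0"
    and right: "y \<in> {-l..l} \<Longrightarrow> u (pi, y) = 0"
    and g: "integrable lborel g" and q: "integrable lborel q"
    and k: "integrable lborel k" and h: "integrable lborel h"
    and weak_ux: "\<And>\<alpha> \<beta>. \<alpha> \<in> bumps 0 pi \<Longrightarrow> \<beta> \<in> bumps (-l) l \<Longrightarrow>
      (LINT z|lborel. (indicator (plate l) z * u z) * (deriv \<alpha> (fst z) * \<beta> (snd z))) = - (LINT z|lborel. g z * (\<alpha> (fst z) * \<beta> (snd z)))"
    and weak_uy: "\<And>\<alpha> \<beta>. \<alpha> \<in> bumps 0 pi \<Longrightarrow> \<beta> \<in> bumps (-l) l \<Longrightarrow>
      (LINT z|lborel. (indicator (plate l) z * u z) * (\<alpha> (fst z) * deriv \<beta> (snd z))) = - (LINT z|lborel. q z * (\<alpha> (fst z) * \<beta> (snd z)))"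
    and weak_gx: "\<And>\<alpha> \<beta>. \<alpha> \<in> bumps 0 pi \<Longrightarrow> \<beta> \<in> bumps (-l) l \<Longrightarrow>
      (LINT z|lborel. g z * (deriv \<alpha> (fst z) * \<beta> (snd z))) = - (LINT z|lborel. k z * (\<alpha> (fst z) * \<beta> (snd z)))"
    and weak_qx: "\<And>\<alpha> \<beta>. \<alpha> \<in> bumps 0 pi \<Longrightarrow> \<beta> \<in> bumps (-l) l \<Longrightarrow>
      (LINT z|lborel. q z * (deriv \<alpha> (fst z) * \<beta> (snd z))) = - (LINT z|lborel. h z * (\<alpha> (fst z) * \<beta> (snd z)))"
begin

lemma integrable_u: "integrable lborel (\<lambda>z. indicator (plate l) z * u z)"
proof -
  have "integrable lborel (\<lambda>z. indicator ({0..pi} \<times> {-l..l}) z *\<^sub>R u z)"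
    by (intro borel_integrable_compact cont compact_Times compact_Icc)
  then have "integrable lborel (\<lambda>z. indicator (plate l) z * (indicator ({0..pi} \<times> {-l..l}) z *\<^sub>R u z))"
    by (rule integrable_indicator_mult) auto
  moreover have "indicator (plate l) z * (indicator ({0..pi} \<times> {-l..l}) z *\<^sub>R u z) = indicator (plate l) z * u z" for z
    by (auto simp: plate_def indicator_def)
  ultimately show ?thesis by (simp only:)
qed

lemma cont_x: "y \<in> {-l..l} \<Longrightarrow> continuous_on {0..pi} (\<lambda>x. u (x, y))"
  by (rule continuous_on_compose2[OF cont]) (auto intro!: continuous_intros)

lemma cont_y: "x \<in> {0..pi} \<Longrightarrow> continuous_on {-l..l} (\<lambda>y. u (x, y))"
  by (rule continuous_on_compose2[OF cont]) (auto intro!: continuous_intros)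

text \<open>On almost every horizontal line u differs from the primitive of u_x by a constant.
  Continuity extends this to the closed interval, and the value 0 at x = 0 fixes the
  constant.\<close>

lemma u_eq_prim:
  "AE y in lborel. y \<in> {-l<..<l} \<longrightarrow> (\<forall>x\<in>{0..pi}. u (x, y) = prim 0 (\<lambda>s. g (s, y)) x)"
proof -
  obtain c where ae: "AE z in lborel. z \<in> {0<..<pi} \<times> {-l<..<l} \<longrightarrow>
      indicator (plate l) z * u z = c (snd z) + prim 0 (\<lambda>s. g (s, snd z)) (fst z)"
    using weak_partial_imp_primitive[OF pi_gt_zero integrable_u g weak_ux] by blast
  from lborel2_AE_yx[OF ae] lborel2_AE_integrable_x[OF g] show ?thesis
  proof eventually_elim
    case (elim y)
    show ?case
    proof (intro impI ballI)
      fix x assume y: "y \<in> {-l<..<l}" and x: "x \<in> {0..pi}"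
      have ae: "AE x in lborel. x \<in> {0<..<pi} \<longrightarrow> u (x, y) - prim 0 (\<lambda>s. g (s, y)) x = c y"
        using elim(1) by eventually_elim (use y in \<open>auto simp: plate_def\<close>)
      have cont: "continuous_on {0..pi} (\<lambda>x. u (x, y) - prim 0 (\<lambda>s. g (s, y)) x)"
        using y by (intro continuous_intros cont_x prim_continuous_on elim(2)) auto
      note * = continuous_AE_const[OF pi_gt_zero cont ae]
      have "0 = c y" using *[of 0] left[of y] y by simp
      then show "u (x, y) = prim 0 (\<lambda>s. g (s, y)) x" using *[OF x] by simp
    qed
  qed
qed

text \<open>The L^1 norm of u_xx on the horizontal line at height y. The later \<open>H\<close> is
  its counterpart for u_xy.\<close>

definition \<kappa> :: "real \<Rightarrow> real" where "\<kappa> y = (LINT s|lborel. \<bar>k (s, y)\<bar>)"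

lemma \<kappa>: "integrable lborel \<kappa>" "0 \<le> \<kappa> y" "(LINT y|lborel. \<kappa> y) = (LINT z|lborel. \<bar>k z\<bar>)"
  unfolding \<kappa>_def using lborel2_integrable_x[of "\<lambda>z. \<bar>k z\<bar>"] lborel2_integral_x[of "\<lambda>z. \<bar>k z\<bar>"] k by auto

text \<open>On a horizontal line u_x = c(y) + primitive of u_xx. As u vanishes at both ends, u_x has
  integral zero, so pi * c(y) is minus the integral of that primitive and |c(y)| \<le>
  \<open>\<kappa> y\<close>. This gives the factor 2 for u_x, and integration over a length of at
  most pi gives 2 pi for u.\<close>

lemma g_section_bound:
  shows "AE z in lborel. z \<in> plate l \<longrightarrow> \<bar>g z\<bar> \<le> 2 * \<kappa> (snd z)"
    and u_section_bound: "AE y in lborel. y \<in> {-l<..<l} \<longrightarrow> (\<forall>x\<in>{0..pi}. \<bar>u (x, y)\<bar> \<le> 2 * pi * \<kappa> y)"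
proof -
  obtain c where ae: "AE z in lborel. z \<in> {0<..<pi} \<times> {-l<..<l} \<longrightarrow>
      g z = c (snd z) + prim 0 (\<lambda>s. k (s, snd z)) (fst z)"
    using weak_partial_imp_primitive[OF pi_gt_zero g k weak_gx] by blast
  have Icc: "integrable lborel (\<lambda>x. indicator {0..pi} x * (r :: real))" for r
    using integrable_indicator_Icc by simp
  have [measurable]: "k \<in> borel_measurable borel" using k by auto
  have c: "AE y in lborel. y \<in> {-l<..<l} \<longrightarrow> \<bar>c y\<bar> \<le> \<kappa> y"
    using lborel2_AE_yx[OF ae] lborel2_AE_integrable_x[OF g] lborel2_AE_integrable_x[OF k] u_eq_prim
  proof eventually_elim
    case (elim y)
    show ?case
    proof
      assume y: "y \<in> {-l<..<l}"
      have m: "prim 0 (\<lambda>s. k (s, y)) \<in> borel_measurable borel" by (rule prim_measurable) measurable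
      have p: "\<bar>prim 0 (\<lambda>s. k (s, y)) x\<bar> \<le> \<kappa> y" for x unfolding \<kappa>_def by (rule abs_prim_le[OF elim(3)])
      have ip: "integrable lborel (\<lambda>x. indicator {0..pi} x * prim 0 (\<lambda>s. k (s, y)) x)"
        by (rule integrable_mult_bounded[OF integrable_indicator_Icc _ p]) (use m in simp)
      have "0 = prim 0 (\<lambda>s. g (s, y)) pi" using elim(4) y right[of y] by auto
      also have "\<dots> = (LINT x|lborel. indicator {0..pi} x * c y + indicator {0..pi} x * prim 0 (\<lambda>s. k (s, y)) x)"
        unfolding prim_def[of 0 "\<lambda>s. g (s, y)"]
      proof (rule integral_cong_AE)
        show "(\<lambda>x. indicator {0..pi} x * g (x, y)) \<in> borel_measurable lborel"
          using integrable_indicator_mult[OF elim(2), of "{0..pi}"] by auto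
        show "(\<lambda>x. indicator {0..pi} x * c y + indicator {0..pi} x * prim 0 (\<lambda>s. k (s, y)) x) \<in> borel_measurable lborel"
          using m by simp
        show "AE x in lborel. indicator {0..pi} x * g (x, y) = indicator {0..pi} x * c y + indicator {0..pi} x * prim 0 (\<lambda>s. k (s, y)) x"
          using elim(1) AE_Icc_Ioo[of 0 pi] by eventually_elim (use y in \<open>auto simp: indicator_def\<close>)
      qed
      also have "\<dots> = pi * c y + (LINT x|lborel. indicator {0..pi} x * prim 0 (\<lambda>s. k (s, y)) x)"
        using Icc ip by (simp add: pi_ge_zero)
      finally have "pi * c y = - (LINT x|lborel. indicator {0..pi} x * prim 0 (\<lambda>s. k (s, y)) x)" by linarith
      then have "\<bar>pi * c y\<bar> = \<bar>LINT x|lborel. indicator {0..pi} x * prim 0 (\<lambda>s. k (s, y)) x\<bar>" by linarith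
      then have "pi * \<bar>c y\<bar> = \<bar>LINT x|lborel. indicator {0..pi} x * prim 0 (\<lambda>s. k (s, y)) x\<bar>"
        by (simp add: abs_mult)
      also have "\<dots> \<le> (LINT x|lborel. \<bar>indicator {0..pi} x * prim 0 (\<lambda>s. k (s, y)) x\<bar>)"
        using integral_norm_bound[of lborel "\<lambda>x. indicator {0..pi} x * prim 0 (\<lambda>s. k (s, y)) x"] by simp
      also have "\<dots> \<le> (LINT x|lborel. indicator {0..pi} x * \<kappa> y)"
        by (intro integral_mono integrable_abs ip Icc) (use p in \<open>auto simp: indicator_def\<close>)
      also have "\<dots> = pi * \<kappa> y" by (simp add: pi_ge_zero)
      finally show "\<bar>c y\<bar> \<le> \<kappa> y" by simp
    qed
  qed
  show gb: "AE z in lborel. z \<in> plate l \<longrightarrow> \<bar>g z\<bar> \<le> 2 * \<kappa> (snd z)"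
    using ae AE_lborel_fst_snd(2)[OF c] AE_lborel_fst_snd(2)[OF lborel2_AE_integrable_x[OF k]]
  proof eventually_elim
    case (elim z)
    show ?case
    proof
      assume z: "z \<in> plate l"
      then have "\<bar>c (snd z)\<bar> \<le> \<kappa> (snd z)" using elim(2) by (auto simp: plate_def)
      moreover have "\<bar>prim 0 (\<lambda>s. k (s, snd z)) (fst z)\<bar> \<le> \<kappa> (snd z)"
        unfolding \<kappa>_def by (rule abs_prim_le[OF elim(3)])
      ultimately show "\<bar>g z\<bar> \<le> 2 * \<kappa> (snd z)" using elim(1) z by (auto simp: plate_def)
    qed
  qed
  show "AE y in lborel. y \<in> {-l<..<l} \<longrightarrow> (\<forall>x\<in>{0..pi}. \<bar>u (x, y)\<bar> \<le> 2 * pi * \<kappa> y)"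
    using lborel2_AE_yx[OF gb] lborel2_AE_integrable_x[OF g] u_eq_prim
  proof eventually_elim
    case (elim y)
    show ?case
    proof (intro impI ballI)
      fix x assume y: "y \<in> {-l<..<l}" and x: "x \<in> {0..pi}"
      have "\<bar>LINT s|lborel. indicator {0..x} s * g (s, y)\<bar> \<le> (LINT s|lborel. indicator {0..pi} s * (2 * \<kappa> y))"
      proof (rule abs_LINT_indicator_le)
        show "AE s in lborel. s \<in> {0..x} \<longrightarrow> \<bar>g (s, y)\<bar> \<le> indicator {0..pi} s * (2 * \<kappa> y)"
          using elim(1) AE_Icc_Ioo[of 0 pi] by eventually_elim (use x y in \<open>auto simp: plate_def indicator_def\<close>)
      qed (use elim(2) Icc \<kappa>(2) in auto)
      then show "\<bar>u (x, y)\<bar> \<le> 2 * pi * \<kappa> y"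
        using elim(3) x y by (simp add: prim_def pi_ge_zero mult_ac)
    qed
  qed
qed

definition H :: "real \<Rightarrow> real" where "H y = (LINT s|lborel. \<bar>h (s, y)\<bar>)"

lemma H: "integrable lborel H" "0 \<le> H y" "(LINT y|lborel. H y) = (LINT z|lborel. \<bar>h z\<bar>)"
  unfolding H_def using lborel2_integrable_x[of "\<lambda>z. \<bar>h z\<bar>"] lborel2_integral_x[of "\<lambda>z. \<bar>h z\<bar>"] h by auto

lemma u_diff_eq:
  "AE x in lborel. x \<in> {0<..<pi} \<longrightarrow> (\<forall>y1\<in>{-l..l}. \<forall>y2\<in>{y1..l}.
     u (x, y2) - u (x, y1) = (LINT t|lborel. indicator {y1<..y2} t * q (x, t)))"
proof -
  have ll: "-l < l" using l by simp
  obtain c where ae: "AE z in lborel. z \<in> {0<..<pi} \<times> {-l<..<l} \<longrightarrow>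
      indicator (plate l) z * u z = c (fst z) + prim (-l) (\<lambda>t. q (fst z, t)) (snd z)"
    using weak_partial_imp_primitive_snd[OF ll integrable_u q weak_uy] by blast
  from lborel2_AE_xy[OF ae] lborel2_AE_integrable_y[OF q] show ?thesis
  proof eventually_elim
    case (elim x)
    show ?case
    proof (intro impI ballI)
      fix y1 y2 assume x: "x \<in> {0<..<pi}" and y: "y1 \<in> {-l..l}" "y2 \<in> {y1..l}"
      have ae: "AE y in lborel. y \<in> {-l<..<l} \<longrightarrow> u (x, y) - prim (-l) (\<lambda>t. q (x, t)) y = c x"
        using elim(1) by eventually_elim (use x in \<open>auto simp: plate_def\<close>)
      have cont: "continuous_on {-l..l} (\<lambda>y. u (x, y) - prim (-l) (\<lambda>t. q (x, t)) y)"
        using x by (intro continuous_intros cont_y prim_continuous_on elim(2)) auto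
      note * = continuous_AE_const[OF ll cont ae]
      have "u (x, y2) - u (x, y1) = prim (-l) (\<lambda>t. q (x, t)) y2 - prim (-l) (\<lambda>t. q (x, t)) y1"
        using *[of y1] *[of y2] y by auto
      also have "\<dots> = (LINT t|lborel. indicator {y1<..y2} t * q (x, t))"
        using y by (intro prim_diff elim(2)) auto
      finally show "u (x, y2) - u (x, y1) = (LINT t|lborel. indicator {y1<..y2} t * q (x, t))" .
    qed
  qed
qed

text \<open>On horizontal lines u_y = c(y) + primitive of u_xy, and c = 0 is the weak form of u_y =
  0 on the side x = 0. To see it, integrate in y from y1 to y2: the left side becomes u(x,y2) -
  u(x,y1), which tends to 0 as x tends to 0, and so does the double integral of u_xy. Hence c
  integrates to zero over every interval.\<close>

lemma q_eq_prim: "AE z in lborel. z \<in> plate l \<longrightarrow> q z = prim 0 (\<lambda>s. h (s, snd z)) (fst z)"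
proof -
  obtain c where c: "integrable lborel c" and ae: "AE z in lborel. z \<in> {0<..<pi} \<times> {-l<..<l} \<longrightarrow>
      q z = c (snd z) + prim 0 (\<lambda>s. h (s, snd z)) (fst z)"
    using weak_partial_imp_primitive[OF pi_gt_zero q h weak_qx] by blast
  define H1 where "H1 s = (LINT t|lborel. \<bar>h (s, t)\<bar>)" for s
  have H1: "integrable lborel H1" unfolding H1_def by (rule lborel2_integrable_y) (use h in simp)
  have zero: "(LINT t|lborel. indicator {y1<..<y2} t * c t) = 0"
    if y: "y1 \<in> {-l..l}" "y2 \<in> {y1..l}" for y1 y2
  proof -
    \<comment> \<open>Bounds all terms of that identity other than the integral of \<open>c\<close>.
      It is continuous in x and vanishes at x = 0.\<close>
    define F where "F x = \<bar>u (x, y1)\<bar> + \<bar>u (x, y2)\<bar> + prim 0 H1 x" for x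
    have bound: "AE x in lborel. x \<in> {0<..<pi} \<longrightarrow> \<bar>LINT t|lborel. indicator {y1<..<y2} t * c t\<bar> \<le> F x"
      using u_diff_eq lborel2_AE_xy[OF ae] lborel2_AE_integrable_y[OF q]
    proof eventually_elim
      case (elim x)
      show ?case
      proof
        assume x: "x \<in> {0<..<pi}"
        define P where "P t = prim 0 (\<lambda>s. h (s, t)) x" for t
        have hx: "integrable lborel (\<lambda>z. indicator ({0..x} \<times> UNIV) z * h z)"
          by (intro integrable_indicator_mult h) (auto intro!: borel_closed closed_Times)
        have P_eq: "P t = (LINT s|lborel. indicator ({0..x} \<times> UNIV) (s, t) * h (s, t))" for t
          unfolding P_def prim_def by (simp add: indicator_times)
        have P: "integrable lborel P" unfolding P_eq[abs_def] by (rule lborel2_integrable_x[OF hx])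
        have "\<bar>LINT t|lborel. indicator {y1<..y2} t * P t\<bar> \<le> (LINT t|lborel. \<bar>P t\<bar>)"
          using P by (intro abs_LINT_indicator_le) auto
        also have "\<dots> \<le> (LINT t|lborel. LINT s|lborel. \<bar>indicator ({0..x} \<times> UNIV) (s, t) * h (s, t)\<bar>)"
        proof (rule integral_mono)
          show "integrable lborel (\<lambda>t. LINT s|lborel. \<bar>indicator ({0..x} \<times> UNIV) (s, t) * h (s, t)\<bar>)"
            using lborel2_integrable_x[OF integrable_abs[OF hx]] .
          show "\<bar>P t\<bar> \<le> (LINT s|lborel. \<bar>indicator ({0..x} \<times> UNIV) (s, t) * h (s, t)\<bar>)" for t
            unfolding P_eq using integral_norm_bound[of lborel "\<lambda>s. indicator ({0..x} \<times> UNIV) (s, t) * h (s, t)"] by simp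
        qed (use P in simp)
        also have "\<dots> = (LINT s|lborel. LINT t|lborel. \<bar>indicator ({0..x} \<times> UNIV) (s, t) * h (s, t)\<bar>)"
          using lborel2_integral_x[OF integrable_abs[OF hx]] lborel2_integral_y[OF integrable_abs[OF hx]] by simp
        also have "\<dots> = prim 0 H1 x"
          unfolding prim_def H1_def by (simp add: indicator_times abs_mult)
        finally have Pb: "\<bar>LINT t|lborel. indicator {y1<..y2} t * P t\<bar> \<le> prim 0 H1 x" .
        have "u (x, y2) - u (x, y1) = (LINT t|lborel. indicator {y1<..y2} t * q (x, t))"
          using elim(1) x y by auto
        also have "\<dots> = (LINT t|lborel. indicator {y1<..<y2} t * c t + indicator {y1<..y2} t * P t)"
        proof (rule integral_cong_AE)
          show "(\<lambda>t. indicator {y1<..y2} t * q (x, t)) \<in> borel_measurable lborel"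
            using integrable_indicator_mult[OF elim(3), of "{y1<..y2}"] by auto
          show "(\<lambda>t. indicator {y1<..<y2} t * c t + indicator {y1<..y2} t * P t) \<in> borel_measurable lborel"
            using integrable_indicator_mult[OF c, of "{y1<..<y2}"] integrable_indicator_mult[OF P, of "{y1<..y2}"] by auto
          show "AE t in lborel. indicator {y1<..y2} t * q (x, t) = indicator {y1<..<y2} t * c t + indicator {y1<..y2} t * P t"
            using elim(2) AE_Icc_Ioo[of y1 y2] by eventually_elim (use x y in \<open>auto simp: P_def indicator_def\<close>)
        qed
        also have "\<dots> = (LINT t|lborel. indicator {y1<..<y2} t * c t) + (LINT t|lborel. indicator {y1<..y2} t * P t)"
          by (intro Bochner_Integration.integral_add integrable_indicator_mult c P) auto
        finally show "\<bar>LINT t|lborel. indicator {y1<..<y2} t * c t\<bar> \<le> F x"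
          using Pb unfolding F_def by linarith
      qed
    qed
    have "continuous_on {0..pi} F"
      unfolding F_def using y by (intro continuous_intros cont_x prim_continuous_on H1) auto
    moreover have "F 0 = 0" using y by (simp add: F_def left)
    ultimately have F: "(F \<longlongrightarrow> 0) (at 0 within {0..pi})"
      by (metis atLeastAtMost_iff continuous_on pi_ge_zero order_refl)
    have "\<bar>LINT t|lborel. indicator {y1<..<y2} t * c t\<bar> \<le> 0 + e" if "e > 0" for e :: real
    proof -
      from F that have "\<forall>\<^sub>F x in at 0 within {0..pi}. F x < e" by (rule order_tendstoD)
      then obtain d where d: "d > 0" "\<And>x. x \<in> {0..pi} \<Longrightarrow> x \<noteq> 0 \<Longrightarrow> dist x 0 < d \<Longrightarrow> F x < e"
        unfolding eventually_at by auto
      \<comment> \<open>The bound is known for almost every x only, so some admissible x is picked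
        arbitrarily close to 0.\<close>
      obtain x where x: "x \<in> {0<..<min d pi}"
          "x \<in> {0<..<pi} \<longrightarrow> \<bar>LINT t|lborel. indicator {y1<..<y2} t * c t\<bar> \<le> F x"
        using exists_point_if_AE[OF bound, of 0 "min d pi"] d(1) by auto
      then show ?thesis using d(2)[of x] by auto
    qed
    then have "\<bar>LINT t|lborel. indicator {y1<..<y2} t * c t\<bar> \<le> 0" by (rule field_le_epsilon)
    then show ?thesis by simp
  qed
  have "AE t in lborel. indicator {-l<..<l} t * c t = 0"
  proof (rule AE_zero_if_zero_on_boxes)
    show "integrable lborel (\<lambda>t. indicator {-l<..<l} t * c t)" by (intro integrable_indicator_mult c) auto
    show "(LINT t|lborel. indicator {-l<..<l} t * c t) = 0" using l by (intro zero) auto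
    fix a b :: real
    have eq: "indicator (box a b) t * (indicator {-l<..<l} t * c t) = indicator {max (-l) a<..<min l b} t * c t" for t
      by (auto simp: indicator_def)
    show "(LINT t|lborel. indicator (box a b) t * (indicator {-l<..<l} t * c t)) = 0"
    proof (cases "max (-l) a \<le> min l b")
      case True
      then show ?thesis unfolding eq using l by (intro zero) auto
    next
      case False
      then have "{max (-l) a<..<min l b} = {}" by auto
      then show ?thesis unfolding eq by (simp add: \<open>{max (-l) a<..<min l b} = {}\<close> del: greaterThanLessThan_empty_iff)
    qed
  qed
  from AE_lborel_fst_snd(2)[OF this] ae show ?thesis
    by eventually_elim (auto simp: plate_def)
qed

lemma q_section_bound: "AE z in lborel. z \<in> plate l \<longrightarrow> \<bar>q z\<bar> \<le> H (snd z)"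
  using q_eq_prim AE_lborel_fst_snd(2)[OF lborel2_AE_integrable_x[OF h]]
  by eventually_elim (auto simp: H_def intro: abs_prim_le)

text \<open>Integrating |u_y| \<le> \<open>H\<close> along a vertical line gives the bound for
  almost every x; continuity of u gives it for all x, the two sides included.\<close>

lemma u_diff_bound:
  assumes x: "x \<in> {0..pi}" and y: "y1 \<in> {-l..l}" "y2 \<in> {-l..l}"
  shows "\<bar>u (x, y2) - u (x, y1)\<bar> \<le> (LINT z|lborel. \<bar>h z\<bar>)"
proof -
  have *: "\<bar>u (x, y2) - u (x, y1)\<bar> \<le> (LINT z|lborel. \<bar>h z\<bar>)" if y: "y1 \<in> {-l..l}" "y2 \<in> {y1..l}" for y1 y2
  proof -
    \<comment> \<open>The inequality is written as an equation of a continuous function with 0, so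
      that \<open>continuous_AE_const\<close> can carry it to every x.\<close>
    have ae: "AE x in lborel. x \<in> {0<..<pi} \<longrightarrow> max 0 (\<bar>u (x, y2) - u (x, y1)\<bar> - (LINT z|lborel. \<bar>h z\<bar>)) = 0"
      using u_diff_eq lborel2_AE_xy[OF q_section_bound] lborel2_AE_integrable_y[OF q]
    proof eventually_elim
      case (elim x)
      show ?case
      proof
        assume x: "x \<in> {0<..<pi}"
        have "\<bar>LINT t|lborel. indicator {y1<..y2} t * q (x, t)\<bar> \<le> (LINT t|lborel. H t)"
        proof (rule abs_LINT_indicator_le)
          show "AE t in lborel. t \<in> {y1<..y2} \<longrightarrow> \<bar>q (x, t)\<bar> \<le> H t"
            using elim(2) AE_Icc_Ioo[of "-l" l] by eventually_elim (use x y in \<open>auto simp: plate_def\<close>)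
        qed (use elim(3) H in auto)
        then show "max 0 (\<bar>u (x, y2) - u (x, y1)\<bar> - (LINT z|lborel. \<bar>h z\<bar>)) = 0"
          using elim(1) x y H(3) by auto
      qed
    qed
    have "continuous_on {0..pi} (\<lambda>x. max 0 (\<bar>u (x, y2) - u (x, y1)\<bar> - (LINT z|lborel. \<bar>h z\<bar>)))"
      using y by (intro continuous_intros cont_x) auto
    from continuous_AE_const[OF pi_gt_zero this ae x] show ?thesis by simp
  qed
  show ?thesis using *[of y1 y2] *[of y2 y1] y by (cases "y1 \<le> y2") (auto simp: abs_minus_commute)
qed

text \<open>The bound on |u(x,t)| by \<open>\<kappa> t\<close> holds only for almost every height t.
  Moving from t to y costs the L^1 norm of u_xy; averaging over t in [-l,l] turns
  \<open>2 * pi * \<kappa> t\<close> into pi / l times the L^1 norm of u_xx.\<close>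

lemma u_bound:
  assumes x: "x \<in> {0..pi}" and y: "y \<in> {-l..l}"
  shows "\<bar>u (x, y)\<bar> \<le> (LINT z|lborel. \<bar>h z\<bar>) + pi / l * (LINT z|lborel. \<bar>k z\<bar>)"
proof -
  define N where "N = (LINT z|lborel. \<bar>h z\<bar>)"
  have Icc: "integrable lborel (\<lambda>x. indicator {-l..l} x * (r :: real))" for r
    using integrable_indicator_Icc by simp
  have "(LINT t|lborel. indicator {-l..l} t * \<bar>u (x, y)\<bar>) \<le> (LINT t|lborel. indicator {-l..l} t * N + 2 * pi * \<kappa> t)"
  proof (rule integral_mono_AE)
    show "AE t in lborel. indicator {-l..l} t * \<bar>u (x, y)\<bar> \<le> indicator {-l..l} t * N + 2 * pi * \<kappa> t"
      using u_section_bound AE_Icc_Ioo[of "-l" l]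
    proof eventually_elim
      case (elim t)
      show ?case
      proof (cases "t \<in> {-l..l}")
        case True
        then have "\<bar>u (x, t)\<bar> \<le> 2 * pi * \<kappa> t" using elim x by auto
        then have "\<bar>u (x, y)\<bar> \<le> N + 2 * pi * \<kappa> t"
          using u_diff_bound[OF x True y] unfolding N_def by linarith
        then show ?thesis using True by simp
      qed (use \<kappa>(2)[of t] pi_ge_zero in simp)
    qed
  qed (use Icc \<kappa>(1) in auto)
  then have "2 * l * \<bar>u (x, y)\<bar> \<le> 2 * l * N + 2 * pi * (LINT z|lborel. \<bar>k z\<bar>)"
    using Icc \<kappa> l by (simp add: mult_ac)
  then show ?thesis using l unfolding N_def by (simp add: field_simps)
qed

end

section \<open>Lebesgue measure on the plate and changes on null sets\<close>

lemma plate_eq_box: "plate l = box (0, -l) (pi, l)"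
  unfolding plate_def by (simp add: box_prod)

lemma plate_sets [simp]: "plate l \<in> sets lebesgue"
  using plate_borel sets_completionI_sets[of _ lborel] by simp

lemma plate_lmeasurable: "plate l \<in> lmeasurable" by (simp add: plate_eq_box)

lemma finite_measure_plate: "finite_measure (lebesgue_on (plate l))"
  by (rule finite_measure_lebesgue_on[OF plate_lmeasurable])

lemma emeasure_plate_pos: "l > 0 \<Longrightarrow> emeasure (lebesgue_on (plate l)) (plate l) > 0"
  by (simp add: emeasure_restrict_space plate_eq_box emeasure_lborel_box_eq Basis_real_prod)

lemma closure_plate: "l > 0 \<Longrightarrow> closure (plate l) = {0..pi} \<times> {-l..l}"
  by (simp add: plate_def closure_Times)

lemma AE_plate_iff: "(AE z in lebesgue_on (plate l). P z) \<longleftrightarrow> (AE z in lborel. z \<in> plate l \<longrightarrow> P z)"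
  by (simp add: AE_restrict_space_iff AE_completion_iff)

lemma integrable_plate_iff:
  fixes f :: "real \<times> real \<Rightarrow> real"
  shows "integrable (lebesgue_on (plate l)) f \<longleftrightarrow> integrable lebesgue (\<lambda>z. indicator (plate l) z * f z)"
  by (subst integrable_restrict_space) auto

lemma integral_plate_eq:
  fixes f :: "real \<times> real \<Rightarrow> real"
  shows "(LINT z|lebesgue_on (plate l). f z) = (LINT z|lebesgue. indicator (plate l) z * f z)"
  by (subst integral_restrict_space) auto

text \<open>Completeness of Lebesgue measure. It allows an arbitrarily chosen weak derivative, known
  only almost everywhere, to replace a given one.\<close>

lemma measurable_lebesgue_on_AE:
  fixes f g :: "'a::euclidean_space \<Rightarrow> real"
  assumes S: "S \<in> sets lebesgue" and f: "f \<in> borel_measurable (lebesgue_on S)"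
    and ae: "AE z in lebesgue_on S. f z = g z"
  shows "g \<in> borel_measurable (lebesgue_on S)"
proof -
  have "(\<lambda>z. indicator S z *\<^sub>R f z) \<in> borel_measurable lebesgue"
    using f S by (subst (asm) borel_measurable_restrict_space_iff) auto
  moreover have "AE z in lebesgue. indicator S z *\<^sub>R f z = indicator S z *\<^sub>R g z"
    using ae S by (simp add: AE_restrict_space_iff indicator_def)
  ultimately have "(\<lambda>z. indicator S z *\<^sub>R g z) \<in> borel_measurable lebesgue" by (rule borel_measurable_AE)
  then show ?thesis using S by (subst borel_measurable_restrict_space_iff) auto
qed

lemma integrable_lebesgue_on_AE:
  fixes f g :: "'a::euclidean_space \<Rightarrow> real"
  assumes "S \<in> sets lebesgue" "integrable (lebesgue_on S) f" "AE z in lebesgue_on S. f z = g z"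
  shows "integrable (lebesgue_on S) g"
  using measurable_lebesgue_on_AE[OF assms(1) _ assms(3)] assms(2,3) integrable_cong_AE_imp
  by (metis (mono_tags, lifting) borel_measurable_integrable eventually_mono)

text \<open>The simplifier would turn the exponent in \<open>lp_space M 2\<close> into \<open>ereal 2\<close>, on which no rule below matches.\<close>

declare numeral_eq_ereal [simp del]

section \<open>Square-integrable functions\<close>

lemma lp2_iff: "f \<in> lp_space M 2 \<longleftrightarrow> f \<in> borel_measurable M \<and> integrable M (\<lambda>z. (f z)\<^sup>2)"
proof -
  have "\<bar>x\<bar> powr real_of_ereal 2 = x\<^sup>2" for x :: real
    by (cases "x = 0") (simp_all add: powr_numeral numeral_eq_ereal)
  moreover have "(2 :: ereal) \<noteq> \<infinity>" by (simp add: numeral_eq_ereal)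
  ultimately show ?thesis by (simp add: lp_space_def)
qed

lemma lp2_mult:
  assumes "f \<in> lp_space M 2" "g \<in> lp_space M 2"
  shows "integrable M (\<lambda>z. f z * g z)"
proof (rule Bochner_Integration.integrable_bound[of _ "\<lambda>z. (f z)\<^sup>2 + (g z)\<^sup>2"])
  show "integrable M (\<lambda>z. (f z)\<^sup>2 + (g z)\<^sup>2)" "(\<lambda>z. f z * g z) \<in> borel_measurable M"
    using assms by (auto simp: lp2_iff)
  have "\<bar>x * y\<bar> \<le> x\<^sup>2 + y\<^sup>2" for x y :: real
  proof -
    have "2 * (\<bar>x\<bar> * \<bar>y\<bar>) \<le> x\<^sup>2 + y\<^sup>2" using sum_squares_bound[of "\<bar>x\<bar>" "\<bar>y\<bar>"] by simp
    then show ?thesis using abs_ge_zero[of "x * y"] unfolding abs_mult by linarith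
  qed
  then show "AE z in M. norm (f z * g z) \<le> norm ((f z)\<^sup>2 + (g z)\<^sup>2)" by simp
qed

lemma lp2_comb:
  assumes "f \<in> lp_space M 2" "g \<in> lp_space M 2"
  shows "(\<lambda>z. s * f z + t * g z) \<in> lp_space M 2"
proof -
  have "(\<lambda>z. (s * f z + t * g z)\<^sup>2) = (\<lambda>z. s\<^sup>2 * (f z)\<^sup>2 + 2 * s * t * (f z * g z) + t\<^sup>2 * (g z)\<^sup>2)"
    by (simp add: fun_eq_iff power2_eq_square algebra_simps)
  then show ?thesis using assms lp2_mult[OF assms] by (auto simp: lp2_iff)
qed

lemma lp2_integrable:
  assumes "finite_measure M" "f \<in> lp_space M 2"
  shows "integrable M f"
proof -
  interpret finite_measure M by fact
  have "(\<lambda>z. 1) \<in> lp_space M 2" by (simp add: lp2_iff)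
  from lp2_mult[OF assms(2) this] show ?thesis by simp
qed

lemma lp2_AE_cong:
  assumes "S \<in> sets lebesgue" "f \<in> lp_space (lebesgue_on S) 2" "AE z in lebesgue_on S. f z = g z"
  shows "g \<in> lp_space (lebesgue_on S) 2"
proof -
  have "g \<in> borel_measurable (lebesgue_on S)"
    using assms by (auto simp: lp2_iff intro: measurable_lebesgue_on_AE)
  moreover have "integrable (lebesgue_on S) (\<lambda>z. (g z)\<^sup>2)"
    by (rule integrable_lebesgue_on_AE[of _ "\<lambda>z. (f z)\<^sup>2"])
      (use assms in \<open>auto simp: lp2_iff elim!: eventually_mono\<close>)
  ultimately show ?thesis by (simp add: lp2_iff)
qed

text \<open>Cauchy-Schwarz against the indicator of \<open>A\<close>, from the nonnegative quadratic
  polynomial t \<mapsto> integral of (|f| - t 1_A)^2.\<close>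

lemma square_integral_abs_le:
  fixes f :: "'a \<Rightarrow> real"
  assumes f: "integrable M f" "integrable M (\<lambda>z. (f z)\<^sup>2)" and A: "A \<in> sets M" "emeasure M A < \<infinity>"
    and out: "\<And>z. z \<in> space M \<Longrightarrow> z \<notin> A \<Longrightarrow> f z = 0"
  shows "(LINT z|M. \<bar>f z\<bar>)\<^sup>2 \<le> measure M A * (LINT z|M. (f z)\<^sup>2)"
proof -
  define I J a where "I = (LINT z|M. \<bar>f z\<bar>)" and "J = (LINT z|M. (f z)\<^sup>2)" and "a = measure M A"
  have "0 \<le> a" by (simp add: a_def)
  have *: "0 \<le> J - 2 * t * I + t\<^sup>2 * a" for t
  proof -
    have "0 \<le> (LINT z|M. (\<bar>f z\<bar> - t * indicator A z)\<^sup>2)" by simp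
    also have "\<dots> = (LINT z|M. (f z)\<^sup>2 - 2 * t * \<bar>f z\<bar> + t\<^sup>2 * indicator A z)"
      using out by (intro Bochner_Integration.integral_cong) (auto simp: indicator_def power2_eq_square algebra_simps)
    also have "(LINT z|M. (f z)\<^sup>2 - 2 * t * \<bar>f z\<bar> + t\<^sup>2 * indicator A z) = J - 2 * t * I + t\<^sup>2 * a"
      using f A by (simp add: I_def J_def a_def)
    finally show ?thesis .
  qed
  show ?thesis
  proof (cases "a = 0")
    case True
    have "I = 0"
    proof (rule ccontr)
      assume "I \<noteq> 0"
      \<comment> \<open>For a = 0 the polynomial is affine in t, and this t gives it the value
        -1.\<close>
      then show False using *[of "(J + 1) / (2 * I)"] True by simp
    qed
    then show ?thesis using True by (simp add: I_def a_def)
  next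
    case False
    \<comment> \<open>The value t = I / a minimizes the polynomial.\<close>
    then have "I\<^sup>2 \<le> a * J" using *[of "I / a"] \<open>0 \<le> a\<close> by (simp add: field_simps power2_eq_square)
    then show ?thesis by (simp add: I_def J_def a_def)
  qed
qed

lemma plate_representative:
  fixes f :: "real \<times> real \<Rightarrow> real"
  assumes f: "integrable (lebesgue_on (plate l)) f"
  shows "\<exists>f'. integrable lborel f' \<and> (\<forall>z. z \<notin> plate l \<longrightarrow> f' z = 0) \<and>
    (AE z in lborel. indicator (plate l) z * f z = f' z) \<and>
    (\<forall>\<phi>\<in>borel_measurable borel. (LINT z|lebesgue_on (plate l). f z * \<phi> z) = (LINT z|lborel. f' z * \<phi> z))"
proof -
  from lebesgue_borel_representative[OF f[unfolded integrable_plate_iff]]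
  obtain f' where f': "integrable lborel f'" and ae: "AE z in lborel. indicator (plate l) z * f z = f' z"
    and int: "\<And>\<phi>. \<phi> \<in> borel_measurable borel \<Longrightarrow>
      (LINT z|lebesgue. indicator (plate l) z * f z * \<phi> z) = (LINT z|lborel. f' z * \<phi> z)" by blast
  let ?f = "\<lambda>z. indicator (plate l) z * f' z"
  have "integrable lborel ?f" by (intro integrable_indicator_mult f') simp
  moreover have "AE z in lborel. indicator (plate l) z * f z = ?f z"
    using ae by eventually_elim (auto simp: indicator_def)
  moreover have "(LINT z|lebesgue_on (plate l). f z * \<phi> z) = (LINT z|lborel. ?f z * \<phi> z)"
    if [measurable]: "\<phi> \<in> borel_measurable borel" for \<phi>
  proof -
    have "(LINT z|lebesgue_on (plate l). f z * \<phi> z) = (LINT z|lborel. f' z * \<phi> z)"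
      using int[OF that] by (simp add: integral_plate_eq mult.assoc)
    also have "\<dots> = (LINT z|lborel. ?f z * \<phi> z)"
    proof (rule integral_cong_AE)
      show "(\<lambda>z. f' z * \<phi> z) \<in> borel_measurable lborel" "(\<lambda>z. ?f z * \<phi> z) \<in> borel_measurable lborel"
        using f' by measurable
      show "AE z in lborel. f' z * \<phi> z = ?f z * \<phi> z"
        using ae by eventually_elim (auto simp: indicator_def)
    qed
    finally show ?thesis .
  qed
  ultimately show ?thesis by (intro exI[of _ ?f]) auto
qed

lemma integral_square_representative:
  fixes f f' :: "real \<times> real \<Rightarrow> real"
  assumes f': "integrable lborel f'" and ae: "AE z in lborel. indicator (plate l) z * f z = f' z"
    and f: "f \<in> lp_space (lebesgue_on (plate l)) 2"
  shows "integrable lborel (\<lambda>z. (f' z)\<^sup>2)"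
    and "(LINT z|lborel. (f' z)\<^sup>2) = (LINT z|lebesgue_on (plate l). (f z)\<^sup>2)"
proof -
  have [measurable]: "f' \<in> borel_measurable borel" using f' by auto
  have ae': "AE z in lebesgue. indicator (plate l) z * (f z)\<^sup>2 = (f' z)\<^sup>2"
    using AE_completion[OF ae] by eventually_elim (auto simp: indicator_def)
  have i: "integrable lebesgue (\<lambda>z. indicator (plate l) z * (f z)\<^sup>2)"
    using f by (simp add: lp2_iff integrable_plate_iff)
  have m: "(\<lambda>z. (f' z)\<^sup>2) \<in> borel_measurable lebesgue" by (rule measurable_completion) simp
  have "integrable lebesgue (\<lambda>z. (f' z)\<^sup>2)"
    using integrable_cong_AE_imp[OF i m] ae' by (simp add: eq_commute)
  then show "integrable lborel (\<lambda>z. (f' z)\<^sup>2)" by (subst (asm) integrable_completion) auto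
  have "(LINT z|lebesgue_on (plate l). (f z)\<^sup>2) = (LINT z|lebesgue. (f' z)\<^sup>2)"
    unfolding integral_plate_eq using i m ae' by (intro integral_cong_AE) auto
  also have "\<dots> = (LINT z|lborel. (f' z)\<^sup>2)" by (rule integral_completion) simp
  finally show "(LINT z|lborel. (f' z)\<^sup>2) = (LINT z|lebesgue_on (plate l). (f z)\<^sup>2)" by simp
qed

lemma locally_integrableI:
  assumes "integrable (lebesgue_on (plate l)) f"
  shows "locally_integrable (plate l) f"
  unfolding locally_integrable_def
proof (intro allI impI)
  fix K assume K: "compact K \<and> K \<subseteq> plate l"
  then have Ks: "K \<in> sets lebesgue" by (simp add: compact_imp_closed lmeasurable_compact fmeasurableD)
  have "integrable lebesgue (\<lambda>z. indicator K z * (indicator (plate l) z * f z))"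
    by (rule integrable_indicator_mult[OF _ Ks]) (use assms in \<open>simp add: integrable_plate_iff\<close>)
  also have "(\<lambda>z. indicator K z * (indicator (plate l) z * f z)) = (\<lambda>z. indicator K z *\<^sub>R f z)"
    using K by (auto simp: fun_eq_iff indicator_def)
  finally show "integrable (lebesgue_on K) f" using Ks by (subst integrable_restrict_space) auto
qed

lemma locally_integrable_AE:
  assumes "locally_integrable (plate l) f" "AE z in lebesgue_on (plate l). f z = g z"
  shows "locally_integrable (plate l) g"
  unfolding locally_integrable_def
proof (intro allI impI)
  fix K assume K: "compact K \<and> K \<subseteq> plate l"
  then have Ks: "K \<in> sets lebesgue" by (simp add: compact_imp_closed lmeasurable_compact fmeasurableD)
  have "AE z in lebesgue. z \<in> plate l \<longrightarrow> f z = g z" using assms(2) by (simp add: AE_restrict_space_iff)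
  then have "AE z in lebesgue_on K. f z = g z" using K Ks by (auto simp: AE_restrict_space_iff elim!: eventually_mono)
  with assms(1) K Ks show "integrable (lebesgue_on K) g"
    unfolding locally_integrable_def by (blast intro: integrable_lebesgue_on_AE)
qed

text \<open>If one of the functions is not measurable then neither is the other, and both integrals
  have the default value 0.\<close>

lemma integral_cong_AE_lebesgue_on:
  fixes f g :: "'a::euclidean_space \<Rightarrow> real"
  assumes S: "S \<in> sets lebesgue" and ae: "AE z in lebesgue_on S. f z = g z"
  shows "integral\<^sup>L (lebesgue_on S) f = integral\<^sup>L (lebesgue_on S) g"
proof (cases "f \<in> borel_measurable (lebesgue_on S)")
  case True
  then show ?thesis using measurable_lebesgue_on_AE[OF S True ae] ae by (intro integral_cong_AE)
next
  case False
  have "AE z in lebesgue_on S. g z = f z" using ae by eventually_elim simp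
  then have "g \<notin> borel_measurable (lebesgue_on S)" using False measurable_lebesgue_on_AE[OF S] by blast
  then show ?thesis using False by (metis borel_measurable_integrable not_integrable_integral_eq)
qed

section \<open>Weak derivatives on the plate and their uniqueness\<close>

lemma has_weak_partial_AE:
  assumes w: "has_weak_partial (plate l) e u g"
    and u: "AE z in lebesgue_on (plate l). u z = u' z" and g: "AE z in lebesgue_on (plate l). g z = g' z"
  shows "has_weak_partial (plate l) e u' g'"
  unfolding has_weak_partial_def
proof (intro conjI ballI)
  show "locally_integrable (plate l) u'" "locally_integrable (plate l) g'"
    using w u g by (auto simp: has_weak_partial_def intro: locally_integrable_AE)
  fix \<phi> assume \<phi>: "\<phi> \<in> test_functions (plate l)"
  have "(LINT z|lebesgue_on (plate l). u z * frechet_derivative \<phi> (at z) e) = (LINT z|lebesgue_on (plate l). u' z * frechet_derivative \<phi> (at z) e)"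
    by (rule integral_cong_AE_lebesgue_on) (use u in \<open>auto elim!: eventually_mono\<close>)
  moreover have "(LINT z|lebesgue_on (plate l). g z * \<phi> z) = (LINT z|lebesgue_on (plate l). g' z * \<phi> z)"
    by (rule integral_cong_AE_lebesgue_on) (use g in \<open>auto elim!: eventually_mono\<close>)
  ultimately show "(LINT z|lebesgue_on (plate l). u' z * frechet_derivative \<phi> (at z) e) = - (LINT z|lebesgue_on (plate l). g' z * \<phi> z)"
    using w \<phi> by (simp add: has_weak_partial_def)
qed

lemmas has_weak_partial_AE_left = has_weak_partial_AE[OF _ _ AE_I2[OF refl]]
lemmas has_weak_partial_AE_right = has_weak_partial_AE[OF _ AE_I2[OF refl]]

lemma has_weak_partial_tensor:
  assumes "\<alpha> \<in> bumps 0 pi" "\<beta> \<in> bumps (-l) l"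
  shows "has_weak_partial (plate l) (1, 0) u g \<Longrightarrow> (LINT z|lebesgue_on (plate l). u z * (deriv \<alpha> (fst z) * \<beta> (snd z))) =
      - (LINT z|lebesgue_on (plate l). g z * (\<alpha> (fst z) * \<beta> (snd z)))"
    and "has_weak_partial (plate l) (0, 1) u g \<Longrightarrow> (LINT z|lebesgue_on (plate l). u z * (\<alpha> (fst z) * deriv \<beta> (snd z))) =
      - (LINT z|lebesgue_on (plate l). g z * (\<alpha> (fst z) * \<beta> (snd z)))"
proof -
  have t: "(\<lambda>z. \<alpha> (fst z) * \<beta> (snd z)) \<in> test_functions (plate l)"
    unfolding plate_def by (rule tensor_test_function[OF assms])
  note d = frechet_derivative_tensor[OF smooth_DERIV[OF bumps_smooth[OF assms(1)]] smooth_DERIV[OF bumps_smooth[OF assms(2)]]]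
  show "(LINT z|lebesgue_on (plate l). u z * (deriv \<alpha> (fst z) * \<beta> (snd z))) =
      - (LINT z|lebesgue_on (plate l). g z * (\<alpha> (fst z) * \<beta> (snd z)))" if "has_weak_partial (plate l) (1, 0) u g"
    using that[unfolded has_weak_partial_def, THEN conjunct2, THEN conjunct2, rule_format, OF t] by (simp add: d)
  show "(LINT z|lebesgue_on (plate l). u z * (\<alpha> (fst z) * deriv \<beta> (snd z))) =
      - (LINT z|lebesgue_on (plate l). g z * (\<alpha> (fst z) * \<beta> (snd z)))" if "has_weak_partial (plate l) (0, 1) u g"
    using that[unfolded has_weak_partial_def, THEN conjunct2, THEN conjunct2, rule_format, OF t] by (simp add: d)
qed

lemma tensor_borel:
  fixes \<alpha> \<beta> :: "real \<Rightarrow> real"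
  assumes [measurable]: "\<alpha> \<in> borel_measurable borel" "\<beta> \<in> borel_measurable borel"
  shows "(\<lambda>z. \<alpha> (fst z) * \<beta> (snd z)) \<in> borel_measurable borel"
  by measurable

lemma locally_integrable_tensor:
  assumes g: "locally_integrable (plate l) g" and ab: "\<alpha> \<in> bumps 0 pi" "\<beta> \<in> bumps (-l) l"
  shows "integrable (lebesgue_on (plate l)) (\<lambda>z. g z * (\<alpha> (fst z) * \<beta> (snd z)))"
proof -
  obtain a b where 1: "0 < a" "b < pi" "\<And>x. x \<notin> {a..b} \<Longrightarrow> \<alpha> x = 0" using bumps_support[OF ab(1)] by blast
  obtain c d where 2: "-l < c" "d < l" "\<And>x. x \<notin> {c..d} \<Longrightarrow> \<beta> x = 0" using bumps_support[OF ab(2)] by blast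
  obtain A B where B: "\<And>x. \<bar>\<alpha> x\<bar> \<le> A" "\<And>x. \<bar>\<beta> x\<bar> \<le> B"
    using bumps_bounded[OF ab(1)] bumps_bounded[OF ab(2)] by blast
  have nn: "0 \<le> A" using B(1)[of 0] by linarith
  let ?Q = "{a..b} \<times> {c..d}"
  have Q: "compact ?Q" "?Q \<subseteq> plate l" using 1 2 by (auto simp: plate_def intro: compact_Times)
  then have Qs: "?Q \<in> sets lebesgue" by (simp add: lmeasurable_compact fmeasurableD)
  have "integrable (lebesgue_on ?Q) g" using g Q by (simp add: locally_integrable_def)
  then have i: "integrable lebesgue (\<lambda>z. indicator ?Q z * g z)" using Qs by (subst (asm) integrable_restrict_space) auto
  have m: "(\<lambda>z. \<alpha> (fst z) * \<beta> (snd z)) \<in> borel_measurable lebesgue"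
    by (rule measurable_completion) (use tensor_borel[OF ab(1)[THEN bumps_measurable] ab(2)[THEN bumps_measurable]] in simp)
  have "integrable lebesgue (\<lambda>z. (indicator ?Q z * g z) * (\<alpha> (fst z) * \<beta> (snd z)))"
    by (rule integrable_mult_bounded[OF i m, where B = "A * B"]) (auto simp: abs_mult intro!: mult_mono B nn)
  also have "(\<lambda>z. (indicator ?Q z * g z) * (\<alpha> (fst z) * \<beta> (snd z))) = (\<lambda>z. indicator (plate l) z * (g z * (\<alpha> (fst z) * \<beta> (snd z))))"
  proof
    fix z
    show "(indicator ?Q z * g z) * (\<alpha> (fst z) * \<beta> (snd z)) = indicator (plate l) z * (g z * (\<alpha> (fst z) * \<beta> (snd z)))"
    proof (cases "z \<in> ?Q")
      case False
      then have "\<alpha> (fst z) = 0 \<or> \<beta> (snd z) = 0" using 1(3) 2(3) by (metis mem_Times_iff)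
      then show ?thesis by auto
    qed (use Q in auto)
  qed
  finally show ?thesis by (simp add: integrable_plate_iff)
qed

lemma AE_eq_if_tensor_eq:
  assumes g: "locally_integrable (plate l) g" and g': "locally_integrable (plate l) g'"
    and eq: "\<And>\<alpha> \<beta>. \<alpha> \<in> bumps 0 pi \<Longrightarrow> \<beta> \<in> bumps (-l) l \<Longrightarrow>
      (LINT z|lebesgue_on (plate l). g z * (\<alpha> (fst z) * \<beta> (snd z))) = (LINT z|lebesgue_on (plate l). g' z * (\<alpha> (fst z) * \<beta> (snd z)))"
  shows "AE z in lebesgue_on (plate l). g z = g' z"
proof -
  define w where "w z = indicator (plate l) z * (g z - g' z)" for z
  have "AE z in lborel. z \<in> {0<..<pi} \<times> {-l<..<l} \<longrightarrow> w z = 0"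
  proof (rule fundamental_lemma)
    fix a b c d :: real assume *: "0 < a" "b < pi" "-l < c" "d < l"
    let ?Q = "{a..b} \<times> {c..d}"
    have Q: "compact ?Q" "?Q \<subseteq> plate l" using * by (auto simp: plate_def intro: compact_Times)
    then have Qs: "?Q \<in> sets lebesgue" by (simp add: lmeasurable_compact fmeasurableD)
    have "integrable (lebesgue_on ?Q) (\<lambda>z. g z - g' z)" using g g' Q by (simp add: locally_integrable_def)
    then have "integrable lebesgue (\<lambda>z. indicator ?Q z * (g z - g' z))" using Qs by (subst (asm) integrable_restrict_space) auto
    also have "(\<lambda>z. indicator ?Q z * (g z - g' z)) = (\<lambda>z. indicator ?Q z * w z)"
    proof
      fix z
      have "z \<in> ?Q \<Longrightarrow> z \<in> plate l" using Q(2) by blast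
      then show "indicator ?Q z * (g z - g' z) = indicator ?Q z * w z"
        by (cases "z \<in> ?Q") (simp_all add: w_def)
    qed
    finally show "integrable lebesgue (\<lambda>z. indicator ?Q z * w z)" .
  next
    fix \<alpha> \<beta> assume ab: "\<alpha> \<in> bumps 0 pi" "\<beta> \<in> bumps (-l) l"
    have "(LINT z|lebesgue. w z * (\<alpha> (fst z) * \<beta> (snd z))) =
        (LINT z|lebesgue_on (plate l). g z * (\<alpha> (fst z) * \<beta> (snd z)) - g' z * (\<alpha> (fst z) * \<beta> (snd z)))"
      by (simp add: integral_plate_eq w_def algebra_simps)
    also have "\<dots> = 0"
      using locally_integrable_tensor[OF g ab] locally_integrable_tensor[OF g' ab] eq[OF ab] by simp
    finally show "(LINT z|lebesgue. w z * (\<alpha> (fst z) * \<beta> (snd z))) = 0" .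
  qed
  then show ?thesis unfolding AE_plate_iff by eventually_elim (auto simp: w_def plate_def)
qed

lemma has_weak_partial_unique:
  assumes "has_weak_partial (plate l) e u g" "has_weak_partial (plate l) e u g'"
  shows "AE z in lebesgue_on (plate l). g z = g' z"
proof (rule AE_eq_if_tensor_eq)
  show "locally_integrable (plate l) g" "locally_integrable (plate l) g'"
    using assms by (simp_all add: has_weak_partial_def)
  fix \<alpha> \<beta> assume ab: "\<alpha> \<in> bumps 0 pi" "\<beta> \<in> bumps (-l) l"
  have t: "(\<lambda>z. \<alpha> (fst z) * \<beta> (snd z)) \<in> test_functions (plate l)"
    unfolding plate_def by (rule tensor_test_function[OF ab])
  note * = assms[unfolded has_weak_partial_def, THEN conjunct2, THEN conjunct2, rule_format, OF t]
  show "(LINT z|lebesgue_on (plate l). g z * (\<alpha> (fst z) * \<beta> (snd z))) = (LINT z|lebesgue_on (plate l). g' z * (\<alpha> (fst z) * \<beta> (snd z)))"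
    using *(1) *(2) by linarith
qed

section \<open>Jets of second order\<close>

lemma test_function_bounds:
  fixes \<phi> :: "'a::euclidean_space \<Rightarrow> real"
  assumes \<phi>: "\<phi> \<in> test_functions S" and e: "e \<in> Basis"
  shows "continuous_on UNIV \<phi>" "continuous_on UNIV (\<lambda>z. frechet_derivative \<phi> (at z) e)"
    and "\<exists>K. compact K \<and> K \<subseteq> S \<and> (\<forall>z. z \<notin> K \<longrightarrow> \<phi> z = 0 \<and> frechet_derivative \<phi> (at z) e = 0)"
    and "\<exists>B. \<forall>z. \<bar>\<phi> z\<bar> \<le> B \<and> \<bar>frechet_derivative \<phi> (at z) e\<bar> \<le> B"
proof -
  have "times_cont_differentiable 1 \<phi>" using \<phi> by (simp add: test_functions_def)
  then show c: "continuous_on UNIV \<phi>" "continuous_on UNIV (\<lambda>z. frechet_derivative \<phi> (at z) e)"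
    using e by (auto simp: continuous_on_eq_continuous_at intro: differentiable_imp_continuous_within)
  obtain K where K: "compact K" "K \<subseteq> S" "\<And>z. z \<notin> K \<Longrightarrow> \<phi> z = 0" using \<phi> by (auto simp: test_functions_def)
  have d0: "frechet_derivative \<phi> (at z) e = 0" if "z \<notin> K" for z
  proof -
    have "(\<phi> has_derivative (\<lambda>h. 0)) (at z)"
      by (rule has_derivative_transform_within_open[of "\<lambda>z. 0" _ _ _ "- K"])
        (use that K in \<open>auto simp: compact_imp_closed open_Compl\<close>)
    from frechet_derivative_at[OF this, symmetric] show ?thesis by simp
  qed
  show "\<exists>K. compact K \<and> K \<subseteq> S \<and> (\<forall>z. z \<notin> K \<longrightarrow> \<phi> z = 0 \<and> frechet_derivative \<phi> (at z) e = 0)"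
    using K d0 by blast
  have "bounded (\<phi> ` K)"
    by (rule compact_imp_bounded[OF compact_continuous_image[OF continuous_on_subset[OF c(1) subset_UNIV] K(1)]])
  moreover have "bounded ((\<lambda>z. frechet_derivative \<phi> (at z) e) ` K)"
    by (rule compact_imp_bounded[OF compact_continuous_image[OF continuous_on_subset[OF c(2) subset_UNIV] K(1)]])
  ultimately obtain B1 B2 where B: "\<forall>y\<in>\<phi> ` K. norm y \<le> B1" "\<forall>y\<in>(\<lambda>z. frechet_derivative \<phi> (at z) e) ` K. norm y \<le> B2"
    unfolding bounded_iff by blast
  have "\<bar>\<phi> z\<bar> \<le> max 0 (max B1 B2) \<and> \<bar>frechet_derivative \<phi> (at z) e\<bar> \<le> max 0 (max B1 B2)" for z
  proof (cases "z \<in> K")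
    case True
    then have "\<bar>\<phi> z\<bar> \<le> B1" "\<bar>frechet_derivative \<phi> (at z) e\<bar> \<le> B2" using B by auto
    then show ?thesis by linarith
  qed (use K(3) d0 in auto)
  then show "\<exists>B. \<forall>z. \<bar>\<phi> z\<bar> \<le> B \<and> \<bar>frechet_derivative \<phi> (at z) e\<bar> \<le> B" by blast
qed

lemma continuous_measurable_plate:
  "continuous_on UNIV f \<Longrightarrow> f \<in> borel_measurable (lebesgue_on (plate l))" for f :: "real \<times> real \<Rightarrow> real"
  by (rule continuous_imp_measurable_on_sets_lebesgue[OF continuous_on_subset[OF _ subset_UNIV] plate_sets])

lemma test_function_integrable:
  assumes \<phi>: "\<phi> \<in> test_functions (plate l)" and e: "e \<in> Basis" and w: "integrable (lebesgue_on (plate l)) w"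
  shows "integrable (lebesgue_on (plate l)) (\<lambda>z. w z * \<phi> z)"
    and "integrable (lebesgue_on (plate l)) (\<lambda>z. w z * frechet_derivative \<phi> (at z) e)"
proof -
  note c = test_function_bounds(1,2)[OF \<phi> e]
  obtain B where B: "\<And>z. \<bar>\<phi> z\<bar> \<le> B" "\<And>z. \<bar>frechet_derivative \<phi> (at z) e\<bar> \<le> B"
    using test_function_bounds(4)[OF \<phi> e] by blast
  show "integrable (lebesgue_on (plate l)) (\<lambda>z. w z * \<phi> z)"
    by (rule integrable_mult_bounded[OF w continuous_measurable_plate[OF c(1)] B(1)])
  show "integrable (lebesgue_on (plate l)) (\<lambda>z. w z * frechet_derivative \<phi> (at z) e)"
    by (rule integrable_mult_bounded[OF w continuous_measurable_plate[OF c(2)] B(2)])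
qed

lemma has_weak_partial_comb:
  assumes 1: "has_weak_partial (plate l) e u g" and 2: "has_weak_partial (plate l) e v h" and e: "e \<in> Basis"
    and i: "integrable (lebesgue_on (plate l)) u" "integrable (lebesgue_on (plate l)) v"
      "integrable (lebesgue_on (plate l)) g" "integrable (lebesgue_on (plate l)) h"
  shows "has_weak_partial (plate l) e (\<lambda>z. s * u z + t * v z) (\<lambda>z. s * g z + t * h z)"
  unfolding has_weak_partial_def
proof (intro conjI ballI locally_integrableI)
  show "integrable (lebesgue_on (plate l)) (\<lambda>z. s * u z + t * v z)"
    "integrable (lebesgue_on (plate l)) (\<lambda>z. s * g z + t * h z)" using i by auto
  fix \<phi> assume \<phi>: "\<phi> \<in> test_functions (plate l)"
  note I = test_function_integrable[OF \<phi> e]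
  have "(LINT z|lebesgue_on (plate l). (s * u z + t * v z) * frechet_derivative \<phi> (at z) e) =
     (LINT z|lebesgue_on (plate l). s * (u z * frechet_derivative \<phi> (at z) e) + t * (v z * frechet_derivative \<phi> (at z) e))"
    by (simp add: algebra_simps)
  also have "\<dots> = s * (LINT z|lebesgue_on (plate l). u z * frechet_derivative \<phi> (at z) e)
      + t * (LINT z|lebesgue_on (plate l). v z * frechet_derivative \<phi> (at z) e)"
    using I(2)[OF i(1)] I(2)[OF i(2)] by simp
  also have "\<dots> = - (s * (LINT z|lebesgue_on (plate l). g z * \<phi> z) + t * (LINT z|lebesgue_on (plate l). h z * \<phi> z))"
    using 1 2 \<phi> by (simp add: has_weak_partial_def)
  also have "\<dots> = - (LINT z|lebesgue_on (plate l). s * (g z * \<phi> z) + t * (h z * \<phi> z))"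
    using I(1)[OF i(3)] I(1)[OF i(4)] by simp
  also have "\<dots> = - (LINT z|lebesgue_on (plate l). (s * g z + t * h z) * \<phi> z)" by (simp add: algebra_simps)
  finally show "(LINT z|lebesgue_on (plate l). (s * u z + t * v z) * frechet_derivative \<phi> (at z) e) =
    - (LINT z|lebesgue_on (plate l). (s * g z + t * h z) * \<phi> z)" .
qed

lemma integral_mult_bounded_tendsto:
  fixes w :: "nat \<Rightarrow> 'a \<Rightarrow> real"
  assumes w: "\<And>n. integrable M (w n)" "integrable M w0" and lim: "(\<lambda>n. LINT z|M. \<bar>w n z - w0 z\<bar>) \<longlonglongrightarrow> 0"
    and \<phi>: "\<phi> \<in> borel_measurable M" "\<And>z. \<bar>\<phi> z\<bar> \<le> B"
  shows "(\<lambda>n. LINT z|M. w n z * \<phi> z) \<longlonglongrightarrow> (LINT z|M. w0 z * \<phi> z)"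
proof -
  have i: "integrable M (\<lambda>z. w n z * \<phi> z)" "integrable M (\<lambda>z. w0 z * \<phi> z)" for n
    by (rule integrable_mult_bounded[OF w(1) \<phi>], rule integrable_mult_bounded[OF w(2) \<phi>])
  have bound: "\<bar>(LINT z|M. w n z * \<phi> z) - (LINT z|M. w0 z * \<phi> z)\<bar> \<le> (LINT z|M. \<bar>w n z - w0 z\<bar>) * B" for n
  proof -
    have d: "integrable M (\<lambda>z. w n z - w0 z)" using w by simp
    have "\<bar>(LINT z|M. w n z * \<phi> z) - (LINT z|M. w0 z * \<phi> z)\<bar> = \<bar>LINT z|M. (w n z - w0 z) * \<phi> z\<bar>"
      using i by (simp add: left_diff_distrib)
    also have "\<dots> \<le> (LINT z|M. \<bar>(w n z - w0 z) * \<phi> z\<bar>)"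
      using integral_norm_bound[of M "\<lambda>z. (w n z - w0 z) * \<phi> z"] by simp
    also have "\<dots> \<le> (LINT z|M. \<bar>w n z - w0 z\<bar> * B)"
      by (intro integral_mono integrable_abs integrable_mult_bounded[OF d \<phi>] integrable_mult_left)
        (use d \<phi>(2) in \<open>auto simp: abs_mult intro!: mult_left_mono\<close>)
    finally show ?thesis by simp
  qed
  have "(\<lambda>n. (LINT z|M. w n z * \<phi> z) - (LINT z|M. w0 z * \<phi> z)) \<longlonglongrightarrow> 0"
    by (rule Lim_null_comparison[OF always_eventually tendsto_mult_left_zero[OF lim, of B]])
      (unfold real_norm_def, rule allI, rule bound)
  then show ?thesis by (simp add: LIM_zero_iff)
qed

text \<open>Test functions and their derivatives are bounded, so L^1 convergence suffices to pass to
  the limit on both sides of the defining identity.\<close>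

lemma has_weak_partial_limit:
  assumes w: "\<And>n. has_weak_partial (plate l) e (u n) (g n)" and e: "e \<in> Basis"
    and i: "\<And>n. integrable (lebesgue_on (plate l)) (u n)" "\<And>n. integrable (lebesgue_on (plate l)) (g n)"
      "integrable (lebesgue_on (plate l)) u0" "integrable (lebesgue_on (plate l)) g0"
    and lim: "(\<lambda>n. LINT z|lebesgue_on (plate l). \<bar>u n z - u0 z\<bar>) \<longlonglongrightarrow> 0"
      "(\<lambda>n. LINT z|lebesgue_on (plate l). \<bar>g n z - g0 z\<bar>) \<longlonglongrightarrow> 0"
  shows "has_weak_partial (plate l) e u0 g0"
  unfolding has_weak_partial_def
proof (intro conjI ballI locally_integrableI i)
  fix \<phi> assume \<phi>: "\<phi> \<in> test_functions (plate l)"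
  note c = test_function_bounds(1,2)[OF \<phi> e, THEN continuous_measurable_plate]
  obtain B where B: "\<And>z. \<bar>\<phi> z\<bar> \<le> B" "\<And>z. \<bar>frechet_derivative \<phi> (at z) e\<bar> \<le> B"
    using test_function_bounds(4)[OF \<phi> e] by blast
  have "(\<lambda>n. LINT z|lebesgue_on (plate l). u n z * frechet_derivative \<phi> (at z) e) \<longlonglongrightarrow>
      (LINT z|lebesgue_on (plate l). u0 z * frechet_derivative \<phi> (at z) e)"
    by (rule integral_mult_bounded_tendsto[OF i(1) i(3) lim(1) c(2) B(2)])
  moreover have "(\<lambda>n. - (LINT z|lebesgue_on (plate l). g n z * \<phi> z)) \<longlonglongrightarrow> - (LINT z|lebesgue_on (plate l). g0 z * \<phi> z)"
    by (intro tendsto_minus integral_mult_bounded_tendsto[OF i(2) i(4) lim(2) c(1) B(1)])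
  moreover have "(LINT z|lebesgue_on (plate l). u n z * frechet_derivative \<phi> (at z) e) = - (LINT z|lebesgue_on (plate l). g n z * \<phi> z)" for n
    using w \<phi> by (simp add: has_weak_partial_def)
  ultimately show "(LINT z|lebesgue_on (plate l). u0 z * frechet_derivative \<phi> (at z) e) = - (LINT z|lebesgue_on (plate l). g0 z * \<phi> z)"
    using LIMSEQ_unique by simp
qed

text \<open>The slots are u, u_x, u_y, u_xx, u_xy, u_yy, with \<open>h\<close> serving as both mixed
  derivatives. With explicit representatives, linear combinations of jets are jets, whereas
  \<open>D_xx\<close>, \<open>D_xy\<close> and \<open>D_yy\<close> are linear only almost
  everywhere.\<close>

definition jet :: "real \<Rightarrow> (real \<times> real \<Rightarrow> real) \<Rightarrow> (real \<times> real \<Rightarrow> real) \<Rightarrow> (real \<times> real \<Rightarrow> real) \<Rightarrow>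
    (real \<times> real \<Rightarrow> real) \<Rightarrow> (real \<times> real \<Rightarrow> real) \<Rightarrow> (real \<times> real \<Rightarrow> real) \<Rightarrow> bool" where
  "jet l u g q k h m \<longleftrightarrow> {u, g, q, k, h, m} \<subseteq> lp_space (lebesgue_on (plate l)) 2 \<and>
     has_weak_partial (plate l) (1, 0) u g \<and> has_weak_partial (plate l) (0, 1) u q \<and>
     has_weak_partial (plate l) (1, 0) g k \<and> has_weak_partial (plate l) (0, 1) g h \<and>
     has_weak_partial (plate l) (1, 0) q h \<and> has_weak_partial (plate l) (0, 1) q m"

text \<open>The mixed derivatives agree because, tested against \<alpha>(x) \<beta>(y), both yield
  the integral of u \<alpha>'(x) \<beta>'(y).\<close>

lemma jet_exists:
  assumes "u \<in> sobolev_H 2 (plate l)"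
  shows "\<exists>g q k h m. jet l u g q k h m"
proof -
  let ?L = "lp_space (lebesgue_on (plate l)) 2"
  have u: "u \<in> ?L" and e: "\<forall>e\<in>{(1, 0), (0, 1)}. \<exists>g\<in>sobolev_H 1 (plate l). has_weak_partial (plate l) e u g"
    using assms by (simp_all add: numeral_2_eq_2 Basis_real_prod)
  obtain g q where g: "g \<in> sobolev_H 1 (plate l)" "has_weak_partial (plate l) (1, 0) u g"
    and q: "q \<in> sobolev_H 1 (plate l)" "has_weak_partial (plate l) (0, 1) u q" using e by auto
  obtain k h where g1: "g \<in> ?L" and k: "k \<in> ?L" "has_weak_partial (plate l) (1, 0) g k"
    and h: "h \<in> ?L" "has_weak_partial (plate l) (0, 1) g h" using g(1) by (auto simp: Basis_real_prod)
  obtain h' m where q1: "q \<in> ?L" and h': "h' \<in> ?L" "has_weak_partial (plate l) (1, 0) q h'"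
    and m: "m \<in> ?L" "has_weak_partial (plate l) (0, 1) q m" using q(1) by (auto simp: Basis_real_prod)
  have "AE z in lebesgue_on (plate l). h' z = h z"
  proof (rule AE_eq_if_tensor_eq)
    show "locally_integrable (plate l) h'" "locally_integrable (plate l) h"
      using h(2) h'(2) by (simp_all add: has_weak_partial_def)
    fix \<alpha> \<beta> assume a: "\<alpha> \<in> bumps 0 pi" and b: "\<beta> \<in> bumps (-l) l"
    show "(LINT z|lebesgue_on (plate l). h' z * (\<alpha> (fst z) * \<beta> (snd z))) = (LINT z|lebesgue_on (plate l). h z * (\<alpha> (fst z) * \<beta> (snd z)))"
      using has_weak_partial_tensor(1)[OF a b h'(2)] has_weak_partial_tensor(2)[OF bumps_deriv[OF a] b q(2)]
        has_weak_partial_tensor(2)[OF a b h(2)] has_weak_partial_tensor(1)[OF a bumps_deriv[OF b] g(2)] by linarith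
  qed
  then have "has_weak_partial (plate l) (1, 0) q h" by (rule has_weak_partial_AE_right[OF h'(2)])
  then have "jet l u g q k h m" unfolding jet_def using u g g1 q q1 k h m by blast
  then show ?thesis by blast
qed

lemma weak_partial_AE:
  assumes "has_weak_partial (plate l) e u g"
  shows "has_weak_partial (plate l) e u (weak_partial (plate l) e u)"
    and "AE z in lebesgue_on (plate l). weak_partial (plate l) e u z = g z"
proof -
  show "has_weak_partial (plate l) e u (weak_partial (plate l) e u)"
    unfolding weak_partial_def by (rule someI[of "\<lambda>g. has_weak_partial (plate l) e u g", OF assms])
  then show "AE z in lebesgue_on (plate l). weak_partial (plate l) e u z = g z"
    using assms by (rule has_weak_partial_unique)
qed

lemma weak_partial_weak_partial_AE:
  assumes 1: "has_weak_partial (plate l) e u g" and 2: "has_weak_partial (plate l) e' g k"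
  shows "AE z in lebesgue_on (plate l). weak_partial (plate l) e' (weak_partial (plate l) e u) z = k z"
proof -
  have "AE z in lebesgue_on (plate l). g z = weak_partial (plate l) e u z"
    using weak_partial_AE(2)[OF 1] by eventually_elim simp
  from has_weak_partial_AE_left[OF 2 this] show ?thesis by (rule weak_partial_AE(2))
qed

lemma jet_D:
  assumes "jet l u g q k h m"
  shows "AE z in lebesgue_on (plate l). D_xx l u z = k z"
    and "AE z in lebesgue_on (plate l). D_xy l u z = h z"
    and "AE z in lebesgue_on (plate l). D_yy l u z = m z"
  using assms unfolding jet_def D_xx_def D_xy_def D_yy_def by (blast intro: weak_partial_weak_partial_AE)+

lemma jet_D_exists:
  assumes "u \<in> sobolev_H 2 (plate l)"
  shows "\<exists>g q. jet l u g q (D_xx l u) (D_xy l u) (D_yy l u)"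
proof -
  obtain g q k h m where j: "jet l u g q k h m" using jet_exists[OF assms] by blast
  note D = jet_D[OF j]
  have D': "AE z in lebesgue_on (plate l). k z = D_xx l u z" "AE z in lebesgue_on (plate l). h z = D_xy l u z"
    "AE z in lebesgue_on (plate l). m z = D_yy l u z"
    using D by (auto simp: eq_commute)
  have "jet l u g q (D_xx l u) (D_xy l u) (D_yy l u)"
    using j D' unfolding jet_def
    by (auto intro: lp2_AE_cong[OF plate_sets] has_weak_partial_AE_right)
  then show ?thesis by blast
qed

lemma jet_comb:
  assumes j: "jet l u g q k h m" "jet l u' g' q' k' h' m'"
  shows "jet l (\<lambda>z. s * u z + t * u' z) (\<lambda>z. s * g z + t * g' z) (\<lambda>z. s * q z + t * q' z)
     (\<lambda>z. s * k z + t * k' z) (\<lambda>z. s * h z + t * h' z) (\<lambda>z. s * m z + t * m' z)"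
  using j unfolding jet_def
  by (auto intro!: lp2_comb has_weak_partial_comb lp2_integrable[OF finite_measure_plate] simp: Basis_real_prod)

lemma jet_sobolev: "jet l u g q k h m \<Longrightarrow> u \<in> sobolev_H 2 (plate l)"
  unfolding jet_def by (auto simp: numeral_2_eq_2 Basis_real_prod)

text \<open>On a finite measure space the sequence is also Cauchy in L^1, so a subsequence converges
  almost everywhere. Fatou's lemma along this subsequence bounds the L^2 distance of every late term
  from the pointwise limit.\<close>

lemma lp2_complete:
  fixes f :: "nat \<Rightarrow> 'a \<Rightarrow> real"
  assumes fin: "finite_measure M" and f: "\<And>n. f n \<in> lp_space M 2"
    and C: "\<And>e. e > 0 \<Longrightarrow> \<exists>N. \<forall>m\<ge>N. \<forall>n\<ge>N. (LINT z|M. (f m z - f n z)\<^sup>2) < e"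
  shows "\<exists>f0\<in>lp_space M 2. (\<lambda>n. LINT z|M. (f n z - f0 z)\<^sup>2) \<longlonglongrightarrow> 0"
proof -
  interpret finite_measure M by fact
  have d: "(\<lambda>z. f m z - f n z) \<in> lp_space M 2" for m n
    using lp2_comb[OF f[of m] f[of n], of 1 "-1"] by simp
  define a where "a = measure M (space M)"
  have a: "0 \<le> a" by (simp add: a_def)
  have L1: "(LINT z|M. \<bar>f m z - f n z\<bar>)\<^sup>2 \<le> a * (LINT z|M. (f m z - f n z)\<^sup>2)" for m n
    unfolding a_def
    by (rule square_integral_abs_le) (use lp2_integrable[OF fin d] d in \<open>auto simp: lp2_iff less_top[symmetric]\<close>)
  obtain r where r: "strict_mono r" and ae: "AE z in M. Cauchy (\<lambda>i. f (r i) z)"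
  proof (rule cauchy_L1_AE_cauchy_subseq[of M f])
    show "integrable M (f n)" for n by (rule lp2_integrable[OF fin f])
    fix e :: real assume e: "e > 0"
    then have "e\<^sup>2 / (a + 1) > 0" using a by simp
    from C[OF this] obtain N where N: "\<And>m n. m \<ge> N \<Longrightarrow> n \<ge> N \<Longrightarrow> (LINT z|M. (f m z - f n z)\<^sup>2) < e\<^sup>2 / (a + 1)" by blast
    have "(LINT z|M. norm (f m z - f n z)) < e" if mn: "m \<ge> N" "n \<ge> N" for m n
    proof -
      have "(LINT z|M. \<bar>f m z - f n z\<bar>)\<^sup>2 \<le> (a + 1) * (LINT z|M. (f m z - f n z)\<^sup>2)"
        using L1[of m n] by (rule order_trans) (simp add: mult_right_mono)
      also have "\<dots> < e\<^sup>2" using N[OF mn] a by (simp add: field_simps)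
      finally show ?thesis using e by (auto intro: power2_less_imp_less)
    qed
    then show "\<exists>N. \<forall>i\<ge>N. \<forall>j\<ge>N. (LINT z|M. norm (f i z - f j z)) < e" by blast
  qed
  define f0 where "f0 z = lim (\<lambda>i. f (r i) z)" for z
  have [measurable]: "f n \<in> borel_measurable M" for n using f[of n] by (simp add: lp2_iff)
  have [measurable]: "f0 \<in> borel_measurable M" unfolding f0_def by measurable
  have conv: "AE z in M. (\<lambda>i. f (r i) z) \<longlonglongrightarrow> f0 z"
    using ae unfolding f0_def by eventually_elim (simp add: Cauchy_convergent_iff convergent_LIMSEQ_iff)
  have bound: "integrable M (\<lambda>z. (f n z - f0 z)\<^sup>2) \<and> (LINT z|M. (f n z - f0 z)\<^sup>2) \<le> e"
    if e: "e > 0" and N: "\<And>m. m \<ge> N \<Longrightarrow> (LINT z|M. (f n z - f m z)\<^sup>2) < e" for n N e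
  proof -
    have "(\<integral>\<^sup>+ z. ennreal ((f n z - f0 z)\<^sup>2) \<partial>M) = (\<integral>\<^sup>+ z. liminf (\<lambda>i. ennreal ((f n z - f (r i) z)\<^sup>2)) \<partial>M)"
    proof (rule nn_integral_cong_AE)
      show "AE z in M. ennreal ((f n z - f0 z)\<^sup>2) = liminf (\<lambda>i. ennreal ((f n z - f (r i) z)\<^sup>2))"
        using conv
      proof eventually_elim
        case (elim z)
        have "(\<lambda>i. ennreal ((f n z - f (r i) z)\<^sup>2)) \<longlonglongrightarrow> ennreal ((f n z - f0 z)\<^sup>2)"
          by (intro tendsto_ennrealI tendsto_intros elim)
        from lim_imp_Liminf[OF _ this] show ?case by simp
      qed
    qed
    also have "\<dots> \<le> liminf (\<lambda>i. \<integral>\<^sup>+ z. ennreal ((f n z - f (r i) z)\<^sup>2) \<partial>M)"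
      by (rule nn_integral_liminf) measurable
    also have "\<dots> \<le> limsup (\<lambda>i. \<integral>\<^sup>+ z. ennreal ((f n z - f (r i) z)\<^sup>2) \<partial>M)"
      by (rule Liminf_le_Limsup) simp
    also have "\<dots> \<le> ennreal e"
    proof (rule Limsup_bounded)
      have "(\<integral>\<^sup>+ z. ennreal ((f n z - f (r i) z)\<^sup>2) \<partial>M) \<le> ennreal e" if "i \<ge> N" for i
      proof -
        have "r i \<ge> N" using seq_suble[OF r, of i] that by simp
        then have "(LINT z|M. (f n z - f (r i) z)\<^sup>2) \<le> e" using N by (simp add: less_imp_le)
        moreover have "(\<integral>\<^sup>+ z. ennreal ((f n z - f (r i) z)\<^sup>2) \<partial>M) = ennreal (LINT z|M. (f n z - f (r i) z)\<^sup>2)"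
          using d[of n "r i"] by (intro nn_integral_eq_integral) (auto simp: lp2_iff)
        ultimately show ?thesis by (simp add: ennreal_leI)
      qed
      then show "\<forall>\<^sub>F i in sequentially. (\<integral>\<^sup>+ z. ennreal ((f n z - f (r i) z)\<^sup>2) \<partial>M) \<le> ennreal e"
        unfolding eventually_sequentially by blast
    qed
    finally have nn: "(\<integral>\<^sup>+ z. ennreal ((f n z - f0 z)\<^sup>2) \<partial>M) \<le> ennreal e" .
    have i: "integrable M (\<lambda>z. (f n z - f0 z)\<^sup>2)"
      by (rule integrableI_bounded) (use nn in \<open>auto intro: le_less_trans\<close>)
    from nn nn_integral_eq_integral[OF i] have "ennreal (LINT z|M. (f n z - f0 z)\<^sup>2) \<le> ennreal e" by simp
    then show ?thesis using i e by (simp add: ennreal_le_iff)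
  qed
  have "f0 \<in> lp_space M 2"
  proof -
    obtain N where N: "\<And>m n. m \<ge> N \<Longrightarrow> n \<ge> N \<Longrightarrow> (LINT z|M. (f m z - f n z)\<^sup>2) < 1" using C[of 1] by auto
    have "(\<lambda>z. f N z - f0 z) \<in> lp_space M 2" using bound[of 1 N N] N by (auto simp: lp2_iff)
    from lp2_comb[OF f[of N] this, of 1 "-1"] show ?thesis by simp
  qed
  moreover have "(\<lambda>n. LINT z|M. (f n z - f0 z)\<^sup>2) \<longlonglongrightarrow> 0"
  proof (rule LIMSEQ_I)
    fix e :: real assume e: "e > 0"
    then obtain N where N: "\<And>m n. m \<ge> N \<Longrightarrow> n \<ge> N \<Longrightarrow> (LINT z|M. (f m z - f n z)\<^sup>2) < e / 2" using C[of "e/2"] by auto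
    have "norm ((LINT z|M. (f n z - f0 z)\<^sup>2) - 0) < e" if "n \<ge> N" for n
      using bound[of "e/2" N n] N that e by fastforce
    then show "\<exists>N. \<forall>n\<ge>N. norm ((LINT z|M. (f n z - f0 z)\<^sup>2) - 0) < e" by blast
  qed
  ultimately show ?thesis by blast
qed

text \<open>Each of the two factors pi is the width of the plate: one from Cauchy-Schwarz on a
  horizontal line, the other from integrating in x a bound that depends on y alone.\<close>

lemma section_square_bound:
  fixes f K :: "real \<times> real \<Rightarrow> real"
  assumes f: "integrable lborel (\<lambda>z. (f z)\<^sup>2)" and fout: "\<And>z. z \<notin> plate l \<Longrightarrow> f z = 0"
    and K: "integrable lborel K" "integrable lborel (\<lambda>z. (K z)\<^sup>2)" and Kout: "\<And>z. z \<notin> plate l \<Longrightarrow> K z = 0"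
    and bound: "AE z in lborel. z \<in> plate l \<longrightarrow> \<bar>f z\<bar> \<le> c * (LINT s|lborel. \<bar>K (s, snd z)\<bar>)"
  shows "(LINT z|lborel. (f z)\<^sup>2) \<le> c\<^sup>2 * pi\<^sup>2 * (LINT z|lborel. (K z)\<^sup>2)"
proof -
  define R where "R y = (LINT s|lborel. (K (s, y))\<^sup>2)" for y
  have R: "integrable lborel R" "(LINT y|lborel. R y) = (LINT z|lborel. (K z)\<^sup>2)" "0 \<le> R y" for y
    unfolding R_def using lborel2_integrable_x[OF K(2)] lborel2_integral_x[OF K(2)] by auto
  have sec: "AE y in lborel. (LINT s|lborel. \<bar>K (s, y)\<bar>)\<^sup>2 \<le> pi * R y"
    using lborel2_AE_integrable_x[OF K(1)] lborel2_AE_integrable_x[OF K(2)]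
  proof eventually_elim
    case (elim y)
    have "(LINT s|lborel. \<bar>K (s, y)\<bar>)\<^sup>2 \<le> measure lborel {0<..<pi} * (LINT s|lborel. (K (s, y))\<^sup>2)"
      by (rule square_integral_abs_le[OF elim]) (auto simp: plate_def intro: Kout)
    then show ?case by (simp add: R_def pi_ge_zero)
  qed
  have rhs: "integrable lborel (\<lambda>z::real \<times> real. indicator {0..pi} (fst z) * (c\<^sup>2 * pi * R (snd z)))"
    by (rule integrable_tensor[of "indicator {0..pi}" "\<lambda>y. c\<^sup>2 * pi * R y"]) (use integrable_indicator_Icc R(1) in auto)
  have "(LINT z|lborel. (f z)\<^sup>2) \<le> (LINT z|lborel. indicator {0..pi} (fst z) * (c\<^sup>2 * pi * R (snd z)))"
  proof (rule integral_mono_AE[OF f rhs])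
    show "AE z in lborel. (f z)\<^sup>2 \<le> indicator {0..pi} (fst z) * (c\<^sup>2 * pi * R (snd z))"
      using bound AE_lborel_fst_snd(2)[OF sec]
    proof eventually_elim
      case (elim z)
      show ?case
      proof (cases "z \<in> plate l")
        case True
        then have "\<bar>f z\<bar> \<le> c * (LINT s|lborel. \<bar>K (s, snd z)\<bar>)" using elim(1) by simp
        then have "(f z)\<^sup>2 \<le> (c * (LINT s|lborel. \<bar>K (s, snd z)\<bar>))\<^sup>2"
          by (metis abs_ge_zero power2_abs power_mono)
        also have "\<dots> \<le> c\<^sup>2 * (pi * R (snd z))"
          unfolding power_mult_distrib by (rule mult_left_mono[OF elim(2)]) simp
        finally show ?thesis using True by (auto simp: plate_def mult.assoc)
      qed (use fout R(3) pi_ge_zero in simp)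
    qed
  qed
  also have "\<dots> = (LINT y|lborel. pi * (c\<^sup>2 * pi * R y))"
    using lborel2_integral_x[OF rhs] by (simp add: pi_ge_zero)
  also have "\<dots> = c\<^sup>2 * pi\<^sup>2 * (LINT z|lborel. (K z)\<^sup>2)"
    by (simp add: R(2) power2_eq_square)
  finally show ?thesis .
qed

lemma H2_star_cont: "u \<in> H2_star l \<Longrightarrow> l > 0 \<Longrightarrow> continuous_on ({0..pi} \<times> {-l..l}) u"
  by (simp add: H2_star_def closure_plate)

lemma H2_star_sides:
  assumes u: "u \<in> H2_star l" and l: "l > 0" and x: "x \<in> {0, pi}" and y: "y \<in> {-l..l}"
  shows "u (x, y) = 0"
proof -
  have "continuous_on {-l..l} (\<lambda>y. u (x, y))"
    by (rule continuous_on_compose2[OF H2_star_cont[OF u l]]) (use x in \<open>auto intro!: continuous_intros\<close>)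
  moreover have "AE y in lborel. y \<in> {-l<..<l} \<longrightarrow> u (x, y) = 0"
    using u x by (intro AE_I2) (auto simp: H2_star_def)
  ultimately show ?thesis using l by (intro continuous_AE_const[of "-l" l "\<lambda>y. u (x, y)"]) (use y in auto)
qed

lemma H2_star_outside: "u \<in> H2_star l \<Longrightarrow> l > 0 \<Longrightarrow> z \<notin> {0..pi} \<times> {-l..l} \<Longrightarrow> u z = 0"
  using closure_plate[of l] unfolding H2_star_def by blast

text \<open>The jet is replaced by Borel representatives that vanish off the plate, which form a
  \<open>hinged_jet\<close>. The section bounds with factors 2 and 1 give the first two estimates;
  the third is \<open>u_bound\<close> with L^1 norms estimated by L^2 norms, whence the root of the
  area.\<close>

lemma jet_estimates:
  assumes u: "u \<in> H2_star l" and l: "l > 0" and j: "jet l u g q k h m"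
  shows "(LINT z|lebesgue_on (plate l). (g z)\<^sup>2) \<le> 4 * pi\<^sup>2 * (LINT z|lebesgue_on (plate l). (k z)\<^sup>2)"
    and "(LINT z|lebesgue_on (plate l). (q z)\<^sup>2) \<le> pi\<^sup>2 * (LINT z|lebesgue_on (plate l). (h z)\<^sup>2)"
    and "\<bar>u z\<bar> \<le> sqrt (measure lborel (plate l)) *
      (sqrt (LINT z|lebesgue_on (plate l). (h z)\<^sup>2) + pi / l * sqrt (LINT z|lebesgue_on (plate l). (k z)\<^sup>2))"
proof -
  let ?M = "lebesgue_on (plate l)"
  have L2: "g \<in> lp_space ?M 2" "q \<in> lp_space ?M 2" "k \<in> lp_space ?M 2" "h \<in> lp_space ?M 2" "u \<in> lp_space ?M 2"
    using j by (auto simp: jet_def)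
  note int = L2[THEN lp2_integrable[OF finite_measure_plate]]
  obtain g' where g': "integrable lborel g'" "\<And>z. z \<notin> plate l \<Longrightarrow> g' z = 0" "AE z in lborel. indicator (plate l) z * g z = g' z"
    "\<And>\<phi>. \<phi> \<in> borel_measurable borel \<Longrightarrow> (LINT z|?M. g z * \<phi> z) = (LINT z|lborel. g' z * \<phi> z)"
    using plate_representative[OF int(1)] by blast
  obtain q' where q': "integrable lborel q'" "\<And>z. z \<notin> plate l \<Longrightarrow> q' z = 0" "AE z in lborel. indicator (plate l) z * q z = q' z"
    "\<And>\<phi>. \<phi> \<in> borel_measurable borel \<Longrightarrow> (LINT z|?M. q z * \<phi> z) = (LINT z|lborel. q' z * \<phi> z)"
    using plate_representative[OF int(2)] by blast
  obtain k' where k': "integrable lborel k'" "\<And>z. z \<notin> plate l \<Longrightarrow> k' z = 0" "AE z in lborel. indicator (plate l) z * k z = k' z"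
    "\<And>\<phi>. \<phi> \<in> borel_measurable borel \<Longrightarrow> (LINT z|?M. k z * \<phi> z) = (LINT z|lborel. k' z * \<phi> z)"
    using plate_representative[OF int(3)] by blast
  obtain h' where h': "integrable lborel h'" "\<And>z. z \<notin> plate l \<Longrightarrow> h' z = 0" "AE z in lborel. indicator (plate l) z * h z = h' z"
    "\<And>\<phi>. \<phi> \<in> borel_measurable borel \<Longrightarrow> (LINT z|?M. h z * \<phi> z) = (LINT z|lborel. h' z * \<phi> z)"
    using plate_representative[OF int(4)] by blast
  note cont = H2_star_cont[OF u l]
  have uB: "(\<lambda>z. indicator (plate l) z * u z) \<in> borel_measurable borel"
  proof -
    have "continuous_on (plate l) u" by (rule continuous_on_subset[OF cont]) (auto simp: plate_def)
    from borel_measurable_continuous_on_indicator[OF plate_borel this] show ?thesis by simp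
  qed
  have uint: "(LINT z|?M. u z * \<phi> z) = (LINT z|lborel. (indicator (plate l) z * u z) * \<phi> z)"
    if [measurable]: "\<phi> \<in> borel_measurable borel" for \<phi>
  proof -
    have "(LINT z|lebesgue. (indicator (plate l) z * u z) * \<phi> z) = (LINT z|lborel. (indicator (plate l) z * u z) * \<phi> z)"
      by (rule integral_completion) (use uB in simp)
    then show ?thesis by (simp add: integral_plate_eq mult.assoc)
  qed
  have m: "\<alpha> \<in> borel_measurable borel" "deriv \<alpha> \<in> borel_measurable borel" if "\<alpha> \<in> bumps a b" for \<alpha> a b
    using bumps_measurable[OF that] bumps_measurable[OF bumps_deriv[OF that]] by auto
  interpret hinged_jet l u g' q' k' h'
  proof
    fix \<alpha> \<beta> assume a: "\<alpha> \<in> bumps 0 pi" and b: "\<beta> \<in> bumps (-l) l"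
    note T = tensor_borel[OF m(1)[OF a] m(1)[OF b]] tensor_borel[OF m(2)[OF a] m(1)[OF b]] tensor_borel[OF m(1)[OF a] m(2)[OF b]]
    show "(LINT z|lborel. (indicator (plate l) z * u z) * (deriv \<alpha> (fst z) * \<beta> (snd z))) = - (LINT z|lborel. g' z * (\<alpha> (fst z) * \<beta> (snd z)))"
      using has_weak_partial_tensor(1)[OF a b, of u g] j unfolding jet_def uint[OF T(2)] g'(4)[OF T(1)] by blast
    show "(LINT z|lborel. (indicator (plate l) z * u z) * (\<alpha> (fst z) * deriv \<beta> (snd z))) = - (LINT z|lborel. q' z * (\<alpha> (fst z) * \<beta> (snd z)))"
      using has_weak_partial_tensor(2)[OF a b, of u q] j unfolding jet_def uint[OF T(3)] q'(4)[OF T(1)] by blast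
    show "(LINT z|lborel. g' z * (deriv \<alpha> (fst z) * \<beta> (snd z))) = - (LINT z|lborel. k' z * (\<alpha> (fst z) * \<beta> (snd z)))"
      using has_weak_partial_tensor(1)[OF a b, of g k] j unfolding jet_def g'(4)[OF T(2)] k'(4)[OF T(1)] by blast
    show "(LINT z|lborel. q' z * (deriv \<alpha> (fst z) * \<beta> (snd z))) = - (LINT z|lborel. h' z * (\<alpha> (fst z) * \<beta> (snd z)))"
      using has_weak_partial_tensor(1)[OF a b, of q h] j unfolding jet_def q'(4)[OF T(2)] h'(4)[OF T(1)] by blast
  qed (use l cont H2_star_sides[OF u l] g'(1) q'(1) k'(1) h'(1) in auto)
  note g2 = integral_square_representative[OF g'(1) g'(3) L2(1)]
  note q2 = integral_square_representative[OF q'(1) q'(3) L2(2)]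
  note k2 = integral_square_representative[OF k'(1) k'(3) L2(3)]
  note h2 = integral_square_representative[OF h'(1) h'(3) L2(4)]
  have "(LINT z|lborel. (g' z)\<^sup>2) \<le> 2\<^sup>2 * pi\<^sup>2 * (LINT z|lborel. (k' z)\<^sup>2)"
    by (rule section_square_bound[OF g2(1) g'(2) k'(1) k2(1) k'(2)]) (use g_section_bound in \<open>simp_all add: \<kappa>_def\<close>)
  then show "(LINT z|?M. (g z)\<^sup>2) \<le> 4 * pi\<^sup>2 * (LINT z|?M. (k z)\<^sup>2)" by (simp add: g2(2) k2(2))
  have "(LINT z|lborel. (q' z)\<^sup>2) \<le> 1\<^sup>2 * pi\<^sup>2 * (LINT z|lborel. (h' z)\<^sup>2)"
    by (rule section_square_bound[OF q2(1) q'(2) h'(1) h2(1) h'(2)]) (use q_section_bound in \<open>simp_all add: H_def\<close>)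
  then show "(LINT z|?M. (q z)\<^sup>2) \<le> pi\<^sup>2 * (LINT z|?M. (h z)\<^sup>2)" by (simp add: q2(2) h2(2))
  have L1: "(LINT z|lborel. \<bar>f z\<bar>) \<le> sqrt (measure lborel (plate l)) * sqrt (LINT z|lborel. (f z)\<^sup>2)"
    if "integrable lborel f" "integrable lborel (\<lambda>z. (f z)\<^sup>2)" "\<And>z. z \<notin> plate l \<Longrightarrow> f z = 0" for f
  proof -
    have "(LINT z|lborel. \<bar>f z\<bar>)\<^sup>2 \<le> measure lborel (plate l) * (LINT z|lborel. (f z)\<^sup>2)"
      by (rule square_integral_abs_le[OF that(1,2) _ _ that(3)]) (simp_all add: plate_eq_box emeasure_lborel_box_eq)
    then show ?thesis by (metis real_le_rsqrt real_sqrt_mult)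
  qed
  show "\<bar>u z\<bar> \<le> sqrt (measure lborel (plate l)) *
      (sqrt (LINT z|?M. (h z)\<^sup>2) + pi / l * sqrt (LINT z|?M. (k z)\<^sup>2))"
  proof (cases "z \<in> {0..pi} \<times> {-l..l}")
    case True
    have "\<bar>u z\<bar> \<le> (LINT z|lborel. \<bar>h' z\<bar>) + pi / l * (LINT z|lborel. \<bar>k' z\<bar>)"
      using u_bound[of "fst z" "snd z"] True by (simp add: mem_Times_iff)
    also have "\<dots> \<le> sqrt (measure lborel (plate l)) * sqrt (LINT z|lborel. (h' z)\<^sup>2)
        + pi / l * (sqrt (measure lborel (plate l)) * sqrt (LINT z|lborel. (k' z)\<^sup>2))"
      using l pi_ge_zero by (intro add_mono mult_left_mono L1 h' k' h2 k2) auto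
    finally show ?thesis by (simp add: h2(2) k2(2) algebra_simps)
  next
    case False
    then show ?thesis using H2_star_outside[OF u l] l pi_ge_zero by simp
  qed
qed

section \<open>Completeness of the energy norm\<close>

lemma has_weak_partial_zero: "has_weak_partial (plate l) e (\<lambda>z. 0) (\<lambda>z. 0)"
  unfolding has_weak_partial_def by (auto intro: locally_integrableI)

lemma H2_starI:
  assumes "jet l u g q k h m" "l > 0" "continuous_on ({0..pi} \<times> {-l..l}) u"
    and "\<And>z. z \<notin> {0..pi} \<times> {-l..l} \<Longrightarrow> u z = 0"
    and "\<And>x y. x \<in> {0, pi} \<Longrightarrow> y \<in> {-l<..<l} \<Longrightarrow> u (x, y) = 0"
  shows "u \<in> H2_star l"
  unfolding H2_star_def mem_Collect_eq closure_plate[OF assms(2)]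
  using jet_sobolev[OF assms(1)] assms(3-5) by blast

lemma H2_star_jet: "u \<in> H2_star l \<Longrightarrow> \<exists>g q. jet l u g q (D_xx l u) (D_xy l u) (D_yy l u)"
  by (rule jet_D_exists) (simp add: H2_star_def)

lemma H2_star_zero: "l > 0 \<Longrightarrow> (\<lambda>z. 0) \<in> H2_star l"
  by (rule H2_starI[of l _ "\<lambda>z. 0" "\<lambda>z. 0" "\<lambda>z. 0" "\<lambda>z. 0" "\<lambda>z. 0"])
    (auto simp: jet_def has_weak_partial_zero lp2_iff)

lemma H2_star_comb:
  assumes u: "u \<in> H2_star l" and v: "v \<in> H2_star l" and l: "l > 0"
  shows "(\<lambda>z. s * u z + t * v z) \<in> H2_star l"
proof -
  obtain g q g' q' where "jet l u g q (D_xx l u) (D_xy l u) (D_yy l u)" "jet l v g' q' (D_xx l v) (D_xy l v) (D_yy l v)"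
    using H2_star_jet[OF u] H2_star_jet[OF v] by blast
  from H2_starI[OF jet_comb[OF this] l] show ?thesis
  proof
    show "continuous_on ({0..pi} \<times> {-l..l}) (\<lambda>z. s * u z + t * v z)"
      by (intro continuous_intros H2_star_cont u v l)
  qed (use H2_star_outside[OF u l] H2_star_outside[OF v l] H2_star_sides[OF u l] H2_star_sides[OF v l] in auto)
qed

text \<open>The integrand of the form (u,v): expanding \<Delta>u \<Delta>v and collecting the
  products u_xx v_yy and u_yy v_xx leaves the coefficient 1 - (1 - \<sigma>) = \<sigma>.\<close>

definition bend :: "real \<Rightarrow> real \<Rightarrow> real \<Rightarrow> real \<Rightarrow> real \<Rightarrow> real \<Rightarrow> real \<Rightarrow> real" where
  "bend \<sigma> k h m k' h' m' = k * k' + m * m' + \<sigma> * (k * m' + m * k') + 2 * (1 - \<sigma>) * (h * h')"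

lemma bend_lower:
  assumes "0 < \<sigma>" "\<sigma> < 1"
  shows "(1 - \<sigma>) * (k\<^sup>2 + h\<^sup>2 + m\<^sup>2) \<le> bend \<sigma> k h m k h m"
proof -
  have "bend \<sigma> k h m k h m - (1 - \<sigma>) * (k\<^sup>2 + h\<^sup>2 + m\<^sup>2) = \<sigma> * (k + m)\<^sup>2 + (1 - \<sigma>) * h\<^sup>2"
    by (simp add: bend_def power2_eq_square algebra_simps)
  also have "\<dots> \<ge> 0" using assms by simp
  finally show ?thesis by simp
qed

lemma bend_upper:
  assumes "0 < \<sigma>" "\<sigma> < 1"
  shows "bend \<sigma> k h m k h m \<le> 2 * (k\<^sup>2 + h\<^sup>2 + m\<^sup>2)"
proof -
  have "2 * (k\<^sup>2 + h\<^sup>2 + m\<^sup>2) - bend \<sigma> k h m k h m = \<sigma> * (k - m)\<^sup>2 + (1 - \<sigma>) * (k\<^sup>2 + m\<^sup>2) + 2 * \<sigma> * h\<^sup>2"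
    by (simp add: bend_def power2_eq_square algebra_simps)
  also have "\<dots> \<ge> 0" using assms by simp
  finally show ?thesis by simp
qed

text \<open>The lower bound 1 on the weight preserves the coercivity constant 1 - \<sigma>; the
  upper bound \<open>W\<close> turns L^2 convergence of second derivatives into convergence in
  energy.\<close>

locale weighted_plate =
  fixes l \<sigma> W :: real and \<omega> :: "real \<times> real \<Rightarrow> real"
  assumes l: "0 < l" and \<sigma>: "0 < \<sigma>" "\<sigma> < 1"
    and \<omega>_measurable [measurable]: "\<omega> \<in> borel_measurable (lebesgue_on (plate l))"
    and \<omega>_bounds: "1 \<le> \<omega> z" "\<omega> z \<le> W"
begin

abbreviation M where "M \<equiv> lebesgue_on (plate l)"

definition form :: "(real \<times> real \<Rightarrow> real) \<Rightarrow> (real \<times> real \<Rightarrow> real) \<Rightarrow> real" where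
  "form u v = (LINT z|M. \<omega> z * bend \<sigma> (D_xx l u z) (D_xy l u z) (D_yy l u z) (D_xx l v z) (D_xy l v z) (D_yy l v z))"

lemma integrable_bend:
  assumes "{k, h, m, k', h', m'} \<subseteq> lp_space M 2"
  shows "integrable M (\<lambda>z. \<omega> z * bend \<sigma> (k z) (h z) (m z) (k' z) (h' z) (m' z))"
proof -
  have "integrable M (\<lambda>z. bend \<sigma> (k z) (h z) (m z) (k' z) (h' z) (m' z))"
    unfolding bend_def
    by (intro Bochner_Integration.integrable_add integrable_mult_right lp2_mult) (use assms in auto)
  then have "integrable M (\<lambda>z. bend \<sigma> (k z) (h z) (m z) (k' z) (h' z) (m' z) * \<omega> z)"
  proof (rule integrable_mult_bounded)
    show "\<bar>\<omega> z\<bar> \<le> W" for z using \<omega>_bounds[of z] by linarith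
  qed simp
  then show ?thesis by (simp add: mult.commute)
qed

text \<open>Allows the form to be computed from any jets, since the chosen second derivatives differ
  from them only on null sets.\<close>

lemma form_jet:
  assumes "jet l u g q k h m" "jet l v g' q' k' h' m'"
  shows "form u v = (LINT z|M. \<omega> z * bend \<sigma> (k z) (h z) (m z) (k' z) (h' z) (m' z))"
  unfolding form_def
proof (rule integral_cong_AE_lebesgue_on[OF plate_sets])
  show "AE z in M. \<omega> z * bend \<sigma> (D_xx l u z) (D_xy l u z) (D_yy l u z) (D_xx l v z) (D_xy l v z) (D_yy l v z) =
      \<omega> z * bend \<sigma> (k z) (h z) (m z) (k' z) (h' z) (m' z)"
    using jet_D[OF assms(1)] jet_D[OF assms(2)] by eventually_elim simp
qed

lemma jet_L2: "jet l u g q k h m \<Longrightarrow> {k, h, m} \<subseteq> lp_space M 2"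
  by (auto simp: jet_def)

lemma form_lin:
  assumes u: "u \<in> H2_star l" and v: "v \<in> H2_star l" and w: "w \<in> H2_star l"
  shows "form (\<lambda>z. s * u z + t * v z) w = s * form u w + t * form v w"
proof -
  obtain g q g' q' g'' q'' where j: "jet l u g q (D_xx l u) (D_xy l u) (D_yy l u)"
      "jet l v g' q' (D_xx l v) (D_xy l v) (D_yy l v)" "jet l w g'' q'' (D_xx l w) (D_xy l w) (D_yy l w)"
    using H2_star_jet[OF u] H2_star_jet[OF v] H2_star_jet[OF w] by blast
  have "bend \<sigma> (s * a + t * a') (s * b + t * b') (s * c + t * c') x y z = s * bend \<sigma> a b c x y z + t * bend \<sigma> a' b' c' x y z"
    for a a' b b' c c' x y z by (simp add: bend_def algebra_simps)
  note lin = this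
  have "form (\<lambda>z. s * u z + t * v z) w =
    (LINT z|M. s * (\<omega> z * bend \<sigma> (D_xx l u z) (D_xy l u z) (D_yy l u z) (D_xx l w z) (D_xy l w z) (D_yy l w z))
      + t * (\<omega> z * bend \<sigma> (D_xx l v z) (D_xy l v z) (D_yy l v z) (D_xx l w z) (D_xy l w z) (D_yy l w z)))"
    unfolding form_jet[OF jet_comb[OF j(1,2)] j(3)] lin by (simp add: algebra_simps)
  also have "\<dots> = s * form u w + t * form v w"
    unfolding form_def
    using integrable_bend[of "D_xx l u" "D_xy l u" "D_yy l u" "D_xx l w" "D_xy l w" "D_yy l w"]
      integrable_bend[of "D_xx l v" "D_xy l v" "D_yy l v" "D_xx l w" "D_xy l w" "D_yy l w"]
      jet_L2[OF j(1)] jet_L2[OF j(2)] jet_L2[OF j(3)] by simp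
  finally show ?thesis .
qed

lemma form_coercive:
  assumes j: "jet l u g q k h m"
  shows "(1 - \<sigma>) * ((LINT z|M. (k z)\<^sup>2) + (LINT z|M. (h z)\<^sup>2) + (LINT z|M. (m z)\<^sup>2)) \<le> form u u"
    and "form u u \<le> 2 * W * ((LINT z|M. (k z)\<^sup>2) + (LINT z|M. (h z)\<^sup>2) + (LINT z|M. (m z)\<^sup>2))"
proof -
  have i: "integrable M (\<lambda>z. (k z)\<^sup>2)" "integrable M (\<lambda>z. (h z)\<^sup>2)" "integrable M (\<lambda>z. (m z)\<^sup>2)"
    using jet_L2[OF j] by (auto simp: lp2_iff)
  have ib: "integrable M (\<lambda>z. \<omega> z * bend \<sigma> (k z) (h z) (m z) (k z) (h z) (m z))"
    using jet_L2[OF j] by (intro integrable_bend) auto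
  have low: "(1 - \<sigma>) * ((k z)\<^sup>2 + (h z)\<^sup>2 + (m z)\<^sup>2) \<le> \<omega> z * bend \<sigma> (k z) (h z) (m z) (k z) (h z) (m z)" for z
  proof -
    note b = bend_lower[OF \<sigma>, of "k z" "h z" "m z"]
    have "0 \<le> (1 - \<sigma>) * ((k z)\<^sup>2 + (h z)\<^sup>2 + (m z)\<^sup>2)" using \<sigma> by simp
    with b have "1 * bend \<sigma> (k z) (h z) (m z) (k z) (h z) (m z) \<le> \<omega> z * bend \<sigma> (k z) (h z) (m z) (k z) (h z) (m z)"
      by (intro mult_right_mono \<omega>_bounds) linarith
    with b show ?thesis by linarith
  qed
  have up: "\<omega> z * bend \<sigma> (k z) (h z) (m z) (k z) (h z) (m z) \<le> 2 * W * ((k z)\<^sup>2 + (h z)\<^sup>2 + (m z)\<^sup>2)" for z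
  proof -
    have "0 \<le> \<omega> z" "0 \<le> W" using \<omega>_bounds[of z] by linarith+
    then have "\<omega> z * bend \<sigma> (k z) (h z) (m z) (k z) (h z) (m z) \<le> \<omega> z * (2 * ((k z)\<^sup>2 + (h z)\<^sup>2 + (m z)\<^sup>2))"
      by (intro mult_left_mono bend_upper \<sigma>)
    also have "\<dots> \<le> W * (2 * ((k z)\<^sup>2 + (h z)\<^sup>2 + (m z)\<^sup>2))"
      by (intro mult_right_mono \<omega>_bounds) simp
    finally show ?thesis by (simp add: mult_ac)
  qed
  have "(LINT z|M. (1 - \<sigma>) * ((k z)\<^sup>2 + (h z)\<^sup>2 + (m z)\<^sup>2)) \<le> form u u"
    unfolding form_jet[OF j j] by (rule integral_mono) (use i ib low in auto)
  then show "(1 - \<sigma>) * ((LINT z|M. (k z)\<^sup>2) + (LINT z|M. (h z)\<^sup>2) + (LINT z|M. (m z)\<^sup>2)) \<le> form u u"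
    using i by simp
  have "form u u \<le> (LINT z|M. 2 * W * ((k z)\<^sup>2 + (h z)\<^sup>2 + (m z)\<^sup>2))"
    unfolding form_jet[OF j j] by (rule integral_mono) (use i ib up in auto)
  then show "form u u \<le> 2 * W * ((LINT z|M. (k z)\<^sup>2) + (LINT z|M. (h z)\<^sup>2) + (LINT z|M. (m z)\<^sup>2))"
    using i by simp
qed

lemma form_sym: "form u v = form v u"
  unfolding form_def by (simp add: bend_def algebra_simps)

text \<open>The constant of the pointwise bound in \<open>jet_estimates\<close>, with both
  second-derivative norms replaced by the energy norm over sqrt (1 - \<sigma>).\<close>

definition C :: real where "C = sqrt (measure lborel (plate l)) * (1 + pi / l) / sqrt (1 - \<sigma>)"

lemma C_nonneg: "0 \<le> C" unfolding C_def using \<sigma> l pi_ge_zero by simp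

lemma second_derivatives_bound:
  assumes j: "jet l u g q k h m"
  shows "(LINT z|M. (k z)\<^sup>2) \<le> form u u / (1 - \<sigma>)" "(LINT z|M. (h z)\<^sup>2) \<le> form u u / (1 - \<sigma>)"
    "(LINT z|M. (m z)\<^sup>2) \<le> form u u / (1 - \<sigma>)"
proof -
  have nn: "0 \<le> (LINT z|M. (f z)\<^sup>2)" for f :: "real \<times> real \<Rightarrow> real" by simp
  have "(LINT z|M. (k z)\<^sup>2) + (LINT z|M. (h z)\<^sup>2) + (LINT z|M. (m z)\<^sup>2) \<le> form u u / (1 - \<sigma>)"
    using form_coercive(1)[OF j] \<sigma> by (simp add: field_simps)
  then show "(LINT z|M. (k z)\<^sup>2) \<le> form u u / (1 - \<sigma>)" "(LINT z|M. (h z)\<^sup>2) \<le> form u u / (1 - \<sigma>)"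
    "(LINT z|M. (m z)\<^sup>2) \<le> form u u / (1 - \<sigma>)"
    using nn[of k] nn[of h] nn[of m] by linarith+
qed

lemma form_eval:
  assumes u: "u \<in> H2_star l"
  shows "\<bar>u z\<bar> \<le> C * sqrt (form u u)"
proof -
  obtain g q where j: "jet l u g q (D_xx l u) (D_xy l u) (D_yy l u)" using H2_star_jet[OF u] by blast
  note b = second_derivatives_bound[OF j]
  have "\<bar>u z\<bar> \<le> sqrt (measure lborel (plate l)) *
      (sqrt (LINT z|M. (D_xy l u z)\<^sup>2) + pi / l * sqrt (LINT z|M. (D_xx l u z)\<^sup>2))"
    by (rule jet_estimates(3)[OF u l j])
  also have "\<dots> \<le> sqrt (measure lborel (plate l)) *
      (sqrt (form u u / (1 - \<sigma>)) + pi / l * sqrt (form u u / (1 - \<sigma>)))"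
    using l pi_ge_zero by (intro mult_left_mono add_mono real_sqrt_le_mono b) auto
  also have "\<dots> = C * sqrt (form u u)"
    using \<sigma> by (simp add: C_def real_sqrt_divide field_simps)
  finally show ?thesis .
qed

lemma form_nonneg: "u \<in> H2_star l \<Longrightarrow> 0 \<le> form u u"
proof -
  assume u: "u \<in> H2_star l"
  obtain g q where j: "jet l u g q (D_xx l u) (D_xy l u) (D_yy l u)" using H2_star_jet[OF u] by blast
  have "0 \<le> (1 - \<sigma>) * ((LINT z|M. (D_xx l u z)\<^sup>2) + (LINT z|M. (D_xy l u z)\<^sup>2) + (LINT z|M. (D_yy l u z)\<^sup>2))"
    using \<sigma> by (intro mult_nonneg_nonneg add_nonneg_nonneg) auto
  with form_coercive(1)[OF j] show ?thesis by linarith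
qed

lemma L1_tendsto:
  assumes "\<And>n. f n \<in> lp_space M 2" "f0 \<in> lp_space M 2" and lim: "(\<lambda>n. LINT z|M. (f n z - f0 z)\<^sup>2) \<longlonglongrightarrow> 0"
  shows "(\<lambda>n. LINT z|M. \<bar>f n z - f0 z\<bar>) \<longlonglongrightarrow> 0"
proof -
  interpret finite_measure M by (rule finite_measure_plate)
  have d: "(\<lambda>z. f n z - f0 z) \<in> lp_space M 2" for n using lp2_comb[OF assms(1)[of n] assms(2), of 1 "-1"] by simp
  have bound: "norm (LINT z|M. \<bar>f n z - f0 z\<bar>) \<le> sqrt (measure M (space M)) * sqrt (LINT z|M. (f n z - f0 z)\<^sup>2)" for n
  proof -
    have "(LINT z|M. \<bar>f n z - f0 z\<bar>)\<^sup>2 \<le> measure M (space M) * (LINT z|M. (f n z - f0 z)\<^sup>2)"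
      by (rule square_integral_abs_le)
        (use lp2_integrable[OF finite_measure_plate d] d in \<open>auto simp: lp2_iff less_top[symmetric] simp del: space_lebesgue_on\<close>)
    then show ?thesis by (simp add: real_le_rsqrt real_sqrt_mult[symmetric])
  qed
  have "(\<lambda>n. sqrt (measure M (space M)) * sqrt (LINT z|M. (f n z - f0 z)\<^sup>2)) \<longlonglongrightarrow> 0"
    using tendsto_mult_right_zero[OF tendsto_real_sqrt[OF lim, simplified]] .
  then show ?thesis by (rule Lim_null_comparison[OF always_eventually, rotated]) (rule allI, rule bound)
qed

text \<open>All derivatives converge in L^2 and the functions themselves uniformly, by
  \<open>form_eval\<close>. Uniform convergence preserves continuity on the closed plate, the
  boundary values and the zero extension; the L^2 limits form a jet of the uniform limit, so the
  limit lies in the space.\<close>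

lemma form_complete:
  assumes X: "\<And>n. X n \<in> H2_star l"
    and Cauchy: "\<And>e. e > 0 \<Longrightarrow> \<exists>N. \<forall>m\<ge>N. \<forall>n\<ge>N. form (\<lambda>z. X m z - X n z) (\<lambda>z. X m z - X n z) < e"
  shows "\<exists>u\<in>H2_star l. (\<lambda>n. form (\<lambda>z. X n z - u z) (\<lambda>z. X n z - u z)) \<longlonglongrightarrow> 0"
proof -
  define k h m where "k n = D_xx l (X n)" and "h n = D_xy l (X n)" and "m n = D_yy l (X n)" for n
  have "\<forall>n. \<exists>g q. jet l (X n) g q (k n) (h n) (m n)"
    unfolding k_def h_def m_def using H2_star_jet[OF X] by blast
  then obtain g q where j: "\<And>n. jet l (X n) (g n) (q n) (k n) (h n) (m n)" by metis
  define F where "F i n = form (\<lambda>z. X i z - X n z) (\<lambda>z. X i z - X n z)" for i n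
  have XX: "(\<lambda>z. X i z - X n z) \<in> H2_star l" for i n using H2_star_comb[OF X[of i] X[of n] l, of 1 "-1"] by simp
  have jd: "jet l (\<lambda>z. X i z - X n z) (\<lambda>z. g i z - g n z) (\<lambda>z. q i z - q n z)
      (\<lambda>z. k i z - k n z) (\<lambda>z. h i z - h n z) (\<lambda>z. m i z - m n z)" for i n
    using jet_comb[OF j[of i] j[of n], of 1 "-1"] by simp
  note sd = second_derivatives_bound[OF jd, folded F_def]
  note je = jet_estimates[OF XX l jd]
  \<comment> \<open>The sum of the constants for first and second derivatives, so that one bound
    serves all five components.\<close>
  define c where "c = 4 * pi\<^sup>2 / (1 - \<sigma>) + 1 / (1 - \<sigma>)"
  have c: "c > 0" unfolding c_def using \<sigma> pi_gt_zero by (simp add: add_pos_pos)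
  have F0: "0 \<le> F i n" for i n unfolding F_def by (rule form_nonneg[OF XX])
  have small: "x \<le> c * F i n" if "x \<le> F i n / (1 - \<sigma>) \<or> x \<le> 4 * pi\<^sup>2 * (F i n / (1 - \<sigma>))" for x i n
  proof -
    have "c * F i n = 4 * pi\<^sup>2 * (F i n / (1 - \<sigma>)) + F i n / (1 - \<sigma>)" by (simp add: c_def algebra_simps add_divide_distrib)
    moreover have "0 \<le> F i n / (1 - \<sigma>)" "0 \<le> 4 * pi\<^sup>2 * (F i n / (1 - \<sigma>))" using F0 \<sigma> by simp_all
    ultimately show ?thesis using that by linarith
  qed
  have b: "(LINT z|M. (k i z - k n z)\<^sup>2) \<le> c * F i n" "(LINT z|M. (h i z - h n z)\<^sup>2) \<le> c * F i n"
    "(LINT z|M. (m i z - m n z)\<^sup>2) \<le> c * F i n" "(LINT z|M. (g i z - g n z)\<^sup>2) \<le> c * F i n"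
    "(LINT z|M. (q i z - q n z)\<^sup>2) \<le> c * F i n" for i n
  proof -
    show "(LINT z|M. (k i z - k n z)\<^sup>2) \<le> c * F i n" "(LINT z|M. (h i z - h n z)\<^sup>2) \<le> c * F i n"
      "(LINT z|M. (m i z - m n z)\<^sup>2) \<le> c * F i n" using sd[of i n] by (auto intro: small)
    have "(LINT z|M. (g i z - g n z)\<^sup>2) \<le> 4 * pi\<^sup>2 * (F i n / (1 - \<sigma>))"
      by (rule order_trans[OF je(1)]) (intro mult_left_mono sd, simp)
    then show "(LINT z|M. (g i z - g n z)\<^sup>2) \<le> c * F i n" by (intro small) simp
    have "(LINT z|M. (q i z - q n z)\<^sup>2) \<le> pi\<^sup>2 * (F i n / (1 - \<sigma>))"
      by (rule order_trans[OF je(2)]) (intro mult_left_mono sd, simp)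
    also have "\<dots> \<le> 4 * pi\<^sup>2 * (F i n / (1 - \<sigma>))"
      by (rule mult_right_mono) (use F0 \<sigma> in simp_all)
    finally show "(LINT z|M. (q i z - q n z)\<^sup>2) \<le> c * F i n" by (intro small) simp
  qed
  have lim: "\<exists>f0\<in>lp_space M 2. (\<lambda>n. LINT z|M. (f n z - f0 z)\<^sup>2) \<longlonglongrightarrow> 0"
    if "\<And>n. f n \<in> lp_space M 2" and fb: "\<And>i n. (LINT z|M. (f i z - f n z)\<^sup>2) \<le> c * F i n" for f
  proof (rule lp2_complete[OF finite_measure_plate that(1)])
    fix e :: real assume "e > 0"
    then have "e / c > 0" using c by simp
    from Cauchy[OF this] obtain N where N: "\<And>i n. i \<ge> N \<Longrightarrow> n \<ge> N \<Longrightarrow> F i n < e / c" unfolding F_def by blast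
    have "(LINT z|M. (f i z - f n z)\<^sup>2) < e" if "i \<ge> N" "n \<ge> N" for i n
      using fb[of i n] N[OF that] c by (simp add: field_simps)
    then show "\<exists>N. \<forall>m\<ge>N. \<forall>n\<ge>N. (LINT z|M. (f m z - f n z)\<^sup>2) < e" by blast
  qed
  have L2: "X n \<in> lp_space M 2" "g n \<in> lp_space M 2" "q n \<in> lp_space M 2" "k n \<in> lp_space M 2" "h n \<in> lp_space M 2" "m n \<in> lp_space M 2" for n
    using j[of n] by (auto simp: jet_def)
  obtain g0 where g0: "g0 \<in> lp_space M 2" "(\<lambda>n. LINT z|M. (g n z - g0 z)\<^sup>2) \<longlonglongrightarrow> 0" using lim[of g] L2(2) b(4) by blast
  obtain q0 where q0: "q0 \<in> lp_space M 2" "(\<lambda>n. LINT z|M. (q n z - q0 z)\<^sup>2) \<longlonglongrightarrow> 0" using lim[of q] L2(3) b(5) by blast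
  obtain k0 where k0: "k0 \<in> lp_space M 2" "(\<lambda>n. LINT z|M. (k n z - k0 z)\<^sup>2) \<longlonglongrightarrow> 0" using lim[of k] L2(4) b(1) by blast
  obtain h0 where h0: "h0 \<in> lp_space M 2" "(\<lambda>n. LINT z|M. (h n z - h0 z)\<^sup>2) \<longlonglongrightarrow> 0" using lim[of h] L2(5) b(2) by blast
  obtain m0 where m0: "m0 \<in> lp_space M 2" "(\<lambda>n. LINT z|M. (m n z - m0 z)\<^sup>2) \<longlonglongrightarrow> 0" using lim[of m] L2(6) b(3) by blast
  have "uniformly_convergent_on UNIV X"
  proof (rule Cauchy_uniformly_convergent, unfold uniformly_Cauchy_on_def, intro allI impI)
    fix e :: real assume e: "e > 0"
    \<comment> \<open>The denominator \<open>C + 1\<close> is positive by \<open>C_nonneg\<close>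
      alone.\<close>
    then have "(e / (C + 1))\<^sup>2 > 0" using C_nonneg by simp
    from Cauchy[OF this] obtain N where N: "\<And>i n. i \<ge> N \<Longrightarrow> n \<ge> N \<Longrightarrow> F i n < (e / (C + 1))\<^sup>2" unfolding F_def by blast
    have "dist (X i z) (X n z) < e" if "i \<ge> N" "n \<ge> N" for i n z
    proof -
      have "sqrt (F i n) < e / (C + 1)"
        using real_sqrt_less_mono[OF N[OF that]] e C_nonneg by simp
      then have "(C + 1) * sqrt (F i n) < e" using C_nonneg by (simp add: field_simps)
      moreover have "\<bar>X i z - X n z\<bar> \<le> C * sqrt (F i n)" unfolding F_def by (rule form_eval[OF XX])
      moreover have "0 \<le> sqrt (F i n)" using F0 by simp
      moreover have "(C + 1) * sqrt (F i n) = C * sqrt (F i n) + sqrt (F i n)" by (simp add: algebra_simps)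
      ultimately show ?thesis unfolding dist_real_def by linarith
    qed
    then show "\<exists>Ma. \<forall>x\<in>UNIV. \<forall>m\<ge>Ma. \<forall>n\<ge>Ma. dist (X m x) (X n x) < e" by blast
  qed
  then obtain u where unif: "uniform_limit UNIV X u sequentially" by (auto simp: uniformly_convergent_on_def)
  have ptw: "(\<lambda>n. X n z) \<longlonglongrightarrow> u z" for z using tendsto_uniform_limitI[OF unif] by simp
  have cont: "continuous_on ({0..pi} \<times> {-l..l}) u"
    by (rule uniform_limit_theorem[OF always_eventually uniform_limit_on_subset[OF unif subset_UNIV]])
      (rule allI, rule H2_star_cont[OF X l], simp)
  have out: "u z = 0" if "z \<notin> {0..pi} \<times> {-l..l}" for z
    using ptw[of z] H2_star_outside[OF X l that] by (simp add: LIMSEQ_const_iff)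
  have sides: "u (x, y) = 0" if "x \<in> {0, pi}" "y \<in> {-l<..<l}" for x y
    using ptw[of "(x, y)"] H2_star_sides[OF X l that(1), of y] that(2) by (simp add: LIMSEQ_const_iff)
  interpret finite_measure M by (rule finite_measure_plate)
  have [measurable]: "X n \<in> borel_measurable M" for n using L2(1)[of n] by (simp add: lp2_iff)
  have uM [measurable]: "u \<in> borel_measurable M" by (rule borel_measurable_LIMSEQ_real[OF ptw]) simp
  obtain Bu where Bu: "\<And>z. \<bar>u z\<bar> \<le> Bu"
  proof -
    have "bounded (u ` ({0..pi} \<times> {-l..l}))"
      by (intro compact_imp_bounded compact_continuous_image cont compact_Times) auto
    then obtain B where B: "\<forall>y\<in>u ` ({0..pi} \<times> {-l..l}). norm y \<le> B" unfolding bounded_iff by blast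
    have "\<bar>u z\<bar> \<le> max B 0" for z
    proof (cases "z \<in> {0..pi} \<times> {-l..l}")
      case True
      then have "\<bar>u z\<bar> \<le> B" using B by auto
      then show ?thesis by simp
    qed (use out in auto)
    then show ?thesis by (rule that)
  qed
  have uL2: "u \<in> lp_space M 2"
    unfolding lp2_iff
  proof
    show "integrable M (\<lambda>z. (u z)\<^sup>2)"
      by (rule integrable_const_bound[of _ "Bu\<^sup>2"]) (auto intro!: AE_I2 power_mono[of "\<bar>u _\<bar>" Bu 2, simplified] Bu)
  qed simp
  have u1: "(\<lambda>n. LINT z|M. \<bar>X n z - u z\<bar>) \<longlonglongrightarrow> 0"
  proof (rule LIMSEQ_I)
    fix e :: real assume e: "e > 0"
    define a where "a = measure M (space M)"
    have a: "0 \<le> a" by (simp add: a_def)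
    have "e / (a + 1) > 0" using e a by simp
    from uniform_limitD[OF unif this] obtain N where N: "\<And>n z. n \<ge> N \<Longrightarrow> \<bar>X n z - u z\<bar> < e / (a + 1)"
      by (auto simp: eventually_sequentially dist_real_def)
    have "norm ((LINT z|M. \<bar>X n z - u z\<bar>) - 0) < e" if "n \<ge> N" for n
    proof -
      have "(LINT z|M. \<bar>X n z - u z\<bar>) \<le> (LINT z|M. e / (a + 1))"
        by (rule integral_mono) (use N[OF that] lp2_integrable[OF finite_measure_plate L2(1)] lp2_integrable[OF finite_measure_plate uL2] in \<open>auto intro: less_imp_le\<close>)
      also have "\<dots> = a * (e / (a + 1))" by (simp add: a_def)
      also have "\<dots> < e" using e a by (simp add: field_simps)
      finally show ?thesis by simp
    qed
    then show "\<exists>N. \<forall>n\<ge>N. norm ((LINT z|M. \<bar>X n z - u z\<bar>) - 0) < e" by blast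
  qed
  note I = lp2_integrable[OF finite_measure_plate]
  note g1 = L1_tendsto[OF L2(2) g0] and q1 = L1_tendsto[OF L2(3) q0] and k1 = L1_tendsto[OF L2(4) k0]
    and h1 = L1_tendsto[OF L2(5) h0] and m1 = L1_tendsto[OF L2(6) m0]
  have B: "(1, 0) \<in> (Basis :: (real \<times> real) set)" "(0, 1) \<in> (Basis :: (real \<times> real) set)" by (auto simp: Basis_real_prod)
  have w: "has_weak_partial (plate l) (1, 0) (X n) (g n)" "has_weak_partial (plate l) (0, 1) (X n) (q n)"
      "has_weak_partial (plate l) (1, 0) (g n) (k n)" "has_weak_partial (plate l) (0, 1) (g n) (h n)"
      "has_weak_partial (plate l) (1, 0) (q n) (h n)" "has_weak_partial (plate l) (0, 1) (q n) (m n)" for n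
    using j[of n] by (auto simp: jet_def)
  have ju: "jet l u g0 q0 k0 h0 m0"
    unfolding jet_def
    using uL2 g0(1) q0(1) k0(1) h0(1) m0(1)
      has_weak_partial_limit[OF w(1) B(1) I[OF L2(1)] I[OF L2(2)] I[OF uL2] I[OF g0(1)] u1 g1]
      has_weak_partial_limit[OF w(2) B(2) I[OF L2(1)] I[OF L2(3)] I[OF uL2] I[OF q0(1)] u1 q1]
      has_weak_partial_limit[OF w(3) B(1) I[OF L2(2)] I[OF L2(4)] I[OF g0(1)] I[OF k0(1)] g1 k1]
      has_weak_partial_limit[OF w(4) B(2) I[OF L2(2)] I[OF L2(5)] I[OF g0(1)] I[OF h0(1)] g1 h1]
      has_weak_partial_limit[OF w(5) B(1) I[OF L2(3)] I[OF L2(5)] I[OF q0(1)] I[OF h0(1)] q1 h1]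
      has_weak_partial_limit[OF w(6) B(2) I[OF L2(3)] I[OF L2(6)] I[OF q0(1)] I[OF m0(1)] q1 m1]
    by simp
  have uH: "u \<in> H2_star l" by (rule H2_starI[OF ju l cont out sides])
  have Xu: "(\<lambda>z. X n z - u z) \<in> H2_star l" for n using H2_star_comb[OF X[of n] uH l, of 1 "-1"] by simp
  have bound: "norm (form (\<lambda>z. X n z - u z) (\<lambda>z. X n z - u z)) \<le>
      2 * W * ((LINT z|M. (k n z - k0 z)\<^sup>2) + (LINT z|M. (h n z - h0 z)\<^sup>2) + (LINT z|M. (m n z - m0 z)\<^sup>2))" for n
    using form_coercive(2)[OF jet_comb[OF j[of n] ju, of 1 "-1"]] form_nonneg[OF Xu[of n]] by simp
  have "(\<lambda>n. 2 * W * ((LINT z|M. (k n z - k0 z)\<^sup>2) + (LINT z|M. (h n z - h0 z)\<^sup>2) + (LINT z|M. (m n z - m0 z)\<^sup>2))) \<longlonglongrightarrow> 2 * W * (0 + 0 + 0)"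
    by (intro tendsto_intros k0 h0 m0)
  then have "(\<lambda>n. form (\<lambda>z. X n z - u z) (\<lambda>z. X n z - u z)) \<longlonglongrightarrow> 0"
    by (intro Lim_null_comparison[OF always_eventually[OF allI[OF bound]]]) simp
  with uH show ?thesis by blast
qed

sublocale form_space "H2_star l" form C
proof
  show "(\<lambda>z. 0) \<in> H2_star l" by (rule H2_star_zero[OF l])
next
  show "(\<lambda>z. s * u z + t * v z) \<in> H2_star l" if "u \<in> H2_star l" "v \<in> H2_star l" for u v s t
    using that l by (rule H2_star_comb)
next
  fix X :: "nat \<Rightarrow> real \<times> real \<Rightarrow> real" assume "\<And>n. X n \<in> H2_star l"
    and "\<And>e. e > 0 \<Longrightarrow> \<exists>N. \<forall>m\<ge>N. \<forall>n\<ge>N. form (\<lambda>z. X m z - X n z) (\<lambda>z. X m z - X n z) < e"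
  then show "\<exists>u\<in>H2_star l. (\<lambda>n. form (\<lambda>z. X n z - u z) (\<lambda>z. X n z - u z)) \<longlonglongrightarrow> 0"
    by (rule form_complete)
next
  show "form u v = form v u" for u v by (rule form_sym)
qed (simp_all add: form_lin form_nonneg form_eval)

end

section \<open>Reflection in the x-axis\<close>

definition reflect :: "real \<times> real \<Rightarrow> real \<times> real" where "reflect z = (fst z, - snd z)"

lemma reflect_simps [simp]: "reflect (reflect z) = z" "fst (reflect z) = fst z" "snd (reflect z) = - snd z"
    "reflect z \<in> plate l \<longleftrightarrow> z \<in> plate l" "reflect z \<in> A \<times> {-l..l} \<longleftrightarrow> z \<in> A \<times> {-l..l}"
  by (auto simp: reflect_def plate_def mem_Times_iff)

lemma
  shows reflect_lebesgue_measurable: "reflect \<in> lebesgue \<rightarrow>\<^sub>M lebesgue"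
    and distr_reflect_lebesgue: "distr lebesgue lebesgue reflect = lebesgue"
proof -
  \<comment> \<open>The reflection is the diagonal map with entries 1 and -1, so its Jacobian has
    absolute value 1.\<close>
  define c :: "real \<times> real \<Rightarrow> real" where "c j = (if j = (0, 1) then -1 else 1)" for j
  have T: "(\<lambda>x. 0 + (\<Sum>j\<in>Basis. (c j * (x \<bullet> j)) *\<^sub>R j)) = reflect"
    by (auto simp: fun_eq_iff Basis_real_prod c_def reflect_def)
  have nz: "\<And>j. j \<in> Basis \<Longrightarrow> c j \<noteq> 0" by (auto simp: c_def)
  have p: "(\<Prod>j\<in>Basis. \<bar>c j\<bar>) = 1" by (rule prod.neutral) (auto simp: c_def)
  show "reflect \<in> lebesgue \<rightarrow>\<^sub>M lebesgue" using lebesgue_affine_measurable[of c 0] nz unfolding T by blast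
  have "lebesgue = density (distr lebesgue lebesgue reflect) (\<lambda>_. ennreal (\<Prod>j\<in>Basis. \<bar>c j\<bar>))"
    using lebesgue_affine_euclidean[of c 0] nz unfolding T by blast
  then show "distr lebesgue lebesgue reflect = lebesgue" unfolding p by (simp add: density_1)
qed

lemma
  fixes f :: "real \<times> real \<Rightarrow> real"
  assumes f: "f \<in> borel_measurable (lebesgue_on (plate l))"
  shows measurable_reflect: "(\<lambda>z. f (reflect z)) \<in> borel_measurable (lebesgue_on (plate l))"
    and integral_reflect_plate: "(LINT z|lebesgue_on (plate l). f (reflect z)) = (LINT z|lebesgue_on (plate l). f z)"
    and integrable_reflect: "integrable (lebesgue_on (plate l)) f \<Longrightarrow> integrable (lebesgue_on (plate l)) (\<lambda>z. f (reflect z))"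
proof -
  define F where "F z = indicator (plate l) z *\<^sub>R f z" for z
  have F: "F \<in> borel_measurable lebesgue" unfolding F_def
    using f by (subst (asm) borel_measurable_restrict_space_iff) auto
  have FR: "F (reflect z) = indicator (plate l) z *\<^sub>R f (reflect z)" for z by (simp add: F_def indicator_def)
  have "(\<lambda>z. F (reflect z)) \<in> borel_measurable lebesgue" by (rule measurable_compose[OF reflect_lebesgue_measurable F])
  then show "(\<lambda>z. f (reflect z)) \<in> borel_measurable (lebesgue_on (plate l))"
    unfolding FR by (subst borel_measurable_restrict_space_iff) auto
  have "(LINT z|lebesgue. F (reflect z)) = (LINT z|distr lebesgue lebesgue reflect. F z)"
    by (rule integral_distr[symmetric, OF reflect_lebesgue_measurable F])
  then show "(LINT z|lebesgue_on (plate l). f (reflect z)) = (LINT z|lebesgue_on (plate l). f z)"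
    unfolding distr_reflect_lebesgue FR by (simp add: integral_plate_eq F_def)
  assume "integrable (lebesgue_on (plate l)) f"
  then have "integrable lebesgue F" by (simp add: integrable_plate_iff F_def[abs_def])
  then have "integrable (distr lebesgue lebesgue reflect) F" unfolding distr_reflect_lebesgue .
  then have "integrable lebesgue (\<lambda>z. F (reflect z))" by (rule integrable_distr[OF reflect_lebesgue_measurable])
  then show "integrable (lebesgue_on (plate l)) (\<lambda>z. f (reflect z))" by (simp add: integrable_plate_iff FR)
qed

lemma lp2_reflect: "f \<in> lp_space (lebesgue_on (plate l)) 2 \<Longrightarrow> (\<lambda>z. f (reflect z)) \<in> lp_space (lebesgue_on (plate l)) 2"
  using measurable_reflect[of f l] integrable_reflect[of "\<lambda>z. (f z)\<^sup>2" l] by (simp add: lp2_iff)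

lemma frechet_derivative_reflect:
  fixes \<phi> :: "real \<times> real \<Rightarrow> real"
  assumes "\<phi> differentiable (at (reflect z))"
  shows "((\<lambda>z. c * \<phi> (reflect z)) has_derivative (\<lambda>h. c * frechet_derivative \<phi> (at (reflect z)) (reflect h))) (at z)"
proof -
  have r: "(reflect has_derivative reflect) (at z)"
    unfolding reflect_def[abs_def] by (auto intro!: derivative_eq_intros)
  have "(\<phi> has_derivative frechet_derivative \<phi> (at (reflect z))) (at (reflect z))"
    using assms by (simp add: frechet_derivative_works)
  from has_derivative_mult_right[OF has_derivative_compose[OF r this]] show ?thesis .
qed

lemma frechet_derivative_reflect_Basis:
  fixes \<phi> :: "real \<times> real \<Rightarrow> real"
  assumes "\<phi> differentiable (at (reflect z))"
  shows "frechet_derivative (\<lambda>z. c * \<phi> (reflect z)) (at z) (1, 0) = c * frechet_derivative \<phi> (at (reflect z)) (1, 0)"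
    and "frechet_derivative (\<lambda>z. c * \<phi> (reflect z)) (at z) (0, 1) = - c * frechet_derivative \<phi> (at (reflect z)) (0, 1)"
proof -
  have "linear (frechet_derivative \<phi> (at (reflect z)))" by (rule linear_frechet_derivative[OF assms])
  then have "frechet_derivative \<phi> (at (reflect z)) (- (0, 1)) = - frechet_derivative \<phi> (at (reflect z)) (0, 1)"
    by (rule linear_neg)
  then show "frechet_derivative (\<lambda>z. c * \<phi> (reflect z)) (at z) (1, 0) = c * frechet_derivative \<phi> (at (reflect z)) (1, 0)"
    "frechet_derivative (\<lambda>z. c * \<phi> (reflect z)) (at z) (0, 1) = - c * frechet_derivative \<phi> (at (reflect z)) (0, 1)"
    unfolding frechet_derivative_at[OF frechet_derivative_reflect[OF assms], symmetric] by (simp_all add: reflect_def)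
qed

text \<open>The factor \<open>c\<close> is there for the induction: the y-derivative of a reflected
  function is a reflected function with the opposite sign.\<close>

lemma times_cont_differentiable_reflect:
  "times_cont_differentiable k \<phi> \<Longrightarrow> times_cont_differentiable k (\<lambda>z. c * \<phi> (reflect z))"
proof (induction k arbitrary: \<phi> c)
  case 0
  have "continuous_on UNIV reflect" unfolding reflect_def[abs_def] by (intro continuous_intros)
  then have "continuous_on UNIV (\<lambda>z. \<phi> (reflect z))"
    using 0 by (intro continuous_on_compose2[of UNIV \<phi> UNIV reflect]) auto
  then show ?case by (auto intro!: continuous_intros)
next
  case (Suc k)
  then have d: "\<phi> differentiable (at (reflect z))" for z
    unfolding times_cont_differentiable.simps(2) by blast
  have "(\<lambda>z. c * \<phi> (reflect z)) differentiable (at z)" for z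
    using frechet_derivative_reflect[OF d] unfolding differentiable_def by blast
  moreover have "times_cont_differentiable k (\<lambda>z. c * frechet_derivative \<phi> (at (reflect z)) (1, 0))"
    "times_cont_differentiable k (\<lambda>z. (- c) * frechet_derivative \<phi> (at (reflect z)) (0, 1))"
    using Suc.prems by (intro Suc.IH; simp add: Basis_real_prod)+
  ultimately show ?case by (simp add: Basis_real_prod frechet_derivative_reflect_Basis[OF d])
qed

lemma test_function_reflect:
  assumes \<phi>: "\<phi> \<in> test_functions (plate l)"
  shows "(\<lambda>z. \<phi> (reflect z)) \<in> test_functions (plate l)"
proof -
  obtain K where K: "compact K" "K \<subseteq> plate l" "\<And>z. z \<notin> K \<Longrightarrow> \<phi> z = 0" using \<phi> by (auto simp: test_functions_def)
  have "compact (reflect ` K)"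
    by (intro compact_continuous_image K) (simp add: reflect_def[abs_def] continuous_intros)
  moreover have "reflect ` K \<subseteq> plate l" using K(2) by auto
  moreover have "\<phi> (reflect z) = 0" if "z \<notin> reflect ` K" for z
    using that K(3)[of "reflect z"] by (metis imageI reflect_simps(1))
  moreover have "times_cont_differentiable k (\<lambda>z. \<phi> (reflect z))" for k
    using times_cont_differentiable_reflect[of k \<phi> 1] \<phi> by (simp add: test_functions_def)
  ultimately show ?thesis unfolding test_functions_def by blast
qed

text \<open>A change of variables moves the reflection onto the test function, whose y-derivative
  then changes sign.\<close>

lemma has_weak_partial_reflect:
  assumes i: "integrable (lebesgue_on (plate l)) u" "integrable (lebesgue_on (plate l)) g"
  shows "has_weak_partial (plate l) (1, 0) u g \<Longrightarrow> has_weak_partial (plate l) (1, 0) (\<lambda>z. u (reflect z)) (\<lambda>z. g (reflect z))"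
    and "has_weak_partial (plate l) (0, 1) u g \<Longrightarrow> has_weak_partial (plate l) (0, 1) (\<lambda>z. u (reflect z)) (\<lambda>z. - g (reflect z))"
proof -
  have B: "(1, 0) \<in> (Basis :: (real \<times> real) set)" "(0, 1) \<in> (Basis :: (real \<times> real) set)" by (auto simp: Basis_real_prod)
  have ir: "integrable (lebesgue_on (plate l)) (\<lambda>z. u (reflect z))" "integrable (lebesgue_on (plate l)) (\<lambda>z. g (reflect z))"
    using i by (auto intro: integrable_reflect)
  \<comment> \<open>One computation for both directions: \<open>s\<close> is the sign, 1 for x and
    -1 for y.\<close>
  have *: "(LINT z|lebesgue_on (plate l). u (reflect z) * frechet_derivative \<phi> (at z) e) =
      - (LINT z|lebesgue_on (plate l). s * g (reflect z) * \<phi> z)"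
    if w: "has_weak_partial (plate l) e u g" and \<phi>: "\<phi> \<in> test_functions (plate l)" and e: "e \<in> Basis"
      and s: "\<And>z. frechet_derivative (\<lambda>z. \<phi> (reflect z)) (at z) e = s * frechet_derivative \<phi> (at (reflect z)) e" "s * s = 1"
    for \<phi> e and s :: real
  proof -
    define \<psi> where "\<psi> z = \<phi> (reflect z)" for z
    have \<psi>: "\<psi> \<in> test_functions (plate l)" unfolding \<psi>_def by (rule test_function_reflect[OF \<phi>])
    have d: "frechet_derivative \<phi> (at z) e = s * frechet_derivative \<psi> (at (reflect z)) e" for z
      using s(1)[of "reflect z"] s(2) by (simp add: \<psi>_def[abs_def] mult.assoc[symmetric])
    have "(LINT z|lebesgue_on (plate l). u (reflect z) * frechet_derivative \<phi> (at z) e) =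
        s * (LINT z|lebesgue_on (plate l). u (reflect z) * frechet_derivative \<psi> (at (reflect z)) e)"
      by (simp add: d mult.left_commute)
    also have "\<dots> = s * (LINT z|lebesgue_on (plate l). u z * frechet_derivative \<psi> (at z) e)"
      using integral_reflect_plate[OF borel_measurable_integrable[OF test_function_integrable(2)[OF \<psi> e i(1)]]] by simp
    also have "\<dots> = - (s * (LINT z|lebesgue_on (plate l). g z * \<psi> z))"
      using w \<psi> by (simp add: has_weak_partial_def)
    also have "(LINT z|lebesgue_on (plate l). g z * \<psi> z) = (LINT z|lebesgue_on (plate l). g (reflect z) * \<psi> (reflect z))"
      using integral_reflect_plate[OF borel_measurable_integrable[OF test_function_integrable(1)[OF \<psi> e i(2)]]] by simp
    finally show ?thesis by (simp add: \<psi>_def mult.assoc)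
  qed
  have dif: "\<phi> differentiable (at z)" if "\<phi> \<in> test_functions (plate l)" for \<phi> z
  proof -
    have "times_cont_differentiable (Suc 0) \<phi>" using that unfolding test_functions_def by blast
    then show ?thesis unfolding times_cont_differentiable.simps(2) by blast
  qed
  show "has_weak_partial (plate l) (1, 0) (\<lambda>z. u (reflect z)) (\<lambda>z. g (reflect z))" if w: "has_weak_partial (plate l) (1, 0) u g"
    unfolding has_weak_partial_def
  proof (intro conjI ballI locally_integrableI ir)
    fix \<phi> assume \<phi>: "\<phi> \<in> test_functions (plate l)"
    show "(LINT z|lebesgue_on (plate l). u (reflect z) * frechet_derivative \<phi> (at z) (1, 0)) = - (LINT z|lebesgue_on (plate l). g (reflect z) * \<phi> z)"
      using *[OF w \<phi> B(1), of 1] frechet_derivative_reflect_Basis(1)[OF dif[OF \<phi>], of 1] by simp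
  qed
  show "has_weak_partial (plate l) (0, 1) (\<lambda>z. u (reflect z)) (\<lambda>z. - g (reflect z))" if w: "has_weak_partial (plate l) (0, 1) u g"
    unfolding has_weak_partial_def
  proof (intro conjI ballI locally_integrableI ir)
    show "integrable (lebesgue_on (plate l)) (\<lambda>z. - g (reflect z))" using ir by simp
    fix \<phi> assume \<phi>: "\<phi> \<in> test_functions (plate l)"
    show "(LINT z|lebesgue_on (plate l). u (reflect z) * frechet_derivative \<phi> (at z) (0, 1)) = - (LINT z|lebesgue_on (plate l). - g (reflect z) * \<phi> z)"
      using *[OF w \<phi> B(2), of "-1"] frechet_derivative_reflect_Basis(2)[OF dif[OF \<phi>], of 1] by simp
  qed
qed

lemma has_weak_partial_uminus:
  assumes "has_weak_partial (plate l) e u g"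
  shows "has_weak_partial (plate l) e (\<lambda>z. - u z) (\<lambda>z. - g z)"
proof -
  have "locally_integrable (plate l) (\<lambda>z. - f z)" if "locally_integrable (plate l) f" for f
    using that by (simp add: locally_integrable_def)
  then show ?thesis using assms by (simp add: has_weak_partial_def)
qed

lemma jet_reflect:
  assumes j: "jet l u g q k h m"
  shows "jet l (\<lambda>z. u (reflect z)) (\<lambda>z. g (reflect z)) (\<lambda>z. - q (reflect z))
    (\<lambda>z. k (reflect z)) (\<lambda>z. - h (reflect z)) (\<lambda>z. m (reflect z))"
proof -
  have L: "u \<in> lp_space (lebesgue_on (plate l)) 2" "g \<in> lp_space (lebesgue_on (plate l)) 2" "q \<in> lp_space (lebesgue_on (plate l)) 2"
    "k \<in> lp_space (lebesgue_on (plate l)) 2" "h \<in> lp_space (lebesgue_on (plate l)) 2" "m \<in> lp_space (lebesgue_on (plate l)) 2"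
    using j by (auto simp: jet_def)
  have neg: "(\<lambda>z. - f z) \<in> lp_space (lebesgue_on (plate l)) 2" if "f \<in> lp_space (lebesgue_on (plate l)) 2" for f
    using that by (simp add: lp2_iff)
  note I = L[THEN lp2_integrable[OF finite_measure_plate]]
  have w: "has_weak_partial (plate l) (1, 0) u g" "has_weak_partial (plate l) (0, 1) u q"
      "has_weak_partial (plate l) (1, 0) g k" "has_weak_partial (plate l) (0, 1) g h"
      "has_weak_partial (plate l) (1, 0) q h" "has_weak_partial (plate l) (0, 1) q m"
    using j by (auto simp: jet_def)
  show ?thesis
    unfolding jet_def
    using has_weak_partial_reflect(1)[OF I(1,2) w(1)] has_weak_partial_reflect(2)[OF I(1,3) w(2)]
      has_weak_partial_reflect(1)[OF I(2,4) w(3)] has_weak_partial_reflect(2)[OF I(2,5) w(4)]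
      has_weak_partial_uminus[OF has_weak_partial_reflect(1)[OF I(3,5) w(5)]]
      has_weak_partial_uminus[OF has_weak_partial_reflect(2)[OF I(3,6) w(6)]]
      L[THEN lp2_reflect] neg[OF lp2_reflect[OF L(3)]] neg[OF lp2_reflect[OF L(5)]]
    by simp
qed

lemma H2_star_reflect:
  assumes u: "u \<in> H2_star l" and l: "l > 0"
  shows "(\<lambda>z. u (reflect z)) \<in> H2_star l"
proof -
  obtain g q where "jet l u g q (D_xx l u) (D_xy l u) (D_yy l u)" using H2_star_jet[OF u] by blast
  from jet_reflect[OF this] l show ?thesis
  proof (rule H2_starI)
    show "continuous_on ({0..pi} \<times> {-l..l}) (\<lambda>z. u (reflect z))"
      by (rule continuous_on_compose2[OF H2_star_cont[OF u l]])
        (auto simp: reflect_def intro!: continuous_intros)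
    show "u (reflect z) = 0" if "z \<notin> {0..pi} \<times> {-l..l}" for z
      using H2_star_outside[OF u l, of "reflect z"] that by simp
    show "u (reflect (x, y)) = 0" if "x \<in> {0, pi}" "y \<in> {-l<..<l}" for x y
      using H2_star_sides[OF u l, of x "-y"] that by (simp add: reflect_def)
  qed
qed

context weighted_plate begin

text \<open>Among the second derivatives only the mixed one changes sign under reflection, and
  \<open>bend\<close> contains it only in the product of the mixed derivatives of both
  arguments.\<close>

lemma form_reflect:
  assumes even: "\<And>z. z \<in> plate l \<Longrightarrow> \<omega> (reflect z) = \<omega> z"
    and u: "u \<in> H2_star l" and v: "v \<in> H2_star l"
  shows "form (\<lambda>z. u (reflect z)) (\<lambda>z. v (reflect z)) = form u v"
proof -
  obtain g q g' q' where j: "jet l u g q (D_xx l u) (D_xy l u) (D_yy l u)" "jet l v g' q' (D_xx l v) (D_xy l v) (D_yy l v)"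
    using H2_star_jet[OF u] H2_star_jet[OF v] by blast
  let ?f = "\<lambda>z. \<omega> z * bend \<sigma> (D_xx l u z) (D_xy l u z) (D_yy l u z) (D_xx l v z) (D_xy l v z) (D_yy l v z)"
  have i: "integrable M ?f" using jet_L2[OF j(1)] jet_L2[OF j(2)] by (intro integrable_bend) auto
  have "form (\<lambda>z. u (reflect z)) (\<lambda>z. v (reflect z)) = (LINT z|M. ?f (reflect z))"
    unfolding form_jet[OF jet_reflect[OF j(1)] jet_reflect[OF j(2)]]
    by (intro Bochner_Integration.integral_cong) (auto simp: bend_def even)
  also have "\<dots> = form u v"
    unfolding form_def using integral_reflect_plate[of ?f l] i by auto
  finally show ?thesis .
qed

end

section \<open>A function with nonzero gap\<close>

lemma test_function_sections:
  fixes \<phi> :: "real \<times> real \<Rightarrow> real"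
  assumes "\<phi> \<in> test_functions S"
  shows "((\<lambda>x. \<phi> (x, y)) has_real_derivative frechet_derivative \<phi> (at (x, y)) (1, 0)) (at x)"
    and "((\<lambda>y. \<phi> (x, y)) has_real_derivative frechet_derivative \<phi> (at (x, y)) (0, 1)) (at y)"
proof -
  have "times_cont_differentiable (Suc 0) \<phi>" using assms unfolding test_functions_def by blast
  then have d: "\<phi> differentiable (at (x, y))" unfolding times_cont_differentiable.simps(2) by blast
  then have D: "(\<phi> has_derivative frechet_derivative \<phi> (at (x, y))) (at (x, y))"
    by (simp add: frechet_derivative_works)
  have lin: "linear (frechet_derivative \<phi> (at (x, y)))" by (rule linear_frechet_derivative[OF d])
  have "((\<lambda>x. (x, y)) has_derivative (\<lambda>h. (h, 0))) (at x)" by (auto intro!: derivative_eq_intros)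
  from has_derivative_compose[OF this D]
  have "((\<lambda>x. \<phi> (x, y)) has_derivative (\<lambda>h. frechet_derivative \<phi> (at (x, y)) (h *\<^sub>R (1, 0)))) (at x)" by simp
  then show "((\<lambda>x. \<phi> (x, y)) has_real_derivative frechet_derivative \<phi> (at (x, y)) (1, 0)) (at x)"
    unfolding linear_scale[OF lin] has_field_derivative_def by (simp add: mult_commute_abs)
  have "((\<lambda>y. (x, y)) has_derivative (\<lambda>h. (0, h))) (at y)" by (auto intro!: derivative_eq_intros)
  from has_derivative_compose[OF this D]
  have "((\<lambda>y. \<phi> (x, y)) has_derivative (\<lambda>h. frechet_derivative \<phi> (at (x, y)) (h *\<^sub>R (0, 1)))) (at y)" by simp
  then show "((\<lambda>y. \<phi> (x, y)) has_real_derivative frechet_derivative \<phi> (at (x, y)) (0, 1)) (at y)"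
    unfolding linear_scale[OF lin] has_field_derivative_def by (simp add: mult_commute_abs)
qed

lemma integral_derivative_zero:
  fixes F f :: "real \<Rightarrow> real"
  assumes "\<And>x. (F has_real_derivative f x) (at x)" "continuous_on UNIV f"
    and out: "\<And>x. R \<le> \<bar>x\<bar> \<Longrightarrow> F x = 0 \<and> f x = 0" and R: "0 < R"
  shows "(LINT x|lborel. f x) = 0"
proof -
  have "(LINT x|lborel. indicator {-R..R} x *\<^sub>R f x) = F R - F (-R)"
    using R by (intro integral_FTC_Icc continuous_on_subset[OF assms(2)])
      (auto simp: has_real_derivative_iff_has_vector_derivative[symmetric] intro: has_field_derivative_at_within assms(1))
  moreover have "indicator {-R..R} x *\<^sub>R f x = f x" for x using out[of x] by (cases "\<bar>x\<bar> \<le> R") (auto simp: indicator_def abs_le_iff)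
  ultimately have "(LINT x|lborel. f x) = F R - F (-R)" by (simp only:)
  then show ?thesis using out[of R] out[of "-R"] R by simp
qed

lemma continuous_integrable_plate:
  fixes f :: "real \<times> real \<Rightarrow> real"
  assumes f: "continuous_on UNIV f"
  shows "integrable (lebesgue_on (plate l)) f"
proof -
  have "continuous_on (cbox (0, -l) (pi, l)) f" by (rule continuous_on_subset[OF f]) simp
  from borel_integrable_compact[OF compact_cbox this]
  have i: "integrable lborel (\<lambda>z. indicator (cbox (0, -l) (pi, l)) z *\<^sub>R f z)" .
  then have "integrable lborel (\<lambda>z. indicator (plate l) z * (indicator (cbox (0, -l) (pi, l)) z *\<^sub>R f z))"
    by (rule integrable_indicator_mult) simp
  also have "(\<lambda>z. indicator (plate l) z * (indicator (cbox (0, -l) (pi, l)) z *\<^sub>R f z)) = (\<lambda>z. indicator (plate l) z * f z)"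
    using box_subset_cbox[of "(0, -l)" "(pi, l)"] by (auto simp: fun_eq_iff plate_eq_box indicator_def)
  finally have "integrable lborel (\<lambda>z. indicator (plate l) z * f z)" .
  then show ?thesis unfolding integrable_plate_iff by (subst integrable_completion) auto
qed

lemma continuous_lp2: "continuous_on UNIV f \<Longrightarrow> f \<in> lp_space (lebesgue_on (plate l)) 2" for f :: "real \<times> real \<Rightarrow> real"
  unfolding lp2_iff by (intro conjI continuous_measurable_plate continuous_integrable_plate continuous_intros)

text \<open>The derivative of v \<phi> integrates to zero along every line in the direction of
  differentiation, because \<phi> has bounded support; Fubini's theorem does the rest.\<close>

lemma has_weak_partial_classical:
  fixes a a' b b' :: "real \<Rightarrow> real"
  assumes a: "\<And>x. (a has_real_derivative a' x) (at x)" "continuous_on UNIV a'"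
    and b: "\<And>x. (b has_real_derivative b' x) (at x)" "continuous_on UNIV b'"
  shows "has_weak_partial (plate l) (1, 0) (\<lambda>z. a (fst z) * b (snd z)) (\<lambda>z. a' (fst z) * b (snd z))"
    and "has_weak_partial (plate l) (0, 1) (\<lambda>z. a (fst z) * b (snd z)) (\<lambda>z. a (fst z) * b' (snd z))"
proof -
  have ca: "continuous_on UNIV a" "continuous_on UNIV b"
    using a(1) b(1) by (auto intro: DERIV_continuous_on has_field_derivative_at_within)
  have c2: "continuous_on UNIV (\<lambda>z::real \<times> real. f (fst z) * g (snd z))"
    if "continuous_on UNIV f" "continuous_on UNIV g" for f g :: "real \<Rightarrow> real"
    by (intro continuous_intros continuous_on_compose2[OF that(1)] continuous_on_compose2[OF that(2)]) auto
  \<comment> \<open>The disjunction in \<open>zero\<close> lets the lines run in either direction,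
    so that the measure-theoretic part is done once.\<close>
  have key: "(LINT z|lebesgue_on (plate l). v z * frechet_derivative \<phi> (at z) e) = - (LINT z|lebesgue_on (plate l). v' z * \<phi> z)"
    if \<phi>: "\<phi> \<in> test_functions (plate l)" and e: "e \<in> Basis" and v: "continuous_on UNIV v" "continuous_on UNIV v'"
      and zero: "\<And>R. R > 0 \<Longrightarrow> (\<And>z. R \<le> \<bar>fst z\<bar> \<or> R \<le> \<bar>snd z\<bar> \<Longrightarrow> \<phi> z = 0 \<and> frechet_derivative \<phi> (at z) e = 0) \<Longrightarrow>
        (\<forall>y. (LINT x|lborel. v (x, y) * frechet_derivative \<phi> (at (x, y)) e + v' (x, y) * \<phi> (x, y)) = 0) \<or>
        (\<forall>x. (LINT y|lborel. v (x, y) * frechet_derivative \<phi> (at (x, y)) e + v' (x, y) * \<phi> (x, y)) = 0)"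
    for \<phi> e v v'
  proof -
    note c = test_function_bounds(1,2)[OF \<phi> e]
    obtain K where K: "compact K" "K \<subseteq> plate l" "\<And>z. z \<notin> K \<Longrightarrow> \<phi> z = 0 \<and> frechet_derivative \<phi> (at z) e = 0"
      using test_function_bounds(3)[OF \<phi> e] by blast
    define W where "W z = v z * frechet_derivative \<phi> (at z) e + v' z * \<phi> z" for z
    have cW: "continuous_on UNIV W" unfolding W_def by (intro continuous_intros v c)
    have "(\<lambda>z. indicator K z *\<^sub>R W z) = W" using K(3) by (auto simp: fun_eq_iff indicator_def W_def)
    then have iW: "integrable lborel W" using borel_integrable_compact[OF K(1) continuous_on_subset[OF cW subset_UNIV]] by simp
    obtain R where R: "R > 0" "\<And>z. z \<in> K \<Longrightarrow> norm z < R"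
      using compact_imp_bounded[OF K(1)] unfolding bounded_pos_less by blast
    have "\<phi> z = 0 \<and> frechet_derivative \<phi> (at z) e = 0" if "R \<le> \<bar>fst z\<bar> \<or> R \<le> \<bar>snd z\<bar>" for z
    proof (rule K(3))
      have "\<bar>fst z\<bar> \<le> norm z" "\<bar>snd z\<bar> \<le> norm z"
        using norm_fst_le[of "fst z" "snd z"] norm_snd_le[of "snd z" "fst z"] by simp_all
      then show "z \<notin> K" using R(2)[of z] that by auto
    qed
    from zero[OF R(1) this]
    have "(LINT z|lborel. W z) = 0"
      using lborel2_integral_x[OF iW] lborel2_integral_y[OF iW] unfolding W_def by auto
    moreover have "(LINT z|lebesgue_on (plate l). W z) = (LINT z|lebesgue. W z)"
    proof -
      have "indicator (plate l) z * W z = W z" for z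
      proof (cases "z \<in> plate l")
        case False
        then have "z \<notin> K" using K(2) by blast
        from K(3)[OF this] show ?thesis by (simp add: W_def)
      qed simp
      then show ?thesis by (simp only: integral_plate_eq)
    qed
    moreover have "(LINT z|lebesgue. W z) = (LINT z|lborel. W z)"
      by (rule integral_completion) (use iW in auto)
    moreover have "(LINT z|lebesgue_on (plate l). W z) =
        (LINT z|lebesgue_on (plate l). v z * frechet_derivative \<phi> (at z) e) + (LINT z|lebesgue_on (plate l). v' z * \<phi> z)"
      unfolding W_def
      using test_function_integrable(2)[OF \<phi> e continuous_integrable_plate[OF v(1)]]
        test_function_integrable(1)[OF \<phi> e continuous_integrable_plate[OF v(2)]] by simp
    ultimately show ?thesis by simp
  qed
  have B: "(1, 0) \<in> (Basis :: (real \<times> real) set)" "(0, 1) \<in> (Basis :: (real \<times> real) set)" by (auto simp: Basis_real_prod)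
  have sec: "continuous_on UNIV (\<lambda>x. f (x, y))" "continuous_on UNIV (\<lambda>y. f (x, y))"
    if "continuous_on UNIV f" for f :: "real \<times> real \<Rightarrow> real" and x y
    by (rule continuous_on_compose2[OF that]; auto intro!: continuous_intros)+
  show "has_weak_partial (plate l) (1, 0) (\<lambda>z. a (fst z) * b (snd z)) (\<lambda>z. a' (fst z) * b (snd z))"
    unfolding has_weak_partial_def
  proof (intro conjI ballI locally_integrableI continuous_integrable_plate c2 ca a b)
    fix \<phi> assume \<phi>: "\<phi> \<in> test_functions (plate l)"
    note c = test_function_bounds(1,2)[OF \<phi> B(1)]
    show "(LINT z|lebesgue_on (plate l). a (fst z) * b (snd z) * frechet_derivative \<phi> (at z) (1, 0)) =
        - (LINT z|lebesgue_on (plate l). a' (fst z) * b (snd z) * \<phi> z)"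
    proof (rule key[OF \<phi> B(1) c2 c2], (intro ca a)+, intro disjI1 allI)
      fix R y assume R: "R > 0" and out: "\<And>z. R \<le> \<bar>fst z\<bar> \<or> R \<le> \<bar>snd z\<bar> \<Longrightarrow> \<phi> z = 0 \<and> frechet_derivative \<phi> (at z) (1, 0) = 0"
      show "(LINT x|lborel. a (fst (x, y)) * b (snd (x, y)) * frechet_derivative \<phi> (at (x, y)) (1, 0) +
          a' (fst (x, y)) * b (snd (x, y)) * \<phi> (x, y)) = 0"
      proof (rule integral_derivative_zero[where F = "\<lambda>x. a x * b y * \<phi> (x, y)", OF _ _ _ R])
        show "((\<lambda>x. a x * b y * \<phi> (x, y)) has_real_derivative a (fst (x, y)) * b (snd (x, y)) * frechet_derivative \<phi> (at (x, y)) (1, 0) +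
          a' (fst (x, y)) * b (snd (x, y)) * \<phi> (x, y)) (at x)" for x
          using a(1)[of x] test_function_sections(1)[OF \<phi>, of y x]
          by (auto intro!: derivative_eq_intros simp: algebra_simps)
        show "continuous_on UNIV (\<lambda>x. a (fst (x, y)) * b (snd (x, y)) * frechet_derivative \<phi> (at (x, y)) (1, 0) +
          a' (fst (x, y)) * b (snd (x, y)) * \<phi> (x, y))"
          by (simp, intro continuous_intros ca a sec(1)[OF c(1)] sec(1)[OF c(2)])
      qed (use out in auto)
    qed
  qed
  show "has_weak_partial (plate l) (0, 1) (\<lambda>z. a (fst z) * b (snd z)) (\<lambda>z. a (fst z) * b' (snd z))"
    unfolding has_weak_partial_def
  proof (intro conjI ballI locally_integrableI continuous_integrable_plate c2 ca a b)
    fix \<phi> assume \<phi>: "\<phi> \<in> test_functions (plate l)"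
    note c = test_function_bounds(1,2)[OF \<phi> B(2)]
    show "(LINT z|lebesgue_on (plate l). a (fst z) * b (snd z) * frechet_derivative \<phi> (at z) (0, 1)) =
        - (LINT z|lebesgue_on (plate l). a (fst z) * b' (snd z) * \<phi> z)"
    proof (rule key[OF \<phi> B(2) c2 c2], (intro ca b)+, intro disjI2 allI)
      fix R x assume R: "R > 0" and out: "\<And>z. R \<le> \<bar>fst z\<bar> \<or> R \<le> \<bar>snd z\<bar> \<Longrightarrow> \<phi> z = 0 \<and> frechet_derivative \<phi> (at z) (0, 1) = 0"
      show "(LINT y|lborel. a (fst (x, y)) * b (snd (x, y)) * frechet_derivative \<phi> (at (x, y)) (0, 1) +
          a (fst (x, y)) * b' (snd (x, y)) * \<phi> (x, y)) = 0"
      proof (rule integral_derivative_zero[where F = "\<lambda>y. a x * b y * \<phi> (x, y)", OF _ _ _ R])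
        show "((\<lambda>y. a x * b y * \<phi> (x, y)) has_real_derivative a (fst (x, y)) * b (snd (x, y)) * frechet_derivative \<phi> (at (x, y)) (0, 1) +
          a (fst (x, y)) * b' (snd (x, y)) * \<phi> (x, y)) (at y)" for y
          using b(1)[of y] test_function_sections(2)[OF \<phi>, of x y]
          by (auto intro!: derivative_eq_intros simp: algebra_simps)
        show "continuous_on UNIV (\<lambda>y. a (fst (x, y)) * b (snd (x, y)) * frechet_derivative \<phi> (at (x, y)) (0, 1) +
          a (fst (x, y)) * b' (snd (x, y)) * \<phi> (x, y))"
          by (simp, intro continuous_intros ca b sec(2)[OF c(1)] sec(2)[OF c(2)])
      qed (use out in auto)
    qed
  qed
qed

lemma H2_star_gap_exists:
  assumes l: "l > 0"
  shows "\<exists>v\<in>H2_star l. v (pi / 2, l) \<noteq> v (pi / 2, - l)"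
proof -
  \<comment> \<open>The sine vanishes on both vertical sides, and the linear factor separates the
    two edges y = l and y = - l. The cut-off outside the closed plate is the normalization required
    by \<open>H2_star\<close>.\<close>
  define v where "v z = (if z \<in> {0..pi} \<times> {-l..l} then sin (fst z) * snd z else 0)" for z
  have v_eq: "AE z in lebesgue_on (plate l). sin (fst z) * snd z = v z"
    unfolding AE_plate_iff by (rule AE_I2) (auto simp: v_def plate_def)
  have lp: "(\<lambda>z::real \<times> real. f (fst z) * g (snd z)) \<in> lp_space (lebesgue_on (plate l)) 2"
    if "continuous_on UNIV f" "continuous_on UNIV g" for f g :: "real \<Rightarrow> real"
    by (intro continuous_lp2 continuous_intros continuous_on_compose2[OF that(1)] continuous_on_compose2[OF that(2)]) auto
  have cos': "(cos has_real_derivative (- sin x)) (at x)" "(sin has_real_derivative cos x) (at x)"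
    "((\<lambda>x. x) has_real_derivative 1) (at x)" "((\<lambda>x. 1) has_real_derivative 0) (at x)" for x :: real
    by (auto intro!: derivative_eq_intros)
  have cont: "continuous_on UNIV (\<lambda>x::real. - sin x)" "continuous_on UNIV (\<lambda>x::real. cos x)" "continuous_on UNIV (\<lambda>x::real. sin x)"
    "continuous_on UNIV (\<lambda>x::real. 1 :: real)" "continuous_on UNIV (\<lambda>x::real. x)" "continuous_on UNIV (\<lambda>x::real. 0 :: real)"
    by (intro continuous_intros)+
  have w1: "has_weak_partial (plate l) (1, 0) (\<lambda>z. sin (fst z) * snd z) (\<lambda>z. cos (fst z) * snd z)"
    by (rule has_weak_partial_classical(1)[OF cos'(2) cont(2) cos'(3) cont(4)])
  have w2: "has_weak_partial (plate l) (0, 1) (\<lambda>z. sin (fst z) * snd z) (\<lambda>z. sin (fst z) * 1)"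
    by (rule has_weak_partial_classical(2)[OF cos'(2) cont(2) cos'(3) cont(4)])
  have w3: "has_weak_partial (plate l) (1, 0) (\<lambda>z. cos (fst z) * snd z) (\<lambda>z. - sin (fst z) * snd z)"
    by (rule has_weak_partial_classical(1)[OF cos'(1) cont(1) cos'(3) cont(4)])
  have w4: "has_weak_partial (plate l) (0, 1) (\<lambda>z. cos (fst z) * snd z) (\<lambda>z. cos (fst z) * 1)"
    by (rule has_weak_partial_classical(2)[OF cos'(1) cont(1) cos'(3) cont(4)])
  have w5: "has_weak_partial (plate l) (1, 0) (\<lambda>z. sin (fst z) * 1) (\<lambda>z. cos (fst z) * 1)"
    by (rule has_weak_partial_classical(1)[OF cos'(2) cont(2) cos'(4) cont(6)])
  have w6: "has_weak_partial (plate l) (0, 1) (\<lambda>z. sin (fst z) * 1) (\<lambda>z. sin (fst z) * 0)"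
    by (rule has_weak_partial_classical(2)[OF cos'(2) cont(2) cos'(4) cont(6)])
  have "v \<in> lp_space (lebesgue_on (plate l)) 2" by (rule lp2_AE_cong[OF plate_sets lp[OF cont(3,5)] v_eq])
  then have "jet l v (\<lambda>z. cos (fst z) * snd z) (\<lambda>z. sin (fst z) * 1) (\<lambda>z. - sin (fst z) * snd z) (\<lambda>z. cos (fst z) * 1) (\<lambda>z. sin (fst z) * 0)"
    unfolding jet_def
    using has_weak_partial_AE_left[OF w1 v_eq] has_weak_partial_AE_left[OF w2 v_eq] w3 w4 w5 w6
      lp[OF cont(2,5)] lp[OF cont(3,4)] lp[OF cont(1,5)] lp[OF cont(2,4)] lp[OF cont(3,6)] by blast
  then have "v \<in> H2_star l"
  proof (rule H2_starI[OF _ l])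
    have "continuous_on ({0..pi} \<times> {-l..l}) (\<lambda>z. sin (fst z) * snd z)" by (intro continuous_intros)
    then show "continuous_on ({0..pi} \<times> {-l..l}) v"
      by (rule continuous_on_eq) (simp add: v_def)
    show "v z = 0" if "z \<notin> {0..pi} \<times> {-l..l}" for z using that by (simp only: v_def if_False)
    show "v (x, y) = 0" if "x \<in> {0, pi}" "y \<in> {-l<..<l}" for x y using that by (auto simp: v_def)
  qed
  moreover have "v (pi / 2, l) = l" "v (pi / 2, - l) = - l" using l pi_ge_zero by (auto simp: v_def)
  ultimately show ?thesis using l by (intro bexI[of _ v]) auto
qed

section \<open>Green functions of the gap\<close>

locale loaded_plate = weighted_plate +
  fixes \<kappa> :: "real \<times> real \<Rightarrow> real"
  assumes \<kappa>_measurable [measurable]: "\<kappa> \<in> borel_measurable (lebesgue_on (plate l))"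
    and \<kappa>_bounds: "0 < \<kappa> z" "\<kappa> z \<le> 1"
    and \<omega>_even: "z \<in> plate l \<Longrightarrow> \<omega> (reflect z) = \<omega> z"
    and \<kappa>_even: "z \<in> plate l \<Longrightarrow> \<kappa> (reflect z) = \<kappa> z"
begin

definition E :: "(real \<times> real \<Rightarrow> real) \<Rightarrow> (real \<times> real \<Rightarrow> real) \<Rightarrow> real" where
  "E f u = (LINT z|M. \<omega> z * bending_density l \<sigma> u z - f z * \<kappa> z * u z)"

definition load :: "(real \<times> real \<Rightarrow> real) \<Rightarrow> (real \<times> real \<Rightarrow> real) \<Rightarrow> real" where
  "load f v = (LINT z|M. f z * (\<kappa> z * v z))"

lemma H2_star_measurable: "v \<in> H2_star l \<Longrightarrow> v \<in> borel_measurable M"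
  using H2_star_jet[of v l] by (auto simp: jet_def lp2_iff)

lemma weighted_bound:
  assumes v: "v \<in> H2_star l"
  shows "\<bar>\<kappa> z * v z\<bar> \<le> C * sqrt (form v v)"
proof -
  have "\<bar>\<kappa> z\<bar> * \<bar>v z\<bar> \<le> 1 * \<bar>v z\<bar>"
    using \<kappa>_bounds[of z] by (intro mult_right_mono) auto
  then show ?thesis using form_eval[OF v, of z] by (simp add: abs_mult)
qed

lemma integrable_load:
  assumes f: "integrable M f" and v: "v \<in> H2_star l"
  shows "integrable M (\<lambda>z. f z * (\<kappa> z * v z))"
  by (rule integrable_mult_bounded[OF f _ weighted_bound[OF v]]) (use H2_star_measurable[OF v] in measurable)

lemma load_bounded_functional:
  assumes f: "integrable M f"
  shows "bounded_functional (load f)"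
  unfolding bounded_functional_def
proof (intro conjI exI ballI allI)
  fix u v s t assume u: "u \<in> H2_star l" and v: "v \<in> H2_star l"
  have "load f (\<lambda>z. s * u z + t * v z) = (LINT z|M. s * (f z * (\<kappa> z * u z)) + t * (f z * (\<kappa> z * v z)))"
    unfolding load_def by (simp add: algebra_simps)
  also have "\<dots> = s * load f u + t * load f v"
    unfolding load_def using integrable_load[OF f u] integrable_load[OF f v] by simp
  finally show "load f (\<lambda>z. s * u z + t * v z) = s * load f u + t * load f v" .
next
  fix v assume v: "v \<in> H2_star l"
  have "\<bar>load f v\<bar> \<le> (LINT z|M. \<bar>f z * (\<kappa> z * v z)\<bar>)"
    unfolding load_def using integral_norm_bound[of M "\<lambda>z. f z * (\<kappa> z * v z)"] by simp
  also have "\<dots> \<le> (LINT z|M. \<bar>f z\<bar> * (C * sqrt (form v v)))"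
    using f integrable_load[OF f v] weighted_bound[OF v]
    by (intro integral_mono integrable_abs integrable_mult_left) (auto simp: abs_mult intro!: mult_left_mono)
  finally show "\<bar>load f v\<bar> \<le> ((LINT z|M. \<bar>f z\<bar>) * C) * sqrt (form v v)" by (simp add: mult.assoc)
qed

lemma E_eq:
  assumes f: "integrable M f" and v: "v \<in> H2_star l"
  shows "E f v = form v v / 2 - load f v"
proof -
  obtain g q where j: "jet l v g q (D_xx l v) (D_xy l v) (D_yy l v)" using H2_star_jet[OF v] by blast
  have i: "integrable M (\<lambda>z. \<omega> z * bend \<sigma> (D_xx l v z) (D_xy l v z) (D_yy l v z) (D_xx l v z) (D_xy l v z) (D_yy l v z))"
    using jet_L2[OF j] by (intro integrable_bend) auto
  have "bending_density l \<sigma> v z = bend \<sigma> (D_xx l v z) (D_xy l v z) (D_yy l v z) (D_xx l v z) (D_xy l v z) (D_yy l v z) / 2" for z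
    by (simp add: bending_density_def laplacian_def bend_def power2_eq_square field_simps)
  note eq = this
  show ?thesis
    unfolding E_def form_def load_def eq using i integrable_load[OF f v] by (simp add: mult.assoc)
qed

definition sol :: "(real \<times> real \<Rightarrow> real) \<Rightarrow> real \<times> real \<Rightarrow> real" where
  "sol f = energy_minimizer l (E f)"

text \<open>The Riesz representer of the load is the only minimizer of the energy, so the
  description by \<open>THE\<close> denotes it.\<close>

lemma sol:
  assumes f: "integrable M f"
  shows "sol f \<in> H2_star l" and "\<And>v. v \<in> H2_star l \<Longrightarrow> form (sol f) v = load f v"
proof -
  obtain w where w: "w \<in> H2_star l" "\<And>v. v \<in> H2_star l \<Longrightarrow> form w v = load f v"
    using riesz[OF load_bounded_functional[OF f]] by blast
  have "is_arg_min (E f) (\<lambda>v. v \<in> H2_star l) u \<longleftrightarrow> is_arg_min (\<lambda>v. form v v / 2 - load f v) (\<lambda>v. v \<in> H2_star l) u" for u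
    unfolding is_arg_min_def using E_eq[OF f] by auto
  then have "is_arg_min (E f) (\<lambda>v. v \<in> H2_star l) = (\<lambda>u. u = w)"
    using is_arg_min_iff_representer[OF load_bounded_functional[OF f] w] by (simp add: fun_eq_iff)
  then have "sol f = w" unfolding sol_def energy_minimizer_def by simp
  with w show "sol f \<in> H2_star l" "\<And>v. v \<in> H2_star l \<Longrightarrow> form (sol f) v = load f v" by auto
qed

lemma point_bounded_functional: "bounded_functional (\<lambda>v. v z)"
  unfolding bounded_functional_def
proof (intro conjI exI ballI allI)
  show "\<bar>v z\<bar> \<le> C * sqrt (form v v)" if "v \<in> H2_star l" for v using that by (rule form_eval)
qed simp

lemma gap_bounded_functional: "bounded_functional (\<lambda>v. v (x, l) - v (x, - l))"
  unfolding bounded_functional_def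
proof (intro conjI exI ballI allI)
  fix v assume v: "v \<in> H2_star l"
  show "\<bar>v (x, l) - v (x, - l)\<bar> \<le> (2 * C) * sqrt (form v v)"
    using form_eval[OF v, of "(x, l)"] form_eval[OF v, of "(x, -l)"] by linarith
qed (simp add: algebra_simps)

definition green :: "real \<Rightarrow> real \<times> real \<Rightarrow> real" where
  "green x = (SOME w. w \<in> H2_star l \<and> (\<forall>v\<in>H2_star l. form w v = v (x, l) - v (x, - l)))"

lemma green: "green x \<in> H2_star l" "v \<in> H2_star l \<Longrightarrow> form (green x) v = v (x, l) - v (x, - l)"
proof -
  have "\<exists>w. w \<in> H2_star l \<and> (\<forall>v\<in>H2_star l. form w v = v (x, l) - v (x, - l))"
    using riesz[OF gap_bounded_functional] by blast
  from someI_ex[OF this] show "green x \<in> H2_star l" "v \<in> H2_star l \<Longrightarrow> form (green x) v = v (x, l) - v (x, - l)"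
    unfolding green_def by auto
qed

definition kernel :: "real \<Rightarrow> real \<times> real \<Rightarrow> real" where "kernel x z = \<kappa> z * green x z"

lemma kernel_measurable: "kernel x \<in> borel_measurable M"
  unfolding kernel_def[abs_def] using H2_star_measurable[OF green(1)] by measurable

text \<open>The energy s^2 of the Green function is its own gap at x, hence at most 2 C s. So s
  \<le> 2 C, and evaluation costs another factor C. The bound is uniform in x, as dominated
  convergence later requires.\<close>

lemma kernel_bounded: "\<bar>kernel x z\<bar> \<le> 2 * C\<^sup>2"
proof -
  define s where "s = sqrt (form (green x) (green x))"
  have s: "0 \<le> s" "s\<^sup>2 = form (green x) (green x)"
    using form_nonneg[OF green(1)] by (simp_all add: s_def)
  have "s\<^sup>2 \<le> 2 * C * s"
    using green(2)[OF green(1), of x x] form_eval[OF green(1), of x "(x, l)"] form_eval[OF green(1), of x "(x, -l)"] s(2)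
    unfolding s_def by linarith
  then have "s \<le> 2 * C" using s(1) C_nonneg by (cases "s = 0") (auto simp: power2_eq_square)
  then have "C * s \<le> C * (2 * C)" by (rule mult_left_mono[OF _ C_nonneg])
  moreover have "\<bar>kernel x z\<bar> \<le> C * s"
    using weighted_bound[OF green(1)] unfolding s_def kernel_def .
  ultimately show ?thesis by (simp add: power2_eq_square)
qed

text \<open>The number \<open>form (sol f) (green x)\<close> is read twice: as the gap of the
  solution at x, and as the load applied to the Green function.\<close>

lemma gap_eq_integral:
  assumes f: "integrable M f"
  shows "sol f (x, l) - sol f (x, - l) = (LINT z|M. f z * kernel x z)"
proof -
  have "sol f (x, l) - sol f (x, - l) = form (sol f) (green x)"
    using green(2)[OF sol(1)[OF f], of x] by (simp add: form_sym)
  also have "\<dots> = load f (green x)" by (rule sol(2)[OF f green(1)])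
  finally show ?thesis by (simp add: load_def kernel_def)
qed

lemma maximal_gap_eq:
  "integrable M f \<Longrightarrow> maximal_gap l E f = (SUP x\<in>{0..pi}. \<bar>LINT z|M. f z * kernel x z\<bar>)"
  unfolding maximal_gap_def using gap_eq_integral[of f] by (simp add: sol_def)

text \<open>Reflection exchanges the edges y = l and y = - l, so minus the reflected Green function
  represents the same gap functional, and representers are unique.\<close>

lemma kernel_odd:
  assumes z: "z \<in> plate l"
  shows "kernel x (reflect z) = - kernel x z"
proof -
  define w where "w z = green x (reflect z)" for z
  have w: "w \<in> H2_star l" unfolding w_def by (rule H2_star_reflect[OF green(1) l])
  have mw: "(\<lambda>z. - w z) \<in> H2_star l" using comb[OF w w, of "-1" 0] by simp
  have "form (\<lambda>z. - w z) v = form (green x) v" if v: "v \<in> H2_star l" for v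
  proof -
    have vr: "(\<lambda>z. v (reflect z)) \<in> H2_star l" by (rule H2_star_reflect[OF v l])
    have "form w v = form w (\<lambda>z. (\<lambda>z. v (reflect z)) (reflect z))" by simp
    also have "\<dots> = form (green x) (\<lambda>z. v (reflect z))"
      unfolding w_def by (rule form_reflect[OF \<omega>_even green(1) vr])
    also have "\<dots> = v (x, - l) - v (x, l)" using green(2)[OF vr] by (simp add: reflect_def)
    finally show ?thesis using lin[OF w w v, of "-1" 0] green(2)[OF v] by simp
  qed
  from fun_cong[OF representer_unique[OF mw green(1) this], of z]
  have "green x (reflect z) = - green x z" unfolding w_def by linarith
  then show ?thesis using \<kappa>_even[OF z] by (simp add: kernel_def)
qed

text \<open>The Green functions are chosen separately for each x. Reciprocity makes the dependence
  on x visible: \<open>green x z\<close> is the gap at x of the representer of evaluation at z, and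
  that representer is continuous.\<close>

lemma kernel_continuous: "continuous_on {0..pi} (\<lambda>x. kernel x z)"
proof -
  obtain G where G: "G \<in> H2_star l" "\<And>v. v \<in> H2_star l \<Longrightarrow> form G v = v z"
    using riesz[OF point_bounded_functional] by blast
  have "green x z = G (x, l) - G (x, - l)" for x
    using G(2)[OF green(1)] green(2)[OF G(1)] by (simp add: form_sym)
  moreover have "continuous_on {0..pi} (\<lambda>x. G (x, y))" if "y \<in> {-l..l}" for y
    by (rule continuous_on_compose2[OF H2_star_cont[OF G(1) l]]) (use that in \<open>auto intro!: continuous_intros\<close>)
  ultimately show ?thesis using l by (auto simp: kernel_def intro!: continuous_intros)
qed

text \<open>Since \<open>\<kappa>\<close> is positive, a vanishing kernel would make the Green
  function zero almost everywhere, hence with zero jet. Then the gap at pi / 2 would vanish for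
  every function in the space.\<close>

lemma kernel_nontrivial: "\<not> (AE z in M. kernel (pi / 2) z = 0)"
proof
  assume "AE z in M. kernel (pi / 2) z = 0"
  then have ae: "AE z in M. 0 = green (pi / 2) z"
  proof eventually_elim
    case (elim z)
    then show ?case using \<kappa>_bounds(1)[of z] by (simp add: kernel_def)
  qed
  have z: "(\<lambda>z. 0) \<in> lp_space M 2" by (simp add: lp2_iff)
  have j: "jet l (green (pi / 2)) (\<lambda>z. 0) (\<lambda>z. 0) (\<lambda>z. 0) (\<lambda>z. 0) (\<lambda>z. 0)"
    unfolding jet_def using lp2_AE_cong[OF plate_sets z ae] z has_weak_partial_zero
      has_weak_partial_AE_left[OF has_weak_partial_zero ae] by simp
  obtain v where v: "v \<in> H2_star l" "v (pi / 2, l) \<noteq> v (pi / 2, - l)" using H2_star_gap_exists[OF l] by blast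
  obtain g q where jv: "jet l v g q (D_xx l v) (D_xy l v) (D_yy l v)" using H2_star_jet[OF v(1)] by blast
  have "form (green (pi / 2)) v = 0" unfolding form_jet[OF j jv] by (simp add: bend_def)
  then show False using green(2)[OF v(1)] v(2) by simp
qed

end

section \<open>Convexity of powers and the unit sphere\<close>

text \<open>Strict Bernoulli inequality. With y the tangent value, y / x - 1 = (r - 1)(1 - 1/x)
  \<le> (r - 1) ln x, while ln (y / x) lies strictly below y / x - 1 because y differs from
  x.\<close>

lemma powr_gt_tangent:
  assumes r: "1 < r" and x: "0 \<le> x" "x \<noteq> 1"
  shows "1 + r * (x - 1) < x powr (r::real)"
proof (cases "x = 0")
  case True
  then show ?thesis using r by simp
next
  case False
  then have x0: "0 < x" using x by simp
  show ?thesis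
  proof (cases "1 + r * (x - 1) \<le> 0")
    case True
    then show ?thesis using x0 by (smt (verit) powr_gt_zero)
  next
    case pos: False
    define y where "y = 1 + r * (x - 1)"
    have y: "0 < y" using pos by (simp add: y_def)
    have "ln y < r * ln x"
    proof -
      have inv: "- ln x \<le> 1 / x - 1" using ln_le_minus_one[of "1 / x"] x0 by (simp add: ln_div)
      have yx: "y / x \<noteq> 1"
      proof
        assume "y / x = 1"
        then have "(r - 1) * (x - 1) = 0" using x0 by (simp add: y_def algebra_simps)
        then show False using r x by simp
      qed
      have "ln (y / x) < y / x - 1"
        using ln_le_minus_one[of "y / x"] ln_eq_minus_one[of "y / x"] yx x0 y by fastforce
      moreover have "y / x - 1 = (r - 1) * (1 - 1 / x)" using x0 by (simp add: y_def field_simps)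
      moreover have "(r - 1) * (1 - 1 / x) \<le> (r - 1) * ln x"
        using inv r by (intro mult_left_mono) auto
      moreover have "ln (y / x) = ln y - ln x" using x0 y by (simp add: ln_div)
      ultimately show ?thesis by (simp add: algebra_simps)
    qed
    then have "exp (ln y) < exp (r * ln x)" by simp
    moreover have "exp (ln y) = y" "exp (r * ln x) = x powr r" using y x0 by (simp_all add: powr_def)
    ultimately show ?thesis unfolding y_def by linarith
  qed
qed

text \<open>Strict convexity: apply the tangent inequality to s / m and t / m with m the midpoint;
  the two linear terms cancel.\<close>

lemma powr_midpoint:
  fixes s t r :: real
  assumes r: "1 < r" and st: "0 \<le> s" "0 \<le> t"
  shows "((s + t) / 2) powr r \<le> (s powr r + t powr r) / 2"
    and "((s + t) / 2) powr r = (s powr r + t powr r) / 2 \<Longrightarrow> s = t"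
proof -
  have *: "((s + t) / 2) powr r < (s powr r + t powr r) / 2" if ne: "s \<noteq> t"
  proof -
    define m where "m = (s + t) / 2"
    have m: "0 < m" using st ne by (auto simp: m_def)
    have mr: "0 < m powr r" using m by simp
    have sm: "s + t = 2 * m" by (simp add: m_def)
    have "s \<noteq> m" "t \<noteq> m" using ne sm by auto
    then have "1 + r * (s / m - 1) < (s / m) powr r" "1 + r * (t / m - 1) < (t / m) powr r"
      using m st by (auto intro!: powr_gt_tangent[OF r])
    moreover have "(s / m) powr r = s powr r / m powr r" "(t / m) powr r = t powr r / m powr r"
      using st m by (auto intro: powr_divide)
    ultimately have "(1 + r * (s / m - 1)) + (1 + r * (t / m - 1)) < s powr r / m powr r + t powr r / m powr r" by linarith
    moreover have "(1 + r * (s / m - 1)) + (1 + r * (t / m - 1)) = 2 + r * ((s + t) / m - 2)"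
      by (simp add: algebra_simps add_divide_distrib)
    moreover have "(s + t) / m - 2 = 0" using m unfolding sm by simp
    ultimately have "2 < s powr r / m powr r + t powr r / m powr r" by simp
    then have "2 < (s powr r + t powr r) / m powr r" by (simp only: add_divide_distrib)
    then have "2 * m powr r < s powr r + t powr r" using mr by (simp add: field_simps)
    then show ?thesis by (simp add: m_def)
  qed
  show "((s + t) / 2) powr r \<le> (s powr r + t powr r) / 2"
    using * by (cases "s = t") (auto intro: less_imp_le)
  show "((s + t) / 2) powr r = (s powr r + t powr r) / 2 \<Longrightarrow> s = t" using * by fastforce
qed

text \<open>Applied to a = f(z) and b = f(reflect z), this compares the odd part of a load with the
  load itself. Equality forces equal absolute values and equality in the triangle inequality, hence
  opposite values.\<close>

lemma powr_half_diff:
  fixes a b r :: real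
  assumes r: "1 < r"
  shows "\<bar>(a - b) / 2\<bar> powr r \<le> (\<bar>a\<bar> powr r + \<bar>b\<bar> powr r) / 2"
    and "\<bar>(a - b) / 2\<bar> powr r = (\<bar>a\<bar> powr r + \<bar>b\<bar> powr r) / 2 \<Longrightarrow> b = - a"
proof -
  have le: "\<bar>(a - b) / 2\<bar> \<le> (\<bar>a\<bar> + \<bar>b\<bar>) / 2"
    using abs_triangle_ineq4[of a b] by simp
  then have 1: "\<bar>(a - b) / 2\<bar> powr r \<le> ((\<bar>a\<bar> + \<bar>b\<bar>) / 2) powr r" using r by (intro powr_mono2) auto
  note 2 = powr_midpoint[OF r abs_ge_zero abs_ge_zero, of a b]
  from 1 2(1) show "\<bar>(a - b) / 2\<bar> powr r \<le> (\<bar>a\<bar> powr r + \<bar>b\<bar> powr r) / 2" by linarith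
  assume eq: "\<bar>(a - b) / 2\<bar> powr r = (\<bar>a\<bar> powr r + \<bar>b\<bar> powr r) / 2"
  then have "\<bar>a\<bar> = \<bar>b\<bar>" using 1 2 by linarith
  moreover have "\<bar>(a - b) / 2\<bar> = (\<bar>a\<bar> + \<bar>b\<bar>) / 2"
  proof (rule ccontr)
    assume "\<not> ?thesis"
    then have "\<bar>(a - b) / 2\<bar> < (\<bar>a\<bar> + \<bar>b\<bar>) / 2" using le by linarith
    then have "\<bar>(a - b) / 2\<bar> powr r < ((\<bar>a\<bar> + \<bar>b\<bar>) / 2) powr r" using r by (intro powr_less_mono2) auto
    then show False using eq 2(1) by linarith
  qed
  ultimately show "b = - a" by (auto simp: abs_if split: if_splits)
qed

text \<open>Restates norm one without the essential supremum: 1 bounds |f| almost everywhere and no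
  smaller constant does.\<close>

lemma lp_sphere_infinity:
  shows "f \<in> lp_sphere M \<infinity> \<longleftrightarrow> f \<in> borel_measurable M \<and> (AE z in M. \<bar>f z\<bar> \<le> 1) \<and>
    \<not> (\<exists>s<1. AE z in M. \<bar>f z\<bar> \<le> s)"
    and "f \<in> lp_sphere M \<infinity> \<Longrightarrow> lp_norm M \<infinity> f = 1"
proof -
  show n: "f \<in> lp_sphere M \<infinity> \<Longrightarrow> lp_norm M \<infinity> f = 1" by (simp add: lp_sphere_def)
  define S where "S = esssup M (\<lambda>z. ereal \<bar>f z\<bar>)"
  have ae: "AE z in M. ereal \<bar>f z\<bar> \<le> S" unfolding S_def by (rule esssup_AE)
  show "f \<in> lp_sphere M \<infinity> \<longleftrightarrow> f \<in> borel_measurable M \<and> (AE z in M. \<bar>f z\<bar> \<le> 1) \<and> \<not> (\<exists>s<1. AE z in M. \<bar>f z\<bar> \<le> s)"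
  proof
    assume f: "f \<in> lp_sphere M \<infinity>"
    then have fm: "f \<in> borel_measurable M" and "S < \<infinity>" and "real_of_ereal S = 1"
      by (auto simp: lp_sphere_def lp_space_def lp_norm_def S_def)
    then have S: "S = 1" by (cases S) (auto simp: one_ereal_def)
    have "AE z in M. \<bar>f z\<bar> \<le> 1" using ae unfolding S by eventually_elim (simp add: one_ereal_def)
    moreover have "\<not> (AE z in M. \<bar>f z\<bar> \<le> s)" if "s < 1" for s
    proof
      assume "AE z in M. \<bar>f z\<bar> \<le> s"
      then have "S \<le> ereal s" unfolding S_def using fm by (intro esssup_I) auto
      then show False using that S by (simp add: one_ereal_def)
    qed
    ultimately show "f \<in> borel_measurable M \<and> (AE z in M. \<bar>f z\<bar> \<le> 1) \<and> \<not> (\<exists>s<1. AE z in M. \<bar>f z\<bar> \<le> s)"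
      using fm by blast
  next
    assume *: "f \<in> borel_measurable M \<and> (AE z in M. \<bar>f z\<bar> \<le> 1) \<and> \<not> (\<exists>s<1. AE z in M. \<bar>f z\<bar> \<le> s)"
    then have fm [measurable]: "f \<in> borel_measurable M" by blast
    have "S \<le> 1" unfolding S_def using * by (intro esssup_I) (auto simp: one_ereal_def)
    moreover have "\<not> S < 1"
    proof
      assume "S < 1"
      then obtain s where s: "S < ereal s" "ereal s < 1" using ereal_dense2 by blast
      have "AE z in M. \<bar>f z\<bar> \<le> s" using ae
      proof eventually_elim
        case (elim z)
        then have "ereal \<bar>f z\<bar> < ereal s" using s(1) by (rule le_less_trans)
        then show ?case by simp
      qed
      moreover have "s < 1" using s(2) by (simp add: one_ereal_def)
      ultimately show False using * by blast
    qed
    ultimately have "S = 1" by simp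
    then show "f \<in> lp_sphere M \<infinity>" using fm by (simp add: lp_sphere_def lp_space_def lp_norm_def S_def)
  qed
qed

lemma lp_sphere_finite_iff:
  assumes r: "1 < r"
  shows "f \<in> lp_sphere M (ereal r) \<longleftrightarrow> f \<in> borel_measurable M \<and> integrable M (\<lambda>z. \<bar>f z\<bar> powr r) \<and>
    (LINT z|M. \<bar>f z\<bar> powr r) = 1"
proof -
  have "x powr (1 / r) = 1 \<longleftrightarrow> x = 1" if "0 \<le> x" for x :: real
  proof
    assume "x powr (1 / r) = 1"
    then have "(x powr (1 / r)) powr r = 1" by simp
    then show "x = 1" using that r by (simp add: powr_powr)
  qed simp
  then show ?thesis unfolding lp_sphere_def lp_space_def lp_norm_def by auto
qed

lemma integrable_powr_imp_integrable:
  fixes f :: "'a \<Rightarrow> real"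
  assumes "finite_measure M" "1 < r" "f \<in> borel_measurable M" "integrable M (\<lambda>z. \<bar>f z\<bar> powr r)"
  shows "integrable M f"
proof -
  interpret finite_measure M by fact
  show ?thesis
  proof (rule Bochner_Integration.integrable_bound)
    show "integrable M (\<lambda>z. 1 + \<bar>f z\<bar> powr r)" using assms(4) by simp
    have "\<bar>x\<bar> \<le> 1 + \<bar>x\<bar> powr r" for x :: real
    proof (cases "\<bar>x\<bar> \<le> 1")
      case False
      then have "\<bar>x\<bar> powr 1 \<le> \<bar>x\<bar> powr r" using assms(2) by (intro powr_mono) auto
      then show ?thesis using False by simp
    qed (simp add: add_increasing2)
    then show "AE z in M. norm (f z) \<le> norm (1 + \<bar>f z\<bar> powr r)" by (simp add: abs_of_nonneg)
  qed (rule assms(3))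
qed

lemma lp_sphere_integrable:
  assumes fin: "finite_measure M" and p: "1 < p" and f: "f \<in> lp_sphere M p"
  shows "integrable M f"
proof -
  interpret finite_measure M by fact
  show ?thesis
  proof (cases "p = \<infinity>")
    case True
    have fm: "f \<in> borel_measurable M" using f by (simp add: lp_sphere_def lp_space_def)
    have "esssup M (\<lambda>z. ereal \<bar>f z\<bar>) < \<infinity>" using f True by (simp add: lp_sphere_def lp_space_def)
    then obtain B where B: "esssup M (\<lambda>z. ereal \<bar>f z\<bar>) \<le> ereal B"
      by (cases "esssup M (\<lambda>z. ereal \<bar>f z\<bar>)") auto
    have "AE z in M. norm (f z) \<le> B"
      using esssup_AE[of "\<lambda>z. ereal \<bar>f z\<bar>" M]
    proof eventually_elim
      case (elim z)
      then have "ereal \<bar>f z\<bar> \<le> ereal B" using B by (rule order_trans)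
      then show ?case by simp
    qed
    then show ?thesis using fm by (rule integrable_const_bound)
  next
    case False
    then obtain r where r: "p = ereal r" "1 < r" using p by (cases p) (auto simp: one_ereal_def)
    with f show ?thesis
      by (auto simp: lp_sphere_finite_iff intro: integrable_powr_imp_integrable[OF fin])
  qed
qed

section \<open>Maximizing an odd kernel\<close>

lemma odd_in_y_iff: "odd_in_y l f \<longleftrightarrow> (AE z in lebesgue_on (plate l). f (reflect z) = - f z)"
  unfolding odd_in_y_def by (simp add: reflect_def case_prod_unfold)

lemma even_part_eq: "even_part f z = (f z + f (reflect z)) / 2"
  by (cases z) (simp add: even_part_def reflect_def)

text \<open>Collects what the maximization uses about the Green kernels, so that it is carried out
  once for both energies.\<close>

locale odd_kernel =
  fixes l B :: real and k :: "real \<Rightarrow> real \<times> real \<Rightarrow> real"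
  assumes l: "0 < l"
    and k_measurable [measurable]: "k x \<in> borel_measurable (lebesgue_on (plate l))"
    and k_bounded: "\<bar>k x z\<bar> \<le> B"
    and k_odd: "z \<in> plate l \<Longrightarrow> k x (reflect z) = - k x z"
    and k_continuous: "continuous_on {0..pi} (\<lambda>x. k x z)"
    and k_nontrivial: "\<not> (AE z in lebesgue_on (plate l). k (pi / 2) z = 0)"
begin

abbreviation N where "N \<equiv> lebesgue_on (plate l)"

definition G :: "(real \<times> real \<Rightarrow> real) \<Rightarrow> real" where
  "G f = (SUP x\<in>{0..pi}. \<bar>LINT z|N. f z * k x z\<bar>)"

lemma fin: "finite_measure N" by (rule finite_measure_plate)

lemma integrable_k: "integrable N f \<Longrightarrow> integrable N (\<lambda>z. f z * k x z)"
  by (rule integrable_mult_bounded[OF _ k_measurable k_bounded])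

lemma G_upper:
  assumes f: "integrable N f" and x: "x \<in> {0..pi}"
  shows "\<bar>LINT z|N. f z * k x z\<bar> \<le> G f"
proof -
  have "\<bar>LINT z|N. f z * k x z\<bar> \<le> (LINT z|N. \<bar>f z\<bar> * B)" for x
  proof -
    have "\<bar>LINT z|N. f z * k x z\<bar> \<le> (LINT z|N. \<bar>f z * k x z\<bar>)"
      using integral_norm_bound[of N "\<lambda>z. f z * k x z"] by simp
    also have "\<dots> \<le> (LINT z|N. \<bar>f z\<bar> * B)"
      using f k_bounded by (intro integral_mono integrable_abs integrable_k integrable_mult_left)
        (auto simp: abs_mult intro!: mult_left_mono)
    finally show ?thesis .
  qed
  then show ?thesis unfolding G_def using x by (intro cSUP_upper bdd_aboveI2) auto
qed

lemma G_least: "(\<And>x. x \<in> {0..pi} \<Longrightarrow> \<bar>LINT z|N. f z * k x z\<bar> \<le> b) \<Longrightarrow> G f \<le> b"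
  unfolding G_def by (intro cSUP_least) (auto simp: pi_ge_zero)

lemma G_cong:
  "(\<And>x. (LINT z|N. f z * k x z) = (LINT z|N. g z * k x z)) \<Longrightarrow> G f = G g"
  unfolding G_def by simp

lemma integral_reflect_k:
  assumes f: "integrable N f"
  shows "(LINT z|N. f (reflect z) * k x z) = - (LINT z|N. f z * k x z)"
proof -
  have "(LINT z|N. f z * k x z) = (LINT z|N. f (reflect z) * k x (reflect z))"
    using integral_reflect_plate[OF borel_measurable_integrable[OF integrable_k[OF f]]] by simp
  also have "\<dots> = (LINT z|N. - (f (reflect z) * k x z))"
    by (intro Bochner_Integration.integral_cong) (auto simp: k_odd)
  finally show ?thesis by simp
qed

lemma integrable_powr_k: "0 \<le> q \<Longrightarrow> integrable N (\<lambda>z. \<bar>k x z\<bar> powr q)"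
proof -
  interpret finite_measure N by (rule fin)
  assume "0 \<le> q"
  then show ?thesis
    by (intro integrable_const_bound[of _ "B powr q"]) (auto intro!: AE_I2 powr_mono2 k_bounded)
qed

lemma continuous_integral_powr_k:
  assumes q: "0 < q"
  shows "continuous_on {0..pi} (\<lambda>x. LINT z|N. \<bar>k x z\<bar> powr q)"
  unfolding continuous_on_sequentially
proof (intro allI ballI impI)
  interpret finite_measure N by (rule fin)
  fix X a assume a: "a \<in> {0..pi}" and X: "(\<forall>n. X n \<in> {0..pi}) \<and> X \<longlonglongrightarrow> a"
  have lim: "(\<lambda>n. k (X n) z) \<longlonglongrightarrow> k a z" for z
    using k_continuous[of z, unfolded continuous_on_sequentially, rule_format, of a X] a X by (simp add: comp_def)
  have "(\<lambda>n. LINT z|N. \<bar>k (X n) z\<bar> powr q) \<longlonglongrightarrow> (LINT z|N. \<bar>k a z\<bar> powr q)"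
  proof (rule integral_dominated_convergence[where w = "\<lambda>z. B powr q"])
    show "AE z in N. (\<lambda>n. \<bar>k (X n) z\<bar> powr q) \<longlonglongrightarrow> \<bar>k a z\<bar> powr q"
      using q by (intro AE_I2 tendsto_powr' tendsto_rabs lim tendsto_const) auto
    show "AE z in N. norm (\<bar>k (X n) z\<bar> powr q) \<le> B powr q" for n
      using q by (auto intro!: AE_I2 powr_mono2 k_bounded)
  qed auto
  then show "((\<lambda>x. LINT z|N. \<bar>k x z\<bar> powr q) \<circ> X) \<longlonglongrightarrow> (LINT z|N. \<bar>k a z\<bar> powr q)" by (simp add: comp_def)
qed

lemma integral_powr_k_max:
  assumes q: "0 < q"
  shows "\<exists>x\<in>{0..pi}. 0 < (LINT z|N. \<bar>k x z\<bar> powr q) \<and>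
    (\<forall>x'\<in>{0..pi}. (LINT z|N. \<bar>k x' z\<bar> powr q) \<le> (LINT z|N. \<bar>k x z\<bar> powr q))"
proof -
  obtain x where x: "x \<in> {0..pi}" "\<And>x'. x' \<in> {0..pi} \<Longrightarrow> (LINT z|N. \<bar>k x' z\<bar> powr q) \<le> (LINT z|N. \<bar>k x z\<bar> powr q)"
    using continuous_attains_sup[OF compact_Icc _ continuous_integral_powr_k[OF q]] pi_ge_zero by auto
  have "(LINT z|N. \<bar>k (pi / 2) z\<bar> powr q) \<noteq> 0"
  proof
    assume "(LINT z|N. \<bar>k (pi / 2) z\<bar> powr q) = 0"
    then have "AE z in N. \<bar>k (pi / 2) z\<bar> powr q = 0"
      using integral_nonneg_eq_0_iff_AE[OF integrable_powr_k, of q "pi / 2"] q by simp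
    then have "AE z in N. k (pi / 2) z = 0" by eventually_elim simp
    with k_nontrivial show False by simp
  qed
  then have "0 < (LINT z|N. \<bar>k (pi / 2) z\<bar> powr q)" by (simp add: less_le)
  also have "\<dots> \<le> (LINT z|N. \<bar>k x z\<bar> powr q)" using pi_ge_zero by (intro x(2)) auto
  finally show ?thesis using x by blast
qed

text \<open>The extremal load is the one with equality in Hoelder's inequality, tested against the kernel
  of largest dual norm; oddness of the kernel makes it odd.\<close>

lemma extremal_load_finite:
  assumes r: "1 < r"
  shows "\<exists>f0 m. f0 \<in> lp_sphere N (ereal r) \<and> odd_in_y l f0 \<and> 0 < m \<and> G f0 = m \<and>
    (\<forall>f\<in>lp_sphere N (ereal r). G f \<le> m)"
proof -
  define q where "q = r / (r - 1)"
  have q: "1 < q" "1 / r + 1 / q = 1" "(q - 1) * r = q" using r by (simp_all add: q_def field_simps)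
  define A where "A x = (LINT z|N. \<bar>k x z\<bar> powr q)" for x
  obtain x0 where x0: "x0 \<in> {0..pi}" "0 < A x0" "\<And>x. x \<in> {0..pi} \<Longrightarrow> A x \<le> A x0"
    unfolding A_def using integral_powr_k_max[of q] q(1) by auto
  define m where "m = A x0 powr (1 / q)"
  have m: "0 < m" "m powr q = A x0" using x0(2) q(1) by (auto simp: m_def powr_powr)
  have upper: "\<bar>LINT z|N. f z * k x z\<bar> \<le> m" if f: "f \<in> lp_sphere N (ereal r)" and x: "x \<in> {0..pi}" for f x
  proof -
    have fm: "f \<in> borel_measurable N" "integrable N (\<lambda>z. \<bar>f z\<bar> powr r)" "(LINT z|N. \<bar>f z\<bar> powr r) = 1"
      using f r by (auto simp: lp_sphere_finite_iff)
    have fi: "integrable N f" by (rule lp_sphere_integrable[OF fin _ f]) (use r in \<open>simp add: one_ereal_def\<close>)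
    have "\<bar>LINT z|N. f z * k x z\<bar> \<le> (LINT z|N. \<bar>f z * k x z\<bar>)"
      using integral_norm_bound[of N "\<lambda>z. f z * k x z"] by simp
    \<comment> \<open>Young's inequality for |f| and |k| / m. Dividing the kernel by the largest
      dual norm makes the integrals of both powers at most 1, so the bound is m (1 / r + 1 / q) =
      m.\<close>
    also have "\<dots> \<le> (LINT z|N. m * (\<bar>f z\<bar> powr r / r + (\<bar>k x z\<bar> powr q / m powr q) / q))"
    proof (rule integral_mono)
      show "integrable N (\<lambda>z. \<bar>f z * k x z\<bar>)" using integrable_k[OF fi] by simp
      show "integrable N (\<lambda>z. m * (\<bar>f z\<bar> powr r / r + (\<bar>k x z\<bar> powr q / m powr q) / q))"
        using fm(2) integrable_powr_k[of q x] q(1) by simp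
      fix z
      have "\<bar>f z\<bar> * (\<bar>k x z\<bar> / m) \<le> \<bar>f z\<bar> powr r / r + (\<bar>k x z\<bar> / m) powr q / q"
        using m by (intro Youngs_inequality r q) auto
      then have "m * (\<bar>f z\<bar> * (\<bar>k x z\<bar> / m)) \<le> m * (\<bar>f z\<bar> powr r / r + (\<bar>k x z\<bar> / m) powr q / q)"
        using m by (intro mult_left_mono) auto
      moreover have "(\<bar>k x z\<bar> / m) powr q = \<bar>k x z\<bar> powr q / m powr q" by (rule powr_divide)
      ultimately show "\<bar>f z * k x z\<bar> \<le> m * (\<bar>f z\<bar> powr r / r + (\<bar>k x z\<bar> powr q / m powr q) / q)"
        using m by (simp add: abs_mult)
    qed
    also have "\<dots> = m * (1 / r + (A x / A x0) / q)"
      using fm(2,3) integrable_powr_k[of q x] q(1) by (simp add: A_def m(2))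
    also have "\<dots> \<le> m * (1 / r + 1 / q)"
      using m x0 x q(1) by (intro mult_left_mono add_left_mono divide_right_mono) auto
    finally show ?thesis by (simp add: q(2))
  qed
  \<comment> \<open>The equality case: |f0|^r is proportional to |k|^q because (q - 1) r = q, and
    the denominator makes its integral 1.\<close>
  define f0 where "f0 z = sgn (k x0 z) * \<bar>k x0 z\<bar> powr (q - 1) / A x0 powr (1 / r)" for z
  have abs_f0: "\<bar>f0 z\<bar> powr r = \<bar>k x0 z\<bar> powr q / A x0" for z
  proof (cases "k x0 z = 0")
    case False
    then have "\<bar>f0 z\<bar> = \<bar>k x0 z\<bar> powr (q - 1) / A x0 powr (1 / r)"
      by (simp add: f0_def abs_mult abs_sgn_eq)
    then have "\<bar>f0 z\<bar> powr r = (\<bar>k x0 z\<bar> powr (q - 1)) powr r / (A x0 powr (1 / r)) powr r"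
      by (simp add: powr_divide)
    also have "\<dots> = \<bar>k x0 z\<bar> powr q / A x0" using x0(2) r by (simp add: powr_powr q(3))
    finally show ?thesis .
  qed (use q(1) in \<open>simp add: f0_def\<close>)
  have f0m: "f0 \<in> borel_measurable N" unfolding f0_def[abs_def] by measurable
  have f0: "f0 \<in> lp_sphere N (ereal r)"
    unfolding lp_sphere_finite_iff[OF r] abs_f0
    using f0m integrable_powr_k[of q x0] q(1) x0(2) by (simp add: A_def)
  have f0i: "integrable N f0" by (rule lp_sphere_integrable[OF fin _ f0]) (use r in \<open>simp add: one_ereal_def\<close>)
  have "(LINT z|N. f0 z * k x0 z) = (LINT z|N. \<bar>k x0 z\<bar> powr q / A x0 powr (1 / r))"
  proof (rule Bochner_Integration.integral_cong[OF refl])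
    fix z
    have "\<bar>t\<bar> powr (q - 1) * (sgn t * t) = \<bar>t\<bar> powr q" for t
    proof (cases "t = 0")
      case False
      then have "sgn t * t = \<bar>t\<bar> powr 1" using abs_sgn[of t] by (simp add: mult.commute)
      then show ?thesis by (simp only: powr_add[symmetric]) simp
    qed (use q(1) in simp)
    then show "f0 z * k x0 z = \<bar>k x0 z\<bar> powr q / A x0 powr (1 / r)" by (simp add: f0_def mult_ac)
  qed
  also have "\<dots> = A x0 / A x0 powr (1 / r)" by (simp add: A_def)
  also have "\<dots> = A x0 powr 1 / A x0 powr (1 / r)" using x0(2) by simp
  also have "\<dots> = A x0 powr (1 - 1 / r)" by (simp only: powr_diff)
  also have "1 - 1 / r = 1 / q" using q(2) by linarith
  finally have "(LINT z|N. f0 z * k x0 z) = m" by (simp only: m_def)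
  then have "m \<le> G f0" using G_upper[OF f0i x0(1)] m(1) by simp
  moreover have "G f \<le> m" if "f \<in> lp_sphere N (ereal r)" for f by (rule G_least) (rule upper[OF that])
  moreover have "odd_in_y l f0" unfolding odd_in_y_iff by (rule AE_I2) (simp add: f0_def k_odd sgn_minus)
  ultimately show ?thesis using f0 m(1) by (intro exI[of _ f0] exI[of _ m]) (auto intro: antisym)
qed

lemma emeasure_N_pos: "emeasure N (space N) > 0"
  using emeasure_plate_pos[OF l] by simp

text \<open>The upper bound is stated for every level s because a level s < 1 gives a gap of at most
  s m < m. This is how loads with gap m are shown to have norm exactly 1.\<close>

lemma extremal_load_infinity:
  shows "\<exists>f0 m. f0 \<in> lp_sphere N \<infinity> \<and> odd_in_y l f0 \<and> 0 < m \<and> G f0 = m \<and>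
    (\<forall>f s. f \<in> borel_measurable N \<longrightarrow> (AE z in N. \<bar>f z\<bar> \<le> s) \<longrightarrow> G f \<le> s * m)"
proof -
  interpret finite_measure N by (rule fin)
  define A where "A x = (LINT z|N. \<bar>k x z\<bar>)" for x
  obtain x0 where x0: "x0 \<in> {0..pi}" "0 < A x0" "\<And>x. x \<in> {0..pi} \<Longrightarrow> A x \<le> A x0"
    unfolding A_def using integral_powr_k_max[of 1] by auto
  have ik: "integrable N (\<lambda>z. \<bar>k x z\<bar>)" for x using integrable_powr_k[of 1 x] by simp
  have upper: "G f \<le> s * A x0" if f: "f \<in> borel_measurable N" "AE z in N. \<bar>f z\<bar> \<le> s" for f s
  proof (rule G_least)
    fix x assume x: "x \<in> {0..pi}"
    \<comment> \<open>A negative essential bound on |f| is impossible because the plate has positive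
      measure.\<close>
    have s: "0 \<le> s"
    proof (rule ccontr)
      assume "\<not> 0 \<le> s"
      then have "AE z in N. \<not> True" using f(2) by (auto elim!: eventually_mono)
      from emeasure_eq_0_AE[OF this] show False using emeasure_N_pos by simp
    qed
    have fi: "integrable N f" by (rule integrable_const_bound[of _ s]) (use f in auto)
    have "\<bar>LINT z|N. f z * k x z\<bar> \<le> (LINT z|N. \<bar>f z * k x z\<bar>)"
      using integral_norm_bound[of N "\<lambda>z. f z * k x z"] by simp
    also have "\<dots> \<le> (LINT z|N. s * \<bar>k x z\<bar>)"
    proof (rule integral_mono_AE)
      show "integrable N (\<lambda>z. \<bar>f z * k x z\<bar>)" using integrable_k[OF fi] by simp
      show "integrable N (\<lambda>z. s * \<bar>k x z\<bar>)" using ik by simp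
      show "AE z in N. \<bar>f z * k x z\<bar> \<le> s * \<bar>k x z\<bar>"
        using f(2) by eventually_elim (auto simp: abs_mult intro!: mult_right_mono)
    qed
    also have "\<dots> \<le> s * A x0" using x0(3)[OF x] s by (simp add: A_def mult_left_mono)
    finally show "\<bar>LINT z|N. f z * k x z\<bar> \<le> s * A x0" .
  qed
  define f0 where "f0 z = sgn (k x0 z)" for z
  have f0m: "f0 \<in> borel_measurable N" unfolding f0_def[abs_def] by measurable
  have le1: "AE z in N. \<bar>f0 z\<bar> \<le> 1" by (rule AE_I2) (simp add: f0_def abs_sgn_eq)
  have f0i: "integrable N f0" by (rule integrable_const_bound[of _ 1]) (use f0m le1 in auto)
  have "(LINT z|N. f0 z * k x0 z) = A x0" by (simp add: f0_def A_def abs_sgn mult.commute)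
  then have ge: "A x0 \<le> G f0" using G_upper[OF f0i x0(1)] x0(2) by simp
  \<comment> \<open>The sign of the kernel vanishes wherever the kernel does, so norm one is deduced
    from the size of the gap.\<close>
  have "\<not> (\<exists>s<1. AE z in N. \<bar>f0 z\<bar> \<le> s)"
  proof
    assume "\<exists>s<1. AE z in N. \<bar>f0 z\<bar> \<le> s"
    then obtain s where s: "s < 1" "AE z in N. \<bar>f0 z\<bar> \<le> s" by blast
    have "A x0 \<le> s * A x0" using upper[OF f0m s(2)] ge by linarith
    then show False using s(1) x0(2) by simp
  qed
  then have "f0 \<in> lp_sphere N \<infinity>" unfolding lp_sphere_infinity(1) using f0m le1 by blast
  moreover have "odd_in_y l f0" unfolding odd_in_y_iff by (rule AE_I2) (simp add: f0_def k_odd sgn_minus)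
  moreover have "G f0 = A x0" using ge upper[OF f0m le1] by simp
  ultimately show ?thesis using x0(2) upper by (intro exI[of _ f0] exI[of _ "A x0"]) auto
qed

lemma extremal_load:
  assumes p: "1 < p"
  shows "\<exists>f0 m. f0 \<in> lp_sphere N p \<and> odd_in_y l f0 \<and> 0 < m \<and> G f0 = m \<and> (\<forall>f\<in>lp_sphere N p. G f \<le> m)"
proof (cases "p = \<infinity>")
  case True
  obtain f0 m where "f0 \<in> lp_sphere N \<infinity>" "odd_in_y l f0" "0 < m" "G f0 = m"
    and u: "\<And>f s. f \<in> borel_measurable N \<Longrightarrow> (AE z in N. \<bar>f z\<bar> \<le> s) \<Longrightarrow> G f \<le> s * m"
    using extremal_load_infinity by blast
  moreover have "G f \<le> m" if "f \<in> lp_sphere N \<infinity>" for f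
    using that u[of f 1] by (simp add: lp_sphere_infinity(1))
  ultimately show ?thesis using True by blast
next
  case False
  then obtain r where "p = ereal r" "1 < r" using p by (cases p) (auto simp: one_ereal_def)
  then show ?thesis using extremal_load_finite[of r] by simp
qed

text \<open>The odd part \<open>h\<close> has the same gap as f, and its norm is at most 1 by
  convexity. A smaller norm would let the rescaled odd part beat f; norm 1 is equality in the
  integrated convexity inequality, hence pointwise equality almost everywhere, which means
  oddness.\<close>

lemma maximizer_odd:
  assumes r: "1 < r" and f: "f \<in> lp_sphere N (ereal r)" and max: "\<And>g. g \<in> lp_sphere N (ereal r) \<Longrightarrow> G g \<le> G f"
    and pos: "0 < G f"
  shows "odd_in_y l f"
proof -
  have fm [measurable]: "f \<in> borel_measurable N" and fr: "integrable N (\<lambda>z. \<bar>f z\<bar> powr r)" "(LINT z|N. \<bar>f z\<bar> powr r) = 1"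
    using f r by (auto simp: lp_sphere_finite_iff)
  have fi: "integrable N f" by (rule lp_sphere_integrable[OF fin _ f]) (use r in \<open>simp add: one_ereal_def\<close>)
  have [measurable]: "(\<lambda>z. f (reflect z)) \<in> borel_measurable N" by (rule measurable_reflect[OF fm])
  have frR: "integrable N (\<lambda>z. \<bar>f (reflect z)\<bar> powr r)" "(LINT z|N. \<bar>f (reflect z)\<bar> powr r) = 1"
    using integrable_reflect[OF borel_measurable_integrable[OF fr(1)] fr(1)]
      integral_reflect_plate[OF borel_measurable_integrable[OF fr(1)]] fr(2) by simp_all
  define h where "h z = (f z - f (reflect z)) / 2" for z
  have hm [measurable]: "h \<in> borel_measurable N" unfolding h_def[abs_def] by measurable
  have hle: "\<bar>h z\<bar> powr r \<le> (\<bar>f z\<bar> powr r + \<bar>f (reflect z)\<bar> powr r) / 2" for z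
    unfolding h_def by (rule powr_half_diff(1)[OF r])
  have mean: "integrable N (\<lambda>z. (\<bar>f z\<bar> powr r + \<bar>f (reflect z)\<bar> powr r) / 2)"
    "(LINT z|N. (\<bar>f z\<bar> powr r + \<bar>f (reflect z)\<bar> powr r) / 2) = 1"
    using fr frR by simp_all
  have hr: "integrable N (\<lambda>z. \<bar>h z\<bar> powr r)"
    by (rule Bochner_Integration.integrable_bound[OF mean(1)]) (use hle in \<open>auto intro!: AE_I2 order_trans[OF hle]\<close>)
  define S where "S = (LINT z|N. \<bar>h z\<bar> powr r)"
  have S1: "S \<le> 1" unfolding S_def mean(2)[symmetric] by (rule integral_mono[OF hr mean(1) hle])
  have S0: "0 \<le> S" by (simp add: S_def)
  have ih: "integrable N h" unfolding h_def using fi integrable_reflect[OF fm fi] by simp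
  have Gh: "G h = G f"
  proof (rule G_cong)
    fix x
    have "(LINT z|N. h z * k x z) = (LINT z|N. (f z * k x z) / 2 - (f (reflect z) * k x z) / 2)"
      by (simp add: h_def field_simps)
    also have "\<dots> = (LINT z|N. f z * k x z)"
      using integrable_k[OF fi, of x] integrable_k[OF integrable_reflect[OF fm fi], of x] by (simp add: integral_reflect_k[OF fi])
    finally show "(LINT z|N. h z * k x z) = (LINT z|N. f z * k x z)" .
  qed
  have "S = 1"
  proof (rule ccontr)
    assume "S \<noteq> 1"
    then have S_less: "S < 1" using S1 by simp
    show False
    proof (cases "S = 0")
      \<comment> \<open>A vanishing odd part cannot be rescaled to norm 1, but then the gap is zero,
        contrary to \<open>pos\<close>.\<close>
      case True
      then have "AE z in N. \<bar>h z\<bar> powr r = 0"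
        using integral_nonneg_eq_0_iff_AE[OF hr] by (simp add: S_def)
      then have h0: "AE z in N. h z = 0" by eventually_elim simp
      have "G h \<le> 0"
      proof (rule G_least)
        fix x
        have "AE z in N. h z * k x z = 0" using h0 by eventually_elim simp
        then have "(LINT z|N. h z * k x z) = 0" by (rule integral_eq_zero_AE)
        then show "\<bar>LINT z|N. h z * k x z\<bar> \<le> 0" by simp
      qed
      then show False using Gh pos by simp
    next
      case False
      \<comment> \<open>The reciprocal of the norm of \<open>h\<close>.\<close>
      define c where "c = S powr (- 1 / r)"
      have Spos: "0 < S" using False S0 by simp
      have c: "1 < c"
        unfolding c_def using S_less Spos r powr_less_mono2_neg[of "- 1 / r" S 1] by simp
      have cS: "c powr r * S = 1" 
      proof -
        have "c powr r = S powr (- 1)" unfolding c_def powr_powr using r by simp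
        then show ?thesis using Spos by (simp add: powr_minus)
      qed
      have cr: "\<bar>c * h z\<bar> powr r = c powr r * \<bar>h z\<bar> powr r" for z
        using c by (simp add: abs_mult powr_mult)
      have ch: "(\<lambda>z. c * h z) \<in> lp_sphere N (ereal r)"
        unfolding lp_sphere_finite_iff[OF r] cr using hr cS by (simp add: S_def)
      have "G h \<le> G f / c"
      proof (rule G_least)
        fix x assume x: "x \<in> {0..pi}"
        have "\<bar>LINT z|N. (c * h z) * k x z\<bar> \<le> G f"
          by (rule order_trans[OF G_upper[OF _ x] max[OF ch]]) (use ih in simp)
        then have "c * \<bar>LINT z|N. h z * k x z\<bar> \<le> G f" using c by (simp add: mult.assoc abs_mult)
        then show "\<bar>LINT z|N. h z * k x z\<bar> \<le> G f / c" using c by (simp add: field_simps)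
      qed
      also have "\<dots> < G f" using c pos by (simp add: field_simps)
      finally show False using Gh by simp
    qed
  qed
  \<comment> \<open>A nonnegative function with integral zero vanishes almost everywhere, which
    gives the equality case of \<open>powr_half_diff\<close>.\<close>
  then have "(LINT z|N. (\<bar>f z\<bar> powr r + \<bar>f (reflect z)\<bar> powr r) / 2 - \<bar>h z\<bar> powr r) = 0"
    using mean hr by (simp add: S_def)
  moreover have "integrable N (\<lambda>z. (\<bar>f z\<bar> powr r + \<bar>f (reflect z)\<bar> powr r) / 2 - \<bar>h z\<bar> powr r)" using mean(1) hr by (rule Bochner_Integration.integrable_diff)
  ultimately have "AE z in N. (\<bar>f z\<bar> powr r + \<bar>f (reflect z)\<bar> powr r) / 2 - \<bar>h z\<bar> powr r = 0"
    using integral_nonneg_eq_0_iff_AE[of N "\<lambda>z. (\<bar>f z\<bar> powr r + \<bar>f (reflect z)\<bar> powr r) / 2 - \<bar>h z\<bar> powr r"] hle by simp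
  then show ?thesis
    unfolding odd_in_y_iff
  proof eventually_elim
    case (elim z)
    then show ?case using powr_half_diff(2)[OF r, of "f z" "f (reflect z)"] by (simp add: h_def)
  qed
qed

text \<open>Where \<open>|f| < 1\<close> there is room for the even perturbation \<open>t (1 - |f|)\<close>, which the odd kernel does not see.\<close>

lemma infinitely_many_maximizers:
  assumes f: "f \<in> lp_sphere N \<infinity>" and odd: "odd_in_y l f" and max: "\<And>g. g \<in> lp_sphere N \<infinity> \<Longrightarrow> G g \<le> G f"
    and small: "emeasure N {z \<in> plate l. \<bar>f z\<bar> < 1} > 0"
  shows "infinite ({g. g \<in> lp_sphere N \<infinity> \<and> G g = G f \<and> \<not> (AE z in N. even_part g z = 0)} // ae_eq N)"
proof -
  interpret finite_measure N by (rule fin)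
  obtain f0 m where m: "f0 \<in> lp_sphere N \<infinity>" "0 < m" "G f0 = m"
    and u: "\<And>f s. f \<in> borel_measurable N \<Longrightarrow> (AE z in N. \<bar>f z\<bar> \<le> s) \<Longrightarrow> G f \<le> s * m"
    using extremal_load_infinity by blast
  have fm [measurable]: "f \<in> borel_measurable N" and f1: "AE z in N. \<bar>f z\<bar> \<le> 1"
    using f by (simp_all add: lp_sphere_infinity(1))
  have Gf: "G f = m" using max[OF m(1)] m(3) u[OF fm f1] by simp
  have fi: "integrable N f" by (rule integrable_const_bound[of _ 1]) (use f1 in auto)
  define g where "g t z = f z + t * (1 - \<bar>f z\<bar>)" for t z
  have gm [measurable]: "g t \<in> borel_measurable N" for t unfolding g_def[abs_def] by measurable
  have g1: "AE z in N. \<bar>g t z\<bar> \<le> 1" if "t \<in> {0<..1}" for t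
    using f1
  proof eventually_elim
    case (elim z)
    then have a: "0 \<le> 1 - \<bar>f z\<bar>" by simp
    define y where "y = t * (1 - \<bar>f z\<bar>)"
    have "0 \<le> y" unfolding y_def using a that by simp
    moreover have "y \<le> 1 * (1 - \<bar>f z\<bar>)"
      unfolding y_def by (rule mult_right_mono[OF _ a]) (use that in simp)
    ultimately have "\<bar>f z + y\<bar> \<le> 1" using abs_triangle_ineq[of "f z" y] by simp
    then show ?case by (simp only: g_def y_def)
  qed
  have ih: "integrable N (\<lambda>z. 1 - \<bar>f z\<bar>)" using fi by simp
  have hzero: "(LINT z|N. (1 - \<bar>f z\<bar>) * k x z) = 0" for x
  proof -
    have "(LINT z|N. (1 - \<bar>f (reflect z)\<bar>) * k x z) = (LINT z|N. (1 - \<bar>f z\<bar>) * k x z)"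
      by (rule integral_cong_AE_lebesgue_on[OF plate_sets])
        (use odd[unfolded odd_in_y_iff] in eventually_elim, simp)
    then show ?thesis using integral_reflect_k[OF ih, of x] by simp
  qed
  have Gg: "G (g t) = G f" for t
  proof (rule G_cong)
    fix x
    have "(LINT z|N. g t z * k x z) = (LINT z|N. f z * k x z + t * ((1 - \<bar>f z\<bar>) * k x z))"
      by (simp add: g_def algebra_simps)
    also have "\<dots> = (LINT z|N. f z * k x z)"
      using integrable_k[OF fi, of x] integrable_k[OF ih, of x] by (simp add: hzero)
    finally show "(LINT z|N. g t z * k x z) = (LINT z|N. f z * k x z)" .
  qed
  \<comment> \<open>The gap is still m, so an essential bound s < 1 would give m \<le> s m.\<close>
  have gs: "g t \<in> lp_sphere N \<infinity>" if t: "t \<in> {0<..1}" for t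
    unfolding lp_sphere_infinity(1)
  proof (intro conjI gm g1 t notI)
    assume "\<exists>s<1. AE z in N. \<bar>g t z\<bar> \<le> s"
    then obtain s where s: "s < 1" "AE z in N. \<bar>g t z\<bar> \<le> s" by blast
    have "m \<le> s * m" using u[OF gm s(2)] Gg Gf by simp
    then show False using s(1) m(2) by simp
  qed
  have nz: "\<not> (AE z in N. c * (1 - \<bar>f z\<bar>) = 0)" if c: "c \<noteq> 0" for c
  proof
    assume "AE z in N. c * (1 - \<bar>f z\<bar>) = 0"
    then have "AE z in N. \<not> \<bar>f z\<bar> < 1" by eventually_elim (use c in auto)
    from emeasure_eq_0_AE[OF this] show False using small by simp
  qed
  have ev: "\<not> (AE z in N. even_part (g t) z = 0)" if t: "t \<in> {0<..1}" for t
  proof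
    assume "AE z in N. even_part (g t) z = 0"
    then have "AE z in N. t * (1 - \<bar>f z\<bar>) = 0"
      using odd[unfolded odd_in_y_iff] by eventually_elim (simp add: even_part_eq g_def)
    then show False using nz[of t] t by simp
  qed
  let ?Q = "{g. g \<in> lp_sphere N \<infinity> \<and> G g = G f \<and> \<not> (AE z in N. even_part g z = 0)}"
  \<comment> \<open>Different parameters differ on the set |f| < 1 of positive measure, so the loads
    are distinct as members of L^\<infinity> and not only as functions.\<close>
  have "inj_on (\<lambda>t. ae_eq N `` {g t}) {0<..1}"
  proof (rule inj_onI)
    fix s t assume "ae_eq N `` {g s} = ae_eq N `` {g t}"
    moreover have "g s \<in> ae_eq N `` {g s}" by (simp add: ae_eq_def)
    ultimately have "AE z in N. g t z = g s z" by (simp add: ae_eq_def)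
    then have "AE z in N. (t - s) * (1 - \<bar>f z\<bar>) = 0"
      by eventually_elim (simp add: g_def algebra_simps)
    then show "s = t" using nz[of "t - s"] by auto
  qed
  moreover have "infinite {0<..1::real}" by (rule infinite_Ioc) simp
  ultimately have "infinite ((\<lambda>t. ae_eq N `` {g t}) ` {0<..1})" by (simp add: finite_image_iff)
  moreover have "(\<lambda>t. ae_eq N `` {g t}) ` {0<..1} \<subseteq> ?Q // ae_eq N"
    using gs Gg ev by (auto intro!: quotientI)
  ultimately show ?thesis using finite_subset by blast
qed

text \<open>\<open>\<Gamma>\<close> stands for the maximal gap, which equals \<open>G\<close> for
  integrable loads; the unit spheres consist of such loads because the plate has finite measure.
  Since the overall maximum \<open>m\<close> is attained at an odd load, odd maximizers are exactly
  the odd loads of norm one with \<open>G f = m\<close>.\<close>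

lemma odd_maximization:
  assumes p: "1 < p" and \<Gamma>: "\<And>f. integrable N f \<Longrightarrow> \<Gamma> f = G f"
  shows "(\<exists>f g. is_arg_max \<Gamma> (\<lambda>f. f \<in> lp_sphere N p) f \<and>
      is_arg_max \<Gamma> (\<lambda>f. f \<in> lp_sphere N p \<and> odd_in_y l f) g \<and> \<Gamma> f = \<Gamma> g)
    \<and> (p < \<infinity> \<longrightarrow> (\<forall>f. is_arg_max \<Gamma> (\<lambda>f. f \<in> lp_sphere N p) f \<longrightarrow> odd_in_y l f))
    \<and> (p = \<infinity> \<longrightarrow> (\<forall>f. is_arg_max \<Gamma> (\<lambda>f. f \<in> lp_sphere N p \<and> odd_in_y l f) f \<and>
         emeasure N {z \<in> plate l. \<bar>f z\<bar> < 1} > 0 \<longrightarrow>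
         infinite ({g. is_arg_max \<Gamma> (\<lambda>f. f \<in> lp_sphere N p) g \<and> \<not> (AE z in N. even_part g z = 0) \<and> lp_norm N \<infinity> g = 1}
           // ae_eq N)))"
proof -
  have \<Gamma>G: "\<Gamma> f = G f" if "f \<in> lp_sphere N p" for f using \<Gamma> lp_sphere_integrable[OF fin p that] .
  obtain f0 m where f0: "f0 \<in> lp_sphere N p" "odd_in_y l f0" "0 < m" "G f0 = m"
    and u: "\<And>f. f \<in> lp_sphere N p \<Longrightarrow> G f \<le> m" using extremal_load[OF p] by blast
  have max_iff: "is_arg_max \<Gamma> (\<lambda>f. f \<in> lp_sphere N p) f \<longleftrightarrow> f \<in> lp_sphere N p \<and> G f = m" for f
  proof
    assume "is_arg_max \<Gamma> (\<lambda>f. f \<in> lp_sphere N p) f"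
    then have f: "f \<in> lp_sphere N p" and "\<not> \<Gamma> f < \<Gamma> f0" using f0 unfolding is_arg_max_def by blast+
    then show "f \<in> lp_sphere N p \<and> G f = m" using \<Gamma>G[of f] \<Gamma>G[OF f0(1)] f0(4) u[of f] by auto
  next
    assume "f \<in> lp_sphere N p \<and> G f = m"
    then show "is_arg_max \<Gamma> (\<lambda>f. f \<in> lp_sphere N p) f"
      unfolding is_arg_max_def using \<Gamma>G u by (auto simp: not_less)
  qed
  have odd_iff: "is_arg_max \<Gamma> (\<lambda>f. f \<in> lp_sphere N p \<and> odd_in_y l f) f \<longleftrightarrow> f \<in> lp_sphere N p \<and> odd_in_y l f \<and> G f = m" for f
  proof
    assume "is_arg_max \<Gamma> (\<lambda>f. f \<in> lp_sphere N p \<and> odd_in_y l f) f"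
    then have f: "f \<in> lp_sphere N p \<and> odd_in_y l f" and "\<not> \<Gamma> f < \<Gamma> f0" using f0 unfolding is_arg_max_def by blast+
    then show "f \<in> lp_sphere N p \<and> odd_in_y l f \<and> G f = m" using \<Gamma>G[of f] \<Gamma>G[OF f0(1)] f0(4) u[of f] by auto
  next
    assume "f \<in> lp_sphere N p \<and> odd_in_y l f \<and> G f = m"
    then show "is_arg_max \<Gamma> (\<lambda>f. f \<in> lp_sphere N p \<and> odd_in_y l f) f"
      unfolding is_arg_max_def using \<Gamma>G u by (auto simp: not_less)
  qed
  show ?thesis
    unfolding max_iff odd_iff
  proof (intro conjI impI allI)
    show "\<exists>f g. (f \<in> lp_sphere N p \<and> G f = m) \<and> (g \<in> lp_sphere N p \<and> odd_in_y l g \<and> G g = m) \<and> \<Gamma> f = \<Gamma> g"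
      using f0 by blast
  next
    fix f assume "p < \<infinity>" and f: "f \<in> lp_sphere N p \<and> G f = m"
    then obtain r where r: "p = ereal r" "1 < r" using p by (cases p) (auto simp: one_ereal_def)
    show "odd_in_y l f" by (rule maximizer_odd[OF r(2)]) (use f f0 u r(1) in auto)
  next
    fix f assume inf: "p = \<infinity>"
      and f: "(f \<in> lp_sphere N p \<and> odd_in_y l f \<and> G f = m) \<and> 0 < emeasure N {z \<in> plate l. \<bar>f z\<bar> < 1}"
    have "{g. (g \<in> lp_sphere N p \<and> G g = m) \<and> \<not> (AE z in N. even_part g z = 0) \<and> lp_norm N \<infinity> g = 1}
        = {g. g \<in> lp_sphere N \<infinity> \<and> G g = G f \<and> \<not> (AE z in N. even_part g z = 0)}"
      using f lp_sphere_infinity(2) inf by auto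
    moreover have "infinite ({g. g \<in> lp_sphere N \<infinity> \<and> G g = G f \<and> \<not> (AE z in N. even_part g z = 0)} // ae_eq N)"
      by (rule infinitely_many_maximizers) (use f u inf in auto)
    ultimately show "infinite ({g. (g \<in> lp_sphere N p \<and> G g = m) \<and> \<not> (AE z in N. even_part g z = 0) \<and> lp_norm N \<infinity> g = 1} // ae_eq N)"
      by simp
  qed
qed

end

sublocale loaded_plate \<subseteq> odd_kernel l "2 * C\<^sup>2" kernel
proof
  show "0 < l" by (rule l)
  show "kernel x \<in> borel_measurable (lebesgue_on (plate l))" for x by (rule kernel_measurable)
  show "\<bar>kernel x z\<bar> \<le> 2 * C\<^sup>2" for x z by (rule kernel_bounded)
  show "kernel x (reflect z) = - kernel x z" if "z \<in> plate l" for x z using that by (rule kernel_odd)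
  show "continuous_on {0..pi} (\<lambda>x. kernel x z)" for z by (rule kernel_continuous)
  show "\<not> (AE z in lebesgue_on (plate l). kernel (pi / 2) z = 0)" by (rule kernel_nontrivial)
qed

theorem theorem4p2:
  fixes l \<sigma> d :: real and p :: ereal and D :: "(real \<times> real) set"
    and E :: "(real \<times> real \<Rightarrow> real) \<Rightarrow> (real \<times> real \<Rightarrow> real) \<Rightarrow> real"
  assumes "l > 0" and "0 < \<sigma>" and "\<sigma> < 1" and "d > 0"
    and "open D" and "D \<subseteq> plate l"
    and "\<forall>x y. (x, y) \<in> plate l \<longrightarrow> ((x, y) \<in> D \<longleftrightarrow> (x, - y) \<in> D)"
    and "1 < p"
    and "E = energy1 l \<sigma> d D \<or> E = energy2 l \<sigma> d D"
  defines "M \<equiv> lebesgue_on (plate l)"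
  defines "maximizer \<equiv> is_arg_max (maximal_gap l E) (\<lambda>f. f \<in> lp_sphere M p)"
  defines "odd_maximizer \<equiv>
    is_arg_max (maximal_gap l E) (\<lambda>f. f \<in> lp_sphere M p \<and> odd_in_y l f)"
  shows "(\<exists>f g. maximizer f \<and> odd_maximizer g \<and> maximal_gap l E f = maximal_gap l E g)
    \<and> (p < \<infinity> \<longrightarrow> (\<forall>f. maximizer f \<longrightarrow> odd_in_y l f))
    \<and> (p = \<infinity> \<longrightarrow> (\<forall>f. odd_maximizer f \<and> emeasure M {z \<in> plate l. \<bar>f z\<bar> < 1} > 0 \<longrightarrow>
         infinite ({g. maximizer g \<and> \<not> (AE z in M. even_part g z = 0) \<and> lp_norm M \<infinity> g = 1}
           // ae_eq M)))"
proof -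
  have "D \<in> sets lebesgue" using assms(5) by (simp add: borel_open)
  then have D: "(indicator D :: real \<times> real \<Rightarrow> real) \<in> borel_measurable (lebesgue_on (plate l))"
    by (intro measurable_restrict_space1) simp
  have refl: "indicator D (reflect z) = (indicator D z :: real)" if "z \<in> plate l" for z
    using assms(7) that by (cases z) (auto simp: reflect_def indicator_def)
  show ?thesis
    using assms(9)
  proof
    assume E: "E = energy1 l \<sigma> d D"
    interpret P: loaded_plate l \<sigma> "1 + d" "\<lambda>z. 1 + d * indicator D z" "\<lambda>z. 1"
    proof
      show "(\<lambda>z. 1 + d * indicator D z) \<in> borel_measurable (lebesgue_on (plate l))" using D by measurable
      show "1 \<le> 1 + d * indicator D z" "1 + d * indicator D z \<le> 1 + d" for z
        using assms(4) by (auto simp: indicator_def)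
    qed (use assms(1-3) refl in simp_all)
    have "E = P.E" unfolding E by (simp add: fun_eq_iff P.E_def energy1_def)
    then have "maximal_gap l E f = P.G f" if "integrable P.N f" for f
      using P.maximal_gap_eq[OF that] by (simp add: P.G_def)
    from P.odd_maximization[OF assms(8) this] show ?thesis
      unfolding M_def maximizer_def odd_maximizer_def .
  next
    assume E: "E = energy2 l \<sigma> d D"
    interpret P: loaded_plate l \<sigma> 1 "\<lambda>z. 1" "\<lambda>z. 1 / (1 + d * indicator D z)"
    proof
      show "(\<lambda>z. 1 / (1 + d * indicator D z)) \<in> borel_measurable (lebesgue_on (plate l))" using D by measurable
      show "0 < 1 / (1 + d * indicator D z)" "1 / (1 + d * indicator D z) \<le> 1" for z
        using assms(4) by (auto simp: indicator_def)
    qed (use assms(1-3) refl in simp_all)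
    have "E = P.E" unfolding E by (simp add: fun_eq_iff P.E_def energy2_def)
    then have "maximal_gap l E f = P.G f" if "integrable P.N f" for f
      using P.maximal_gap_eq[OF that] by (simp add: P.G_def)
    from P.odd_maximization[OF assms(8) this] show ?thesis
      unfolding M_def maximizer_def odd_maximizer_def .
  qed
qed

end
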